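(* Let $R$ be an integral domain which is not a field and such that $R/(m)$ is finite for every $m\in R\setminus\{0\}$. Then the $C^*$-algebra $\mathfrak{A}[R]$ is simple.
   Context: An integral domain is a unital commutative ring without zero divisors. $R^\times=R\setminus\{0\}$. The algebra $\mathfrak{A}[R]$ is the universal $C^*$-algebra generated by isometries $\{s_m : m\in R^\times\}$ and unitaries $\{u^n : n\in R\}$ subject to: (CL1) $s_ms_{m'}=s_{mm'}$; (CL2) $u^nu^{n'}=u^{n+n'}$; (CL3) $s_mu^n=u^{mn}s_m$; (CL4) $\sum_{l+(m)\in R/(m)}u^ls_ms_m^*u^{-l}=1$, for all $m,m'\in R^\times$, $n,n'\in R$. (The summands in (CL4) do not depend on the choice of representative $l$.) A $C^*$-algebra is simple if it has no closed two-sided ideals other than $0$ and itself. *)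

theory Defs
  imports "HOL-Analysis.Analysis" "HOL-Library.Poly_Mapping"
begin

section \<open>Unital C*-algebras\<close>

class scaleC =
  fixes scaleC :: "complex \<Rightarrow> 'a \<Rightarrow> 'a"  (infixr \<open>*\<^sub>C\<close> 75)

class star =
  fixes star :: "'a \<Rightarrow> 'a"

text \<open>Unital complex *-algebras. \<open>0 = 1\<close> is not excluded, hence \<open>ring + monoid_mult\<close>
  instead of \<open>ring_1\<close>.\<close>

class star_algebra = ring + monoid_mult + scaleC + star +
  assumes scaleC_add_right: "c *\<^sub>C (x + y) = c *\<^sub>C x + c *\<^sub>C y"
    and scaleC_add_left: "(c + d) *\<^sub>C x = c *\<^sub>C x + d *\<^sub>C x"
    and scaleC_scaleC: "c *\<^sub>C d *\<^sub>C x = (c * d) *\<^sub>C x"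
    and scaleC_one: "1 *\<^sub>C x = x"
    and mult_scaleC_left: "(c *\<^sub>C x) * y = c *\<^sub>C (x * y)"
    and mult_scaleC_right: "x * (c *\<^sub>C y) = c *\<^sub>C (x * y)"
    and star_add: "star (x + y) = star x + star y"
    and star_scaleC: "star (c *\<^sub>C x) = cnj c *\<^sub>C star x"
    and star_mult: "star (x * y) = star y * star x"
    and star_star: "star (star x) = x"

text \<open>Here \<open>real_normed_algebra\<close> supplies the norm, its topology and submultiplicativity; the real
  scalar multiplication it carries is forced to be the restriction of the complex one.\<close>

class pre_cstar_algebra = star_algebra + real_normed_algebra +
  assumes scaleR_scaleC: "r *\<^sub>R x = complex_of_real r *\<^sub>C x"
    and norm_scaleC: "norm (c *\<^sub>C x) = cmod c * norm x"
    and cstar_identity: "norm (star x * x) = (norm x)\<^sup>2"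

class cstar_algebra = pre_cstar_algebra + complete_space

definition star_hom :: "('a::star_algebra \<Rightarrow> 'b::star_algebra) \<Rightarrow> bool" where
  "star_hom \<phi> \<longleftrightarrow> (\<forall>x y. \<phi> (x + y) = \<phi> x + \<phi> y) \<and> (\<forall>c x. \<phi> (c *\<^sub>C x) = c *\<^sub>C \<phi> x) \<and>
     (\<forall>x y. \<phi> (x * y) = \<phi> x * \<phi> y) \<and> (\<forall>x. \<phi> (star x) = star (\<phi> x)) \<and> \<phi> 1 = 1"

definition closed_two_sided_ideal :: "'a::cstar_algebra set \<Rightarrow> bool" where
  "closed_two_sided_ideal I \<longleftrightarrow> closed I \<and> 0 \<in> I \<and> (\<forall>x\<in>I. \<forall>y\<in>I. x + y \<in> I) \<and>
     (\<forall>c. \<forall>x\<in>I. c *\<^sub>C x \<in> I) \<and> (\<forall>a. \<forall>x\<in>I. a * x \<in> I \<and> x * a \<in> I)"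

definition simple_cstar_algebra :: "'a::cstar_algebra itself \<Rightarrow> bool" where
  "simple_cstar_algebra _ \<longleftrightarrow> (\<forall>I :: 'a set. closed_two_sided_ideal I \<longrightarrow> I = {0} \<or> I = UNIV)"

lemma star_homD:
  assumes "star_hom \<phi>"
  shows "\<phi> (x + y) = \<phi> x + \<phi> y" "\<phi> (c *\<^sub>C x) = c *\<^sub>C \<phi> x" "\<phi> (x * y) = \<phi> x * \<phi> y"
    "\<phi> (star x) = star (\<phi> x)" "\<phi> 1 = 1"
  using assms by (auto simp: star_hom_def)

lemma scaleC_zero_right [simp]: "c *\<^sub>C (0::'a::star_algebra) = 0"
  using scaleC_add_right[of c "0::'a" 0] by simp

lemma scaleC_zero_left [simp]: "0 *\<^sub>C (x::'a::star_algebra) = 0"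
  using scaleC_add_left[of 0 0 x] by simp

lemma scaleC_minus_one: "(-1) *\<^sub>C (x::'a::star_algebra) = - x"
  using scaleC_add_left[of 1 "-1" x] by (simp add: scaleC_one add_eq_0_iff)

lemma scaleC_diff_right: "c *\<^sub>C ((x::'a::star_algebra) - y) = c *\<^sub>C x - c *\<^sub>C y"
  by (metis scaleC_add_right add_diff_cancel diff_add_cancel)

lemma star_zero [simp]: "star (0::'a::star_algebra) = 0"
  using star_add[of "0::'a" 0] by simp

lemma star_minus: "star (- x) = - star (x::'a::star_algebra)"
  by (metis add.right_inverse minus_unique star_add star_zero)

lemma star_diff: "star (x - y) = star x - star (y::'a::star_algebra)"
  by (metis diff_conv_add_uminus star_add star_minus)

lemma star_one [simp]: "star (1::'a::star_algebra) = 1"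
  by (metis mult_1_left mult_1_right star_mult star_star)

lemma star_hom_zero: "star_hom \<phi> \<Longrightarrow> \<phi> 0 = 0"
  using star_homD(1)[of \<phi> 0 0] by simp

lemma star_hom_minus: "star_hom \<phi> \<Longrightarrow> \<phi> (- x) = - \<phi> x"
  by (metis star_homD(2) scaleC_minus_one)

lemma star_hom_diff: "star_hom \<phi> \<Longrightarrow> \<phi> (x - y) = \<phi> x - \<phi> y"
  by (metis diff_conv_add_uminus star_homD(1) star_hom_minus)

lemma star_hom_sum: "star_hom \<phi> \<Longrightarrow> \<phi> (sum f A) = (\<Sum>i\<in>A. \<phi> (f i))"
  by (induction A rule: infinite_finite_induct) (auto simp: star_hom_zero star_homD)

lemma norm_star: "norm (star x) = norm (x::'a::pre_cstar_algebra)"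
proof -
  have *: "norm x \<le> norm (star x)" for x :: 'a
  proof (cases "norm x = 0")
    case False
    have "norm x * norm x \<le> norm (star x) * norm x"
      using norm_mult_ineq[of "star x" x] cstar_identity[of x] by (simp add: power2_eq_square)
    then show ?thesis using False by (simp add: mult_le_cancel_right)
  qed simp
  show ?thesis using *[of x] *[of "star x"] by (simp add: star_star)
qed


section \<open>Completion of a normed *-algebra with the C*-identity\<close>

definition completion_rel :: "(nat \<Rightarrow> 'a::pre_cstar_algebra) \<Rightarrow> (nat \<Rightarrow> 'a) \<Rightarrow> bool" where
  "completion_rel X Y \<longleftrightarrow> Cauchy X \<and> Cauchy Y \<and> (\<lambda>n. X n - Y n) \<longlonglongrightarrow> 0"

lemma part_equivp_completion_rel: "part_equivp completion_rel"
proof (rule part_equivpI)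
  have "completion_rel (\<lambda>_. 0::'a) (\<lambda>_. 0)"
    by (simp add: completion_rel_def convergent_Cauchy convergent_const)
  then show "\<exists>X::nat \<Rightarrow> 'a. completion_rel X X" by blast
  show "symp (completion_rel :: (nat \<Rightarrow> 'a) \<Rightarrow> _)"
  proof (rule sympI)
    fix X Y :: "nat \<Rightarrow> 'a" assume "completion_rel X Y"
    then show "completion_rel Y X"
      using tendsto_minus[of "\<lambda>n. X n - Y n" 0 sequentially] by (simp add: completion_rel_def)
  qed
  show "transp (completion_rel :: (nat \<Rightarrow> 'a) \<Rightarrow> _)"
  proof (rule transpI)
    fix X Y Z :: "nat \<Rightarrow> 'a"
    assume a: "completion_rel X Y" "completion_rel Y Z"
    then have "(\<lambda>n. (X n - Y n) + (Y n - Z n)) \<longlonglongrightarrow> 0 + 0"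
      unfolding completion_rel_def by (intro tendsto_add) auto
    then show "completion_rel X Z" using a by (simp add: completion_rel_def)
  qed
qed

quotient_type (overloaded) 'a completion = "nat \<Rightarrow> 'a::pre_cstar_algebra" / partial: completion_rel
  by (rule part_equivp_completion_rel)

lemma Cauchy_contraction:
  fixes X :: "nat \<Rightarrow> 'a::real_normed_vector" and Y :: "nat \<Rightarrow> 'b::real_normed_vector"
  assumes "Cauchy X" "\<And>m n. norm (Y m - Y n) \<le> C * norm (X m - X n)"
  shows "Cauchy Y"
proof (rule CauchyI)
  fix e :: real assume e: "e > 0"
  define D where "D = \<bar>C\<bar> + 1"
  have D: "D > 0" "C \<le> D" by (auto simp: D_def)
  then obtain M where M: "\<And>m n. m \<ge> M \<Longrightarrow> n \<ge> M \<Longrightarrow> norm (X m - X n) < e / D"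
    using CauchyD[OF assms(1), of "e / D"] e by auto
  have "norm (Y m - Y n) < e" if "m \<ge> M" "n \<ge> M" for m n
  proof -
    have "norm (Y m - Y n) \<le> D * norm (X m - X n)"
      using assms(2)[of m n] D(2) mult_right_mono[OF D(2), of "norm (X m - X n)"] by auto
    also have "\<dots> < D * (e / D)" using M[OF that] D by (intro mult_strict_left_mono) auto
    finally show ?thesis using D by simp
  qed
  then show "\<exists>M. \<forall>m\<ge>M. \<forall>n\<ge>M. norm (Y m - Y n) < e" by blast
qed

lemma Cauchy_plus:
  fixes X Y :: "nat \<Rightarrow> 'a::real_normed_vector"
  assumes "Cauchy X" "Cauchy Y"
  shows "Cauchy (\<lambda>n. X n + Y n)"
proof (rule CauchyI)
  fix e :: real assume e: "e > 0"
  obtain M where M: "\<And>m n. m \<ge> M \<Longrightarrow> n \<ge> M \<Longrightarrow> norm (X m - X n) < e / 2"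
    using CauchyD[OF assms(1), of "e / 2"] e by auto
  obtain N where N: "\<And>m n. m \<ge> N \<Longrightarrow> n \<ge> N \<Longrightarrow> norm (Y m - Y n) < e / 2"
    using CauchyD[OF assms(2), of "e / 2"] e by auto
  have "norm (X m + Y m - (X n + Y n)) < e" if "m \<ge> max M N" "n \<ge> max M N" for m n
    using M[of m n] N[of m n] that norm_triangle_ineq[of "X m - X n" "Y m - Y n"]
    by (simp add: algebra_simps)
  then show "\<exists>M. \<forall>m\<ge>M. \<forall>n\<ge>M. norm (X m + Y m - (X n + Y n)) < e" by blast
qed

lemma Cauchy_uminus: "Cauchy X \<Longrightarrow> Cauchy (\<lambda>n. - X n)"
  for X :: "nat \<Rightarrow> 'a::real_normed_vector"
  by (rule Cauchy_contraction[of X _ 1]) (auto simp: norm_minus_commute)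

lemma Cauchy_times:
  fixes X Y :: "nat \<Rightarrow> 'a::real_normed_algebra"
  assumes "Cauchy X" "Cauchy Y"
  shows "Cauchy (\<lambda>n. X n * Y n)"
proof (rule CauchyI)
  fix e :: real assume e: "e > 0"
  obtain B where B: "B > 0" "\<And>n. norm (X n) \<le> B"
    using Cauchy_Bseq[OF assms(1)] by (auto elim: BseqE)
  obtain C where C: "C > 0" "\<And>n. norm (Y n) \<le> C"
    using Cauchy_Bseq[OF assms(2)] by (auto elim: BseqE)
  obtain M where M: "\<And>m n. m \<ge> M \<Longrightarrow> n \<ge> M \<Longrightarrow> norm (X m - X n) < e / (2 * C)"
    using CauchyD[OF assms(1), of "e / (2 * C)"] e C by auto
  obtain N where N: "\<And>m n. m \<ge> N \<Longrightarrow> n \<ge> N \<Longrightarrow> norm (Y m - Y n) < e / (2 * B)"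
    using CauchyD[OF assms(2), of "e / (2 * B)"] e B by auto
  have "norm (X m * Y m - X n * Y n) < e" if "m \<ge> max M N" "n \<ge> max M N" for m n
  proof -
    have "X m * Y m - X n * Y n = X m * (Y m - Y n) + (X m - X n) * Y n"
      by (simp add: algebra_simps)
    also have "norm \<dots> \<le> norm (X m) * norm (Y m - Y n) + norm (X m - X n) * norm (Y n)"
      by (meson add_mono norm_mult_ineq norm_triangle_le)
    also have "\<dots> \<le> B * norm (Y m - Y n) + norm (X m - X n) * C"
      using B C by (intro add_mono mult_mono) auto
    also have "\<dots> < B * (e / (2 * B)) + e / (2 * C) * C"
      using M[of m n] N[of m n] that B(1) C(1)
      by (intro add_strict_mono mult_strict_left_mono mult_strict_right_mono) auto
    also have "\<dots> = e" using B(1) C(1) by (simp add: field_simps)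
    finally show ?thesis .
  qed
  then show "\<exists>M. \<forall>m\<ge>M. \<forall>n\<ge>M. norm (X m * Y m - X n * Y n) < e" by blast
qed

lemma Cauchy_norm: "Cauchy (\<lambda>n. norm (X n))" if "Cauchy X" for X :: "nat \<Rightarrow> 'a::real_normed_vector"
  using that by (rule Cauchy_contraction[of X _ 1]) (auto simp: norm_triangle_ineq3)

lemma Cauchy_norm_lim: "(\<lambda>n. norm (X n)) \<longlonglongrightarrow> lim (\<lambda>n. norm (X n))" if "Cauchy X"
  for X :: "nat \<Rightarrow> 'a::real_normed_vector"
  using Cauchy_norm[OF that] Cauchy_convergent convergent_LIMSEQ_iff by blast

lemma completion_relI:
  "Cauchy X \<Longrightarrow> Cauchy Y \<Longrightarrow> (\<lambda>n. X n - Y n) \<longlonglongrightarrow> 0 \<Longrightarrow> completion_rel X Y"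
  by (simp add: completion_rel_def)

lemma completion_rel_lim:
  assumes "completion_rel X Y"
  shows "lim (\<lambda>n. norm (X n)) = lim (\<lambda>n. norm (Y n))"
proof -
  from assms have X: "Cauchy X" and Y: "Cauchy Y" and XY: "(\<lambda>n. X n - Y n) \<longlonglongrightarrow> 0"
    by (auto simp: completion_rel_def)
  have "(\<lambda>n. norm (X n - Y n)) \<longlonglongrightarrow> 0" using XY tendsto_norm_zero by blast
  then have "(\<lambda>n. norm (X n) - norm (Y n)) \<longlonglongrightarrow> 0"
    by (rule Lim_null_comparison[rotated]) (auto simp: norm_triangle_ineq3)
  moreover have "(\<lambda>n. norm (X n) - norm (Y n)) \<longlonglongrightarrow> lim (\<lambda>n. norm (X n)) - lim (\<lambda>n. norm (Y n))"
    using X Y by (intro tendsto_diff Cauchy_norm_lim)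
  ultimately show ?thesis using LIMSEQ_unique by fastforce
qed

lemma completion_rel_contraction:
  fixes X Y :: "nat \<Rightarrow> 'a::pre_cstar_algebra"
  assumes "completion_rel X Y" "\<And>x y. norm (f x - f y) \<le> C * norm (x - y)"
  shows "completion_rel (\<lambda>n. f (X n)) (\<lambda>n. f (Y n) :: 'a)"
proof (rule completion_relI)
  from assms(1) have X: "Cauchy X" and Y: "Cauchy Y" and XY: "(\<lambda>n. X n - Y n) \<longlonglongrightarrow> 0"
    by (auto simp: completion_rel_def)
  show "Cauchy (\<lambda>n. f (X n))" by (rule Cauchy_contraction[OF X assms(2)])
  show "Cauchy (\<lambda>n. f (Y n))" by (rule Cauchy_contraction[OF Y assms(2)])
  have "(\<lambda>n. C * norm (X n - Y n)) \<longlonglongrightarrow> C * 0"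
    using XY by (intro tendsto_mult tendsto_const tendsto_norm_zero)
  then show "(\<lambda>n. f (X n) - f (Y n)) \<longlonglongrightarrow> 0"
    by (intro Lim_null_comparison[of "\<lambda>n. f (X n) - f (Y n)" "\<lambda>n. C * norm (X n - Y n)"])
       (auto intro!: always_eventually assms(2))
qed

lemma Cauchy_constant: "Cauchy (\<lambda>_::nat. a)" for a :: "'a::real_normed_vector"
  by (simp add: convergent_Cauchy convergent_const)

instantiation completion :: (pre_cstar_algebra) pre_cstar_algebra
begin

lift_definition zero_completion :: "'a completion" is "\<lambda>_. 0"
  by (simp add: completion_rel_def Cauchy_constant)

lift_definition one_completion :: "'a completion" is "\<lambda>_. 1"
  by (simp add: completion_rel_def Cauchy_constant)

lift_definition plus_completion :: "'a completion \<Rightarrow> 'a completion \<Rightarrow> 'a completion"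
  is "\<lambda>X Y n. X n + Y n"
proof -
  fix X X' Y Y' :: "nat \<Rightarrow> 'a"
  assume "completion_rel X X'" "completion_rel Y Y'"
  then show "completion_rel (\<lambda>n. X n + Y n) (\<lambda>n. X' n + Y' n)"
    using tendsto_add[of "\<lambda>n. X n - X' n" 0 sequentially "\<lambda>n. Y n - Y' n" 0]
    by (auto simp: completion_rel_def algebra_simps intro: Cauchy_plus)
qed

lift_definition uminus_completion :: "'a completion \<Rightarrow> 'a completion" is "\<lambda>X n. - X n"
  by (erule completion_rel_contraction[of _ _ uminus 1]) (simp add: norm_minus_commute)

definition minus_completion :: "'a completion \<Rightarrow> 'a completion \<Rightarrow> 'a completion" where
  "x - y = x + (- y)" for x y :: "'a completion"

lift_definition times_completion :: "'a completion \<Rightarrow> 'a completion \<Rightarrow> 'a completion"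
  is "\<lambda>X Y n. X n * Y n"
proof (rule completion_relI)
  fix X X' Y Y' :: "nat \<Rightarrow> 'a"
  assume a: "completion_rel X X'" "completion_rel Y Y'"
  then have c: "Cauchy X" "Cauchy Y" "Cauchy X'" "Cauchy Y'"
    and l: "(\<lambda>n. X n - X' n) \<longlonglongrightarrow> 0" "(\<lambda>n. Y n - Y' n) \<longlonglongrightarrow> 0"
    by (auto simp: completion_rel_def)
  show "Cauchy (\<lambda>n. X n * Y n)" "Cauchy (\<lambda>n. X' n * Y' n)" using c by (auto intro: Cauchy_times)
  have "(\<lambda>n. X n * (Y n - Y' n)) \<longlonglongrightarrow> 0"
    using Cauchy_Bseq[OF c(1)] l(2)
      bounded_bilinear.Bfun_prod_Zfun[OF bounded_bilinear_mult, of X sequentially "\<lambda>n. Y n - Y' n"]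
    by (simp add: tendsto_Zfun_iff)
  moreover have "(\<lambda>n. (X n - X' n) * Y' n) \<longlonglongrightarrow> 0"
    using Cauchy_Bseq[OF c(4)] l(1)
      bounded_bilinear.Zfun_prod_Bfun[OF bounded_bilinear_mult, of "\<lambda>n. X n - X' n" sequentially Y']
    by (simp add: tendsto_Zfun_iff)
  ultimately have "(\<lambda>n. X n * (Y n - Y' n) + (X n - X' n) * Y' n) \<longlonglongrightarrow> 0 + 0" by (rule tendsto_add)
  then show "(\<lambda>n. X n * Y n - X' n * Y' n) \<longlonglongrightarrow> 0" by (simp add: algebra_simps)
qed

lift_definition scaleC_completion :: "complex \<Rightarrow> 'a completion \<Rightarrow> 'a completion"
  is "\<lambda>c X n. c *\<^sub>C X n"
  by (rule completion_rel_contraction)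
     (auto simp: scaleC_diff_right[symmetric] norm_scaleC)

definition scaleR_completion :: "real \<Rightarrow> 'a completion \<Rightarrow> 'a completion" where
  "r *\<^sub>R x = complex_of_real r *\<^sub>C x" for x :: "'a completion"

lift_definition star_completion :: "'a completion \<Rightarrow> 'a completion" is "\<lambda>X n. star (X n)"
  by (erule completion_rel_contraction[of _ _ star 1]) (simp add: star_diff[symmetric] norm_star)

lift_definition norm_completion :: "'a completion \<Rightarrow> real" is "\<lambda>X. lim (\<lambda>n. norm (X n))"
  by (rule completion_rel_lim)

definition dist_completion :: "'a completion \<Rightarrow> 'a completion \<Rightarrow> real" where
  "dist x y = norm (x - y)" for x y :: "'a completion"

definition sgn_completion :: "'a completion \<Rightarrow> 'a completion" where
  "sgn x = inverse (norm x) *\<^sub>R x" for x :: "'a completion"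

definition uniformity_completion :: "('a completion \<times> 'a completion) filter" where
  "uniformity_completion = (INF e\<in>{0 <..}. principal {(x, y). dist x y < e})"

definition open_completion :: "'a completion set \<Rightarrow> bool" where
  "open U = (\<forall>x\<in>U. eventually (\<lambda>(x', y). x' = x \<longrightarrow> y \<in> U) uniformity)" for U :: "'a completion set"

lemma completion_rel_eq: "completion_rel X X \<Longrightarrow> (\<And>n. X n = Y n) \<Longrightarrow> completion_rel X Y"
proof -
  assume "completion_rel X X" "\<And>n. X n = Y n"
  then show ?thesis by (metis ext)
qed

lemma completion_rel_Cauchy: "completion_rel X X \<longleftrightarrow> Cauchy X"
  by (simp add: completion_rel_def)

instance
proof
  fix x y z :: "'a completion" and c d :: complex and r s :: real
  note C = completion_rel_Cauchy Cauchy_plus Cauchy_uminus Cauchy_times Cauchy_constant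
  have CC: "Cauchy (\<lambda>n. c *\<^sub>C X n)" if "Cauchy X" for c and X :: "nat \<Rightarrow> 'a"
    using that by (rule Cauchy_contraction[of _ _ "cmod c"])
      (simp add: scaleC_diff_right[symmetric] norm_scaleC)
  have CS: "Cauchy (\<lambda>n. star (X n))" if "Cauchy X" for X :: "nat \<Rightarrow> 'a"
    using that by (rule Cauchy_contraction[of _ _ 1]) (simp add: star_diff[symmetric] norm_star)
  show "(x + y) + z = x + (y + z)"
    by transfer (auto intro!: completion_rel_eq simp: C add.assoc)
  show comm: "x + y = y + x"
    by transfer (auto intro!: completion_rel_eq simp: C add.commute)
  show "0 + x = x"
    by transfer (auto intro!: completion_rel_eq simp: C)
  show "- x + x = 0"
    by transfer (auto intro!: completion_rel_eq simp: C)
  show "x - y = x + - y" by (rule minus_completion_def)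
  show "(x * y) * z = x * (y * z)"
    by transfer (auto intro!: completion_rel_eq simp: C mult.assoc)
  show "1 * x = x" by transfer (auto intro!: completion_rel_eq simp: C)
  show "x * 1 = x" by transfer (auto intro!: completion_rel_eq simp: C)
  show "(x + y) * z = x * z + y * z"
    by transfer (auto intro!: completion_rel_eq simp: C distrib_right)
  show "x * (y + z) = x * y + x * z"
    by transfer (auto intro!: completion_rel_eq simp: C distrib_left)
  show c1: "c *\<^sub>C (x + y) = c *\<^sub>C x + c *\<^sub>C y"
    for c and x y :: "'a completion"
    by transfer (auto intro!: completion_rel_eq simp: C CC scaleC_add_right)
  show c2: "(c + d) *\<^sub>C x = c *\<^sub>C x + d *\<^sub>C x" for c d
    by transfer (auto intro!: completion_rel_eq simp: C CC scaleC_add_left)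
  show c3: "c *\<^sub>C d *\<^sub>C x = (c * d) *\<^sub>C x" for c d
    by transfer (auto intro!: completion_rel_eq simp: C CC scaleC_scaleC)
  show c4: "1 *\<^sub>C x = x"
    by transfer (auto intro!: completion_rel_eq simp: C CC scaleC_one)
  show c5: "(c *\<^sub>C x) * y = c *\<^sub>C (x * y)" for c
    by transfer (auto intro!: completion_rel_eq simp: C CC mult_scaleC_left)
  show c6: "x * (c *\<^sub>C y) = c *\<^sub>C (x * y)" for c
    by transfer (auto intro!: completion_rel_eq simp: C CC mult_scaleC_right)
  show "star (x + y) = star x + star y"
    by transfer (auto intro!: completion_rel_eq simp: C CS star_add)
  show "star (c *\<^sub>C x) = cnj c *\<^sub>C star x"
    by transfer (auto intro!: completion_rel_eq simp: C CS CC star_scaleC)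
  show "star (x * y) = star y * star x"
    by transfer (auto intro!: completion_rel_eq simp: C CS star_mult)
  show "star (star x) = x"
    by transfer (auto intro!: completion_rel_eq simp: C CS star_star)
  show "r *\<^sub>R (x + y) = r *\<^sub>R x + r *\<^sub>R y" "(r + s) *\<^sub>R x = r *\<^sub>R x + s *\<^sub>R x"
    "r *\<^sub>R s *\<^sub>R x = (r * s) *\<^sub>R x" "1 *\<^sub>R x = x" "(r *\<^sub>R x) * y = r *\<^sub>R (x * y)"
    "x * (r *\<^sub>R y) = r *\<^sub>R (x * y)"
    by (simp_all add: scaleR_completion_def c1 c2 c3 c4 c5 c6)
  show "dist x y = norm (x - y)" by (rule dist_completion_def)
  show "sgn x = inverse (norm x) *\<^sub>R x" by (rule sgn_completion_def)
  show "uniformity = (INF e\<in>{0 <..}. principal {(x, y::'a completion). dist x y < e})"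
    by (rule uniformity_completion_def)
  show "open U = (\<forall>x\<in>U. \<forall>\<^sub>F (x', y) in uniformity. x' = x \<longrightarrow> y \<in> U)" for U :: "'a completion set"
    by (rule open_completion_def)
  show "r *\<^sub>R x = complex_of_real r *\<^sub>C x" by (rule scaleR_completion_def)
  show n: "norm (c *\<^sub>C x) = cmod c * norm x" for c
  proof transfer
    fix c and X :: "nat \<Rightarrow> 'a" assume "completion_rel X X"
    then have "Cauchy X" by (simp add: completion_rel_Cauchy)
    then have "(\<lambda>n. cmod c * norm (X n)) \<longlonglongrightarrow> cmod c * lim (\<lambda>n. norm (X n))"
      by (intro tendsto_mult tendsto_const Cauchy_norm_lim)
    then show "lim (\<lambda>n. norm (c *\<^sub>C X n)) = cmod c * lim (\<lambda>n. norm (X n))"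
      by (simp add: norm_scaleC limI)
  qed
  show "norm (r *\<^sub>R x) = \<bar>r\<bar> * norm x" by (simp add: scaleR_completion_def n)
  show "norm x = 0 \<longleftrightarrow> x = 0"
  proof transfer
    fix X :: "nat \<Rightarrow> 'a" assume "completion_rel X X"
    then have X: "Cauchy X" by (simp add: completion_rel_Cauchy)
    have "lim (\<lambda>n. norm (X n)) = 0 \<longleftrightarrow> (\<lambda>n. norm (X n)) \<longlonglongrightarrow> 0"
      using Cauchy_norm_lim[OF X] by (metis limI)
    also have "\<dots> \<longleftrightarrow> X \<longlonglongrightarrow> 0" by (rule tendsto_norm_zero_iff)
    finally show "lim (\<lambda>n. norm (X n)) = 0 \<longleftrightarrow> completion_rel X (\<lambda>_. 0)"
      using X by (simp add: completion_rel_def Cauchy_constant)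
  qed
  show "norm (x + y) \<le> norm x + norm y"
  proof transfer
    fix X Y :: "nat \<Rightarrow> 'a" assume "completion_rel X X" "completion_rel Y Y"
    then have XY: "Cauchy X" "Cauchy Y" by (simp_all add: completion_rel_Cauchy)
    show "lim (\<lambda>n. norm (X n + Y n)) \<le> lim (\<lambda>n. norm (X n)) + lim (\<lambda>n. norm (Y n))"
      by (rule LIMSEQ_le[OF Cauchy_norm_lim[OF Cauchy_plus[OF XY]]
            tendsto_add[OF Cauchy_norm_lim[OF XY(1)] Cauchy_norm_lim[OF XY(2)]]])
         (auto intro: norm_triangle_ineq)
  qed
  show "norm (x * y) \<le> norm x * norm y"
  proof transfer
    fix X Y :: "nat \<Rightarrow> 'a" assume "completion_rel X X" "completion_rel Y Y"
    then have XY: "Cauchy X" "Cauchy Y" by (simp_all add: completion_rel_Cauchy)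
    show "lim (\<lambda>n. norm (X n * Y n)) \<le> lim (\<lambda>n. norm (X n)) * lim (\<lambda>n. norm (Y n))"
      by (rule LIMSEQ_le[OF Cauchy_norm_lim[OF Cauchy_times[OF XY]]
            tendsto_mult[OF Cauchy_norm_lim[OF XY(1)] Cauchy_norm_lim[OF XY(2)]]])
         (auto intro: norm_mult_ineq)
  qed
  show "norm (star x * x) = (norm x)\<^sup>2"
  proof transfer
    fix X :: "nat \<Rightarrow> 'a" assume "completion_rel X X"
    then have "Cauchy X" by (simp add: completion_rel_Cauchy)
    then have "(\<lambda>n. (norm (X n))\<^sup>2) \<longlonglongrightarrow> (lim (\<lambda>n. norm (X n)))\<^sup>2"
      by (intro tendsto_power Cauchy_norm_lim)
    then show "lim (\<lambda>n. norm (star (X n) * X n)) = (lim (\<lambda>n. norm (X n)))\<^sup>2"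
      by (simp add: cstar_identity limI)
  qed
qed

end

lift_definition of_pre :: "'a::pre_cstar_algebra \<Rightarrow> 'a completion" is "\<lambda>a _. a"
  by (simp add: completion_rel_def Cauchy_constant)

lemma star_hom_of_pre: "star_hom of_pre"
  unfolding star_hom_def
  by (intro conjI allI; transfer) (auto simp: completion_rel_def Cauchy_constant)

lemma norm_of_pre [simp]: "norm (of_pre a) = norm a"
  by transfer simp

lemma of_pre_tendsto:
  assumes A: "Cauchy A"
  shows "(\<lambda>n. of_pre (A n)) \<longlonglongrightarrow> abs_completion A"
proof (rule LIMSEQ_I)
  fix e :: real assume "e > 0"
  then obtain M where M: "\<And>m n. m \<ge> M \<Longrightarrow> n \<ge> M \<Longrightarrow> norm (A m - A n) < e / 2"
    using CauchyD[OF A, of "e / 2"] by auto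
  have "norm (of_pre (A n) - abs_completion A) < e" if n: "n \<ge> M" for n
  proof -
    have "of_pre (A n) - abs_completion A = abs_completion (\<lambda>m. A n + - A m)"
      using A by (simp add: minus_completion_def of_pre.abs_eq uminus_completion.abs_eq
          plus_completion.abs_eq completion_rel_Cauchy Cauchy_constant Cauchy_uminus)
    moreover have c: "Cauchy (\<lambda>m. A n + - A m)"
      using A by (intro Cauchy_plus Cauchy_uminus Cauchy_constant)
    ultimately have "norm (of_pre (A n) - abs_completion A) = lim (\<lambda>m. norm (A n + - A m))"
      by (simp add: norm_completion.abs_eq completion_rel_Cauchy)
    also have "\<dots> \<le> e / 2"
      by (rule LIMSEQ_le_const2[OF Cauchy_norm_lim[OF c]])
         (use M n in \<open>auto intro!: exI[of _ M] less_imp_le\<close>)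
    finally show ?thesis using \<open>e > 0\<close> by simp
  qed
  then show "\<exists>M. \<forall>n\<ge>M. norm (of_pre (A n) - abs_completion A) < e" by blast
qed

lemma completion_cases:
  obtains A where "Cauchy A" "x = abs_completion A"
  by (metis Quotient3_completion Quotient3_abs_rep Quotient3_rep_reflp completion_rel_Cauchy)

lemma of_pre_approx:
  assumes "e > 0"
  obtains a where "norm (x - of_pre a) < e"
proof -
  obtain A where A: "Cauchy A" "x = abs_completion A" by (rule completion_cases)
  from LIMSEQ_D[OF of_pre_tendsto[OF A(1)] assms] obtain n
    where "norm (of_pre (A n) - abs_completion A) < e" by blast
  then show ?thesis using A(2) that by (metis norm_minus_commute)
qed

instance completion :: (pre_cstar_algebra) cstar_algebra
proof
  fix X :: "nat \<Rightarrow> 'a completion"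
  assume X: "Cauchy X"
  have "\<forall>n. \<exists>a. norm (X n - of_pre a) < 1 / real (Suc n)"
    by (metis of_pre_approx of_nat_0_less_iff zero_less_Suc zero_less_divide_1_iff)
  then obtain a where a: "\<And>n. norm (X n - of_pre (a n)) < 1 / real (Suc n)" by metis
  have Z: "(\<lambda>n. X n - of_pre (a n)) \<longlonglongrightarrow> 0"
    by (rule Lim_null_comparison[OF _ LIMSEQ_inverse_real_of_nat])
       (use a in \<open>auto intro!: always_eventually less_imp_le simp: inverse_eq_divide\<close>)
  then have "Cauchy (\<lambda>n. X n + - (X n - of_pre (a n)))"
    by (intro Cauchy_plus Cauchy_uminus X LIMSEQ_imp_Cauchy)
  then have "Cauchy (\<lambda>n. of_pre (a n))" by simp
  then have "Cauchy a"
    by (rule Cauchy_contraction[of _ _ 1])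
       (simp add: star_hom_diff[OF star_hom_of_pre, symmetric])
  then have "(\<lambda>n. (X n - of_pre (a n)) + of_pre (a n)) \<longlonglongrightarrow> 0 + abs_completion a"
    by (intro tendsto_add Z of_pre_tendsto)
  then show "convergent X" by (auto simp: convergent_def)
qed


section \<open>The free unital *-algebra on a type of generators\<close>

datatype 'g letter = Gen 'g | Adj 'g

datatype 'g star_word = Word "'g letter list"

instantiation star_word :: (type) monoid_add
begin

definition zero_star_word :: "'a star_word" where
  "0 = Word []"

fun plus_star_word :: "'a star_word \<Rightarrow> 'a star_word \<Rightarrow> 'a star_word" where
  "Word v + Word w = Word (v @ w)"

instance
proof
  fix a b c :: "'a star_word"
  show "a + b + c = a + (b + c)" by (cases a; cases b; cases c) simp
  show "0 + a = a" "a + 0 = a" by (cases a; simp add: zero_star_word_def)+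
qed

end

fun letter_adj :: "'g letter \<Rightarrow> 'g letter" where
  "letter_adj (Gen g) = Adj g"
| "letter_adj (Adj g) = Gen g"

fun word_adj :: "'g star_word \<Rightarrow> 'g star_word" where
  "word_adj (Word w) = Word (rev (map letter_adj w))"

lemma letter_adj_adj [simp]: "letter_adj (letter_adj a) = a"
  by (cases a) auto

lemma word_adj_adj [simp]: "word_adj (word_adj w) = w"
  by (cases w) (simp add: rev_map[symmetric] comp_def)

lemma word_adj_plus: "word_adj (v + w) = word_adj w + word_adj v"
  by (cases v; cases w) simp

lemma word_adj_zero: "word_adj 0 = 0"
  by (simp add: zero_star_word_def)

lemma inj_word_adj: "inj word_adj"
  by (metis injI word_adj_adj)

text \<open>The monoid algebra over \<open>\<complex>\<close> of the monoid of words: multiplication is convolution, which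
  on words is concatenation.\<close>

typedef 'g free_star_algebra = "UNIV :: ('g star_word \<Rightarrow>\<^sub>0 complex) set" ..

setup_lifting type_definition_free_star_algebra

lemma poly_mapping_single_induct:
  fixes f :: "'a \<Rightarrow>\<^sub>0 'b::comm_monoid_add"
  assumes "\<And>k c. P (Poly_Mapping.single k c)" "\<And>f g. P f \<Longrightarrow> P g \<Longrightarrow> P (f + g)"
  shows "P f"
proof -
  have 0: "P 0" using assms(1)[of undefined 0] by simp
  have "P (\<Sum>k\<in>A. Poly_Mapping.single k (Poly_Mapping.lookup f k))" if "finite A" for A
    using that by induction (auto simp: 0 assms)
  moreover have "(\<Sum>k\<in>Poly_Mapping.keys f. Poly_Mapping.single k (Poly_Mapping.lookup f k)) = f"
    by (rule poly_mapping_eqI)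
       (auto simp: lookup_sum lookup_single when_def in_keys_iff sum.delta)
  ultimately show ?thesis by (metis finite_keys)
qed

definition pm_star :: "('g star_word \<Rightarrow>\<^sub>0 complex) \<Rightarrow> ('g star_word \<Rightarrow>\<^sub>0 complex)" where
  "pm_star f = Poly_Mapping.map_key word_adj (Poly_Mapping.map cnj f)"

lemma lookup_pm_star: "Poly_Mapping.lookup (pm_star f) w = cnj (Poly_Mapping.lookup f (word_adj w))"
  by (simp add: pm_star_def map_key.rep_eq[OF inj_word_adj] map.rep_eq when_def)

lemma pm_star_add: "pm_star (f + g) = pm_star f + pm_star g"
  by (rule poly_mapping_eqI) (simp add: lookup_pm_star lookup_add)

lemma pm_star_single: "pm_star (Poly_Mapping.single w c) = Poly_Mapping.single (word_adj w) (cnj c)"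
  by (rule poly_mapping_eqI) (auto simp: lookup_pm_star lookup_single when_def)

lemma pm_star_mult: "pm_star (f * g) = pm_star g * pm_star f"
proof (induction f rule: poly_mapping_single_induct)
  case (1 v c)
  show ?case
  proof (induction g rule: poly_mapping_single_induct)
    case (1 w d)
    show ?case by (simp add: mult_single pm_star_single word_adj_plus mult.commute)
  qed (simp add: distrib_left distrib_right pm_star_add)
qed (simp add: distrib_left distrib_right pm_star_add)

lemma pm_central: "f * Poly_Mapping.single 0 c = Poly_Mapping.single 0 c * (f :: 'g star_word \<Rightarrow>\<^sub>0 complex)"
  by (induction f rule: poly_mapping_single_induct)
     (simp_all add: mult_single distrib_left distrib_right mult.commute)

instantiation free_star_algebra :: (type) star_algebra
begin

lift_definition zero_free_star_algebra :: "'a free_star_algebra" is 0 .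
lift_definition one_free_star_algebra :: "'a free_star_algebra" is 1 .
lift_definition plus_free_star_algebra ::
  "'a free_star_algebra \<Rightarrow> 'a free_star_algebra \<Rightarrow> 'a free_star_algebra" is "(+)" .
lift_definition minus_free_star_algebra ::
  "'a free_star_algebra \<Rightarrow> 'a free_star_algebra \<Rightarrow> 'a free_star_algebra" is "(-)" .
lift_definition uminus_free_star_algebra ::
  "'a free_star_algebra \<Rightarrow> 'a free_star_algebra" is uminus .
lift_definition times_free_star_algebra ::
  "'a free_star_algebra \<Rightarrow> 'a free_star_algebra \<Rightarrow> 'a free_star_algebra" is "(*)" .
lift_definition scaleC_free_star_algebra ::
  "complex \<Rightarrow> 'a free_star_algebra \<Rightarrow> 'a free_star_algebra"
  is "\<lambda>c f. Poly_Mapping.single 0 c * f" .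
lift_definition star_free_star_algebra :: "'a free_star_algebra \<Rightarrow> 'a free_star_algebra"
  is pm_star .

instance
proof
  fix x y z :: "'a free_star_algebra" and c d :: complex
  show "x + y + z = x + (y + z)" by transfer (rule add.assoc)
  show "x + y = y + x" by transfer (rule add.commute)
  show "0 + x = x" "- x + x = 0" "1 * x = x" "x * 1 = x" by (transfer; simp)+
  show "x - y = x + - y" by transfer simp
  show "x * y * z = x * (y * z)" by transfer (rule mult.assoc)
  show "(x + y) * z = x * z + y * z" "c *\<^sub>C (x + y) = c *\<^sub>C x + c *\<^sub>C y"
    by (transfer; rule distrib_right distrib_left)+
  show "x * (y + z) = x * y + x * z" by transfer (rule distrib_left)
  show "(c + d) *\<^sub>C x = c *\<^sub>C x + d *\<^sub>C x" by transfer (simp add: single_add distrib_right)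
  show "c *\<^sub>C d *\<^sub>C x = (c * d) *\<^sub>C x"
    by transfer (simp add: mult.assoc[symmetric] mult_single)
  show "1 *\<^sub>C x = x" by transfer simp
  show "(c *\<^sub>C x) * y = c *\<^sub>C (x * y)" by transfer (rule mult.assoc)
  show "x * (c *\<^sub>C y) = c *\<^sub>C (x * y)"
    by transfer (metis mult.assoc pm_central)
  show "star (x + y) = star x + star y" by transfer (rule pm_star_add)
  show "star (c *\<^sub>C x) = cnj c *\<^sub>C star x"
    by transfer (simp add: pm_star_mult pm_star_single word_adj_zero pm_central)
  show "star (x * y) = star y * star x" by transfer (rule pm_star_mult)
  show "star (star x) = x" by transfer (rule poly_mapping_eqI, simp add: lookup_pm_star)
qed

end

lift_definition free_word :: "'g star_word \<Rightarrow> 'g free_star_algebra"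
  is "\<lambda>w. Poly_Mapping.single w 1" .

definition free_gen :: "'g \<Rightarrow> 'g free_star_algebra" where
  "free_gen g = free_word (Word [Gen g])"

lemma free_word_plus: "free_word (v + w) = free_word v * free_word w"
  by transfer (simp add: mult_single)

lemma free_word_zero: "free_word 0 = 1"
  by transfer simp

lemma star_free_word: "star (free_word w) = free_word (word_adj w)"
  by transfer (simp add: pm_star_single)

lemma star_free_gen: "star (free_gen g) = free_word (Word [Adj g])"
  by (simp add: free_gen_def star_free_word)

lemma free_induct:
  assumes "\<And>c w. P (c *\<^sub>C free_word w)" "\<And>x y. P x \<Longrightarrow> P y \<Longrightarrow> P (x + y)"
  shows "P (x :: 'g free_star_algebra)"
  using assms
proof transfer
  fix P :: "('g star_word \<Rightarrow>\<^sub>0 complex) \<Rightarrow> bool" and f :: "'g star_word \<Rightarrow>\<^sub>0 complex"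
  assume *: "\<And>c w. P (Poly_Mapping.single 0 c * Poly_Mapping.single w 1)"
    and "\<And>x y. P x \<Longrightarrow> P y \<Longrightarrow> P (x + y)"
  then show "P f"
    by (induction f rule: poly_mapping_single_induct) (use * in \<open>simp_all add: mult_single\<close>)
qed

lemma free_star_hom_unique:
  assumes "star_hom \<phi>" "star_hom \<psi>" "\<And>g. \<phi> (free_gen g) = \<psi> (free_gen g)"
  shows "\<phi> x = \<psi> x"
proof (induction x rule: free_induct)
  case (1 c w)
  have "\<phi> (free_word (Word l)) = \<psi> (free_word (Word l))" for l
  proof (induction l)
    case Nil
    show ?case using assms by (simp add: free_word_zero star_homD flip: zero_star_word_def)
  next
    case (Cons a l)
    have "free_word (Word (a # l)) = free_word (Word [a]) * free_word (Word l)"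
      by (simp flip: free_word_plus)
    moreover have "\<phi> (free_word (Word [a])) = \<psi> (free_word (Word [a]))"
      using assms
      by (cases a) (simp_all add: star_homD(4) flip: star_free_gen free_gen_def)
    ultimately show ?case using Cons assms by (simp add: star_homD(3))
  qed
  then show ?case using assms by (cases w) (simp add: star_homD(2))
next
  case (2 x y)
  then show ?case using assms by (simp add: star_homD(1))
qed

text \<open>Evaluation of formal *-polynomials, i.e. the universal property of the free *-algebra.\<close>

fun eval_letter :: "('g \<Rightarrow> 'b::star_algebra) \<Rightarrow> 'g letter \<Rightarrow> 'b" where
  "eval_letter f (Gen g) = f g"
| "eval_letter f (Adj g) = star (f g)"

fun eval_word :: "('g \<Rightarrow> 'b::star_algebra) \<Rightarrow> 'g star_word \<Rightarrow> 'b" where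
  "eval_word f (Word w) = prod_list (map (eval_letter f) w)"

lift_definition free_eval :: "('g \<Rightarrow> 'b::star_algebra) \<Rightarrow> 'g free_star_algebra \<Rightarrow> 'b"
  is "\<lambda>f p. \<Sum>w\<in>Poly_Mapping.keys p. Poly_Mapping.lookup p w *\<^sub>C eval_word f w" .

lemma eval_word_plus: "eval_word f (v + w) = eval_word f v * eval_word f w"
  by (cases v; cases w) simp

lemma star_prod_list: "star (prod_list xs) = prod_list (rev (map star (xs::'b::star_algebra list)))"
  by (induction xs) (simp_all add: star_mult)

lemma eval_letter_adj: "eval_letter f (letter_adj a) = star (eval_letter f a)"
  by (cases a) (simp_all add: star_star)

lemma eval_word_adj: "eval_word f (word_adj w) = star (eval_word f w)"
  by (cases w) (simp add: star_prod_list rev_map comp_def eval_letter_adj)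

lemma free_eval_add: "free_eval f (x + y) = free_eval f x + free_eval f y"
  by transfer (rule setsum_keys_plus_distrib; simp add: scaleC_add_left)

lemma free_eval_word: "free_eval f (c *\<^sub>C free_word w) = c *\<^sub>C eval_word f w"
  by transfer (simp add: mult_single)

lemma free_eval_scaleC: "free_eval f (c *\<^sub>C x) = c *\<^sub>C free_eval f x"
  by (induction x rule: free_induct)
     (simp_all add: scaleC_scaleC free_eval_word free_eval_add scaleC_add_right)

lemma free_eval_one: "free_eval f 1 = 1"
proof -
  have "eval_word f 0 = 1" by (simp add: zero_star_word_def)
  then show ?thesis using free_eval_word[of f 1 0] by (simp add: free_word_zero scaleC_one)
qed

lemma free_eval_mult: "free_eval f (x * y) = free_eval f x * free_eval f y"
proof (induction x rule: free_induct)
  case (1 c v)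
  show ?case
  proof (induction y rule: free_induct)
    case (1 d w)
    have "(c *\<^sub>C free_word v) * (d *\<^sub>C free_word w) = (c * d) *\<^sub>C free_word (v + w)"
      by (simp add: mult_scaleC_left mult_scaleC_right scaleC_scaleC free_word_plus mult.commute)
    then show ?case
      by (simp add: free_eval_word eval_word_plus mult_scaleC_left mult_scaleC_right scaleC_scaleC mult.commute)
  qed (simp add: distrib_left free_eval_add)
qed (simp add: distrib_right free_eval_add)

lemma free_eval_star: "free_eval f (star x) = star (free_eval f x)"
  by (induction x rule: free_induct)
     (simp_all add: star_scaleC star_free_word free_eval_word eval_word_adj free_eval_add star_add)

lemma star_hom_free_eval: "star_hom (free_eval f)"
  by (simp add: star_hom_def free_eval_add free_eval_scaleC free_eval_mult free_eval_star free_eval_one)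

lemma free_eval_gen [simp]: "free_eval f (free_gen g) = f g"
  using free_eval_word[of f 1 "Word [Gen g]"] by (simp add: free_gen_def scaleC_one)


section \<open>The ring C*-algebra\<close>

typedef (overloaded) 'r nonzero = "{m :: 'r::idom. m \<noteq> 0}" morphisms elem Nonzero
  by (rule exI[of _ 1]) simp

setup_lifting type_definition_nonzero

instantiation nonzero :: (idom) times
begin
lift_definition times_nonzero :: "'a nonzero \<Rightarrow> 'a nonzero \<Rightarrow> 'a nonzero" is "(*)" by simp
instance ..
end

definition ideal_cong :: "'r::comm_ring_1 \<Rightarrow> ('r \<times> 'r) set" where
  "ideal_cong m = {(a, b). m dvd a - b}"

lemma equiv_ideal_cong: "equiv UNIV (ideal_cong m)"
proof (rule equivI)
  show "refl (ideal_cong m)" by (auto simp: ideal_cong_def refl_on_def)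
  have "m dvd b - a" if "m dvd a - b" for a b
    using that dvd_minus_iff[of m "a - b"] by simp
  then show "sym (ideal_cong m)" by (auto simp: ideal_cong_def sym_def)
  have "m dvd a - c" if "m dvd a - b" "m dvd b - c" for a b c
    using dvd_add[OF that] by simp
  then show "trans (ideal_cong m)" by (auto simp: ideal_cong_def intro!: transI)
qed (simp add: ideal_cong_def)

text \<open>\<open>UNIV // ideal_cong m\<close> is \<open>R/(m)\<close>. Relations are pairs of elements that are to become equal;
  in the order listed: \<open>s m\<close> (for \<open>m \<in> R - {0}\<close>) is an isometry, \<open>u n\<close> is a unitary (two lines), (CL1), (CL2), (CL3),
  (CL4). The choice of the representative \<open>l\<close> in (CL4) is immaterial, see
  \<open>CL_summand_independent\<close> below. (CL4) is meaningful only if \<open>R/(m)\<close> is finite.\<close>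

definition CL_relations ::
  "('r::idom nonzero \<Rightarrow> 'a::star_algebra) \<Rightarrow> ('r \<Rightarrow> 'a) \<Rightarrow> ('a \<times> 'a) set" where
  "CL_relations s u =
     {(star (s m) * s m, 1) |m. True} \<union>
     {(star (u n) * u n, 1) |n. True} \<union>
     {(u n * star (u n), 1) |n. True} \<union>
     {(s m * s m', s (m * m')) |m m'. True} \<union>
     {(u n * u n', u (n + n')) |n n'. True} \<union>
     {(s m * u n, u (elem m * n) * s m) |m n. True} \<union>
     {(\<Sum>X \<in> UNIV // ideal_cong (elem m).
         let l = (SOME l. l \<in> X) in u l * s m * star (s m) * u (- l), 1) |m. True}"

definition satisfies_CL :: "('r::idom nonzero \<Rightarrow> 'a::star_algebra) \<Rightarrow> ('r \<Rightarrow> 'a) \<Rightarrow> bool" where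
  "satisfies_CL s u \<longleftrightarrow> (\<forall>(a, b) \<in> CL_relations s u. a = b)"

lemma satisfies_CLD:
  assumes "satisfies_CL s u"
  shows "star (s m) * s m = 1" "star (u n) * u n = 1" "u n * star (u n) = 1"
    "s m * s m' = s (m * m')" "u n * u n' = u (n + n')" "s m * u n = u (elem m * n) * s m"
    "(\<Sum>X \<in> UNIV // ideal_cong (elem m).
        let l = (SOME l. l \<in> X) in u l * s m * star (s m) * u (- l)) = 1"
proof -
  have *: "(a, b) \<in> CL_relations s u \<Longrightarrow> a = b" for a b
    using assms by (auto simp: satisfies_CL_def)
  show "star (s m) * s m = 1" "star (u n) * u n = 1" "u n * star (u n) = 1"
    "s m * s m' = s (m * m')" "u n * u n' = u (n + n')" "s m * u n = u (elem m * n) * s m"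
    "(\<Sum>X \<in> UNIV // ideal_cong (elem m).
        let l = (SOME l. l \<in> X) in u l * s m * star (s m) * u (- l)) = 1"
    by (rule *; unfold CL_relations_def Un_iff mem_Collect_eq; metis)+
qed

lemma CL_summand_independent:
  assumes CL: "satisfies_CL s u" and "(a, b) \<in> ideal_cong (elem m)"
  shows "u a * s m * star (s m) * u (- a) = u b * s m * star (s m) * u (- b)"
proof -
  note D = satisfies_CLD[OF CL]
  have u0: "u 0 = 1"
    using D(5)[of 0 0] D(2)[of 0] by (metis add_0 mult.assoc mult_1_left)
  have um: "u (- n) = star (u n)" for n
    using D(5)[of "-n" n] D(3)[of n] by (metis ab_left_minus mult.assoc mult_1_left mult_1_right u0)
  obtain k where k: "a = b + elem m * k"
    using assms(2) by (auto simp: ideal_cong_def elim!: dvdE) (metis add.commute diff_add_cancel)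
  have 1: "u a * s m = u b * s m * u k"
    using D(5)[of b "elem m * k"] D(6)[of m k] k by (metis mult.assoc)
  have 2: "star (s m) * u (- a) = star (u k) * star (s m) * u (- b)"
  proof -
    have "star (s m) * u (- a) = star (u a * s m)" by (simp add: um star_mult)
    also have "\<dots> = star (u k) * star (s m) * u (- b)"
      by (simp add: 1 um star_mult mult.assoc)
    finally show ?thesis .
  qed
  have "u a * s m * star (s m) * u (- a) = u b * s m * (u k * star (u k)) * (star (s m) * u (- b))"
    using 1 2 by (simp add: mult.assoc)
  then show ?thesis by (simp add: D(3) mult.assoc)
qed

text \<open>C*-seminorms on a *-algebra correspond to *-homomorphisms to C*-algebras (quotient by the null
  space and complete). Hence the supremum over all C*-seminorms that respect the relations is the
  supremum of \<open>\<parallel>\<pi> x\<parallel>\<close> over all representations \<open>\<pi>\<close> of the relations, without any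
  quantification over C*-algebras.\<close>

definition cstar_seminorm :: "('a::star_algebra \<Rightarrow> real) \<Rightarrow> bool" where
  "cstar_seminorm p \<longleftrightarrow> (\<forall>x y. p (x + y) \<le> p x + p y) \<and> (\<forall>c x. p (c *\<^sub>C x) = cmod c * p x) \<and>
     (\<forall>x y. p (x * y) \<le> p x * p y) \<and> (\<forall>x. p (star x * x) = (p x)\<^sup>2)"

type_synonym 'r CL_free = "('r nonzero + 'r) free_star_algebra"

definition CL_seminorms :: "('r::idom CL_free \<Rightarrow> real) set" where
  "CL_seminorms = {p. cstar_seminorm p \<and>
     (\<forall>(a, b) \<in> CL_relations (free_gen \<circ> Inl) (free_gen \<circ> Inr). p (a - b) = 0)}"

definition CL_norm :: "'r::idom CL_free \<Rightarrow> real" where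
  "CL_norm x = (SUP p \<in> CL_seminorms. p x)"

context
  fixes p :: "'a::star_algebra \<Rightarrow> real"
  assumes p: "cstar_seminorm p"
begin

lemma seminorm_add: "p (x + y) \<le> p x + p y"
  and seminorm_scaleC: "p (c *\<^sub>C x) = cmod c * p x"
  and seminorm_mult: "p (x * y) \<le> p x * p y"
  and seminorm_cstar: "p (star x * x) = (p x)\<^sup>2"
  using p by (auto simp: cstar_seminorm_def)

lemma seminorm_zero: "p 0 = 0"
  using seminorm_scaleC[of 0 0] by simp

lemma seminorm_minus: "p (- x) = p x"
  using seminorm_scaleC[of "-1" x] by (simp add: scaleC_minus_one)

lemma seminorm_nonneg: "p x \<ge> 0"
  using seminorm_add[of x "- x"] by (simp add: seminorm_zero seminorm_minus)

lemma seminorm_diff: "p (x - y) \<le> p x + p y"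
  using seminorm_add[of x "- y"] by (simp add: seminorm_minus)

lemma seminorm_diff_commute: "p (x - y) = p (y - x)"
  using seminorm_minus[of "x - y"] by simp

lemma seminorm_abs_diff: "\<bar>p x - p y\<bar> \<le> p (x - y)"
  using seminorm_add[of "x - y" y] seminorm_add[of "y - x" x] seminorm_diff_commute[of x y] by simp

lemma seminorm_star: "p (star x) = p x"
proof -
  have *: "p x \<le> p (star x)" for x
  proof (cases "p x = 0")
    case False
    have "p x * p x \<le> p (star x) * p x"
      using seminorm_mult[of "star x" x] seminorm_cstar[of x] by (simp add: power2_eq_square)
    then show ?thesis using False seminorm_nonneg[of x] by (simp add: mult_le_cancel_right)
  qed (simp add: seminorm_nonneg)
  show ?thesis using *[of x] *[of "star x"] by (simp add: star_star)
qed

lemma seminorm_one_le: "p 1 \<le> 1"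
proof -
  have "p 1 * p 1 = p 1 * 1" using seminorm_cstar[of 1] by (simp add: power2_eq_square)
  then show ?thesis by (cases "p 1 = 0") (simp_all only: mult_cancel_left, auto)
qed

lemma seminorm_isometry_le:
  assumes "p (star x * x - 1) = 0"
  shows "p x \<le> 1"
proof -
  have "(p x)\<^sup>2 \<le> p (star x * x - 1) + p 1"
    using seminorm_add[of "star x * x - 1" 1] by (simp add: seminorm_cstar)
  then have "(p x)\<^sup>2 \<le> 1" using assms seminorm_one_le by simp
  then show ?thesis by (simp add: power2_le_iff_abs_le abs_le_square_iff power_le_one_iff seminorm_nonneg)
qed

end

lemma CL_seminorm_word_le:
  assumes p: "p \<in> (CL_seminorms :: ('r::idom CL_free \<Rightarrow> real) set)"
  shows "p (free_word (Word l)) \<le> 1"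
proof (induction l)
  have s: "cstar_seminorm p" using p by (simp add: CL_seminorms_def)
  {
    case Nil
    show ?case using seminorm_one_le[OF s] by (simp add: free_word_zero flip: zero_star_word_def)
  next
    case (Cons a l)
    have g: "p (free_gen g) \<le> 1" for g
    proof (rule seminorm_isometry_le[OF s])
      show "p (star (free_gen g) * free_gen g - 1) = 0"
        using p unfolding CL_seminorms_def CL_relations_def by (cases g) fastforce+
    qed
    have a: "p (free_word (Word [a])) \<le> 1"
    proof (cases a)
      case (Gen g)
      then show ?thesis using g[of g] by (simp add: free_gen_def)
    next
      case (Adj g)
      then show ?thesis using g[of g] seminorm_star[OF s, of "free_gen g"] by (simp add: star_free_gen)
    qed
    have "free_word (Word (a # l)) = free_word (Word [a]) * free_word (Word l)"
      by (simp flip: free_word_plus)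
    then have "p (free_word (Word (a # l))) \<le> p (free_word (Word [a])) * p (free_word (Word l))"
      using seminorm_mult[OF s] by simp
    also have "\<dots> \<le> 1 * 1"
      using a Cons seminorm_nonneg[OF s] by (intro mult_mono) auto
    finally show ?case by simp
  }
qed

lemma CL_seminorms_bdd: "bdd_above ((\<lambda>p. p x) ` (CL_seminorms :: ('r::idom CL_free \<Rightarrow> real) set))"
proof -
  have "\<exists>C. \<forall>p\<in>(CL_seminorms :: ('r CL_free \<Rightarrow> real) set). p x \<le> C"
  proof (induction x rule: free_induct)
    case (1 c w)
    have "p (c *\<^sub>C free_word w) \<le> cmod c" if "p \<in> CL_seminorms" for p :: "'r CL_free \<Rightarrow> real"
    proof -
      have s: "cstar_seminorm p" using that by (simp add: CL_seminorms_def)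
      have "p (free_word w) \<le> 1" using CL_seminorm_word_le[OF that] by (cases w) auto
      then show ?thesis
        using mult_left_mono[of "p (free_word w)" 1 "cmod c"] by (simp add: seminorm_scaleC[OF s])
    qed
    then show ?case by blast
  next
    case (2 x y)
    then obtain C D where *: "\<And>p. p \<in> (CL_seminorms :: ('r CL_free \<Rightarrow> real) set) \<Longrightarrow> p x \<le> C \<and> p y \<le> D"
      by blast
    have "p (x + y) \<le> C + D" if "p \<in> CL_seminorms" for p :: "'r CL_free \<Rightarrow> real"
      using *[OF that] seminorm_add[of p x y] that by (simp add: CL_seminorms_def)
    then show ?case by blast
  qed
  then show ?thesis by (auto simp: bdd_above_def)
qed

lemma CL_seminorms_nonempty: "(CL_seminorms :: ('r::idom CL_free \<Rightarrow> real) set) \<noteq> {}"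
proof -
  have "(\<lambda>_. 0) \<in> (CL_seminorms :: ('r CL_free \<Rightarrow> real) set)"
    by (auto simp: CL_seminorms_def cstar_seminorm_def)
  then show ?thesis by blast
qed

lemma CL_norm_upper: "p \<in> CL_seminorms \<Longrightarrow> p x \<le> CL_norm x"
  unfolding CL_norm_def by (rule cSUP_upper[OF _ CL_seminorms_bdd])

lemma CL_norm_least: "(\<And>p. p \<in> CL_seminorms \<Longrightarrow> p x \<le> C) \<Longrightarrow> CL_norm x \<le> C"
  unfolding CL_norm_def by (rule cSUP_least[OF CL_seminorms_nonempty])

lemma CL_norm_nonneg: "0 \<le> CL_norm (x :: 'r::idom CL_free)"
proof -
  obtain p :: "'r CL_free \<Rightarrow> real" where p: "p \<in> CL_seminorms" using CL_seminorms_nonempty by blast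
  then have "0 \<le> p x" by (simp add: CL_seminorms_def seminorm_nonneg)
  then show ?thesis using CL_norm_upper[OF p, of x] by simp
qed

lemma CL_norm_seminorm: "cstar_seminorm (CL_norm :: 'r::idom CL_free \<Rightarrow> real)"
proof -
  note U = CL_norm_upper
  have S: "cstar_seminorm p" if "p \<in> CL_seminorms" for p :: "'r CL_free \<Rightarrow> real"
    using that by (simp add: CL_seminorms_def)
  have le: "CL_norm (c *\<^sub>C x) \<le> cmod c * CL_norm x" for c and x :: "'r CL_free"
    by (rule CL_norm_least) (simp add: seminorm_scaleC[OF S] U mult_left_mono)
  have sc: "CL_norm (c *\<^sub>C x) = cmod c * CL_norm x" for c and x :: "'r CL_free"
  proof (cases "c = 0")
    case True
    then show ?thesis using le[of 0 x] CL_norm_nonneg[of "0 :: 'r CL_free"] by simp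
  next
    case False
    have "CL_norm x \<le> cmod (inverse c) * CL_norm (c *\<^sub>C x)"
      using le[of "inverse c" "c *\<^sub>C x"] False by (simp add: scaleC_scaleC scaleC_one)
    then have "cmod c * CL_norm x \<le> CL_norm (c *\<^sub>C x)"
      using False by (simp add: norm_inverse inverse_eq_divide norm_divide field_simps)
    then show ?thesis using le[of c x] by simp
  qed
  have ad: "CL_norm (x + y) \<le> CL_norm x + CL_norm y" for x y :: "'r CL_free"
  proof (rule CL_norm_least)
    fix p :: "'r CL_free \<Rightarrow> real" assume "p \<in> CL_seminorms"
    then show "p (x + y) \<le> CL_norm x + CL_norm y"
      using seminorm_add[OF S, of p x y] U[of p x] U[of p y] by linarith
  qed
  have mu: "CL_norm (x * y) \<le> CL_norm x * CL_norm y" for x y :: "'r CL_free"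
  proof (rule CL_norm_least)
    fix p :: "'r CL_free \<Rightarrow> real" assume p: "p \<in> CL_seminorms"
    have "p x * p y \<le> CL_norm x * CL_norm y"
      using p by (intro mult_mono U CL_norm_nonneg seminorm_nonneg[OF S])
    then show "p (x * y) \<le> CL_norm x * CL_norm y"
      using seminorm_mult[OF S[OF p], of x y] by linarith
  qed
  have cs: "CL_norm (star x * x) = (CL_norm x)\<^sup>2" for x :: "'r CL_free"
  proof (rule antisym)
    show "CL_norm (star x * x) \<le> (CL_norm x)\<^sup>2"
      by (rule CL_norm_least)
         (auto simp: seminorm_cstar[OF S] intro!: power_mono U seminorm_nonneg[OF S])
    have "CL_norm x \<le> sqrt (CL_norm (star x * x))"
    proof (rule CL_norm_least)
      fix p :: "'r CL_free \<Rightarrow> real" assume p: "p \<in> CL_seminorms"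
      have "(p x)\<^sup>2 \<le> CL_norm (star x * x)"
        using U[OF p, of "star x * x"] by (simp add: seminorm_cstar[OF S[OF p]])
      then show "p x \<le> sqrt (CL_norm (star x * x))" by (rule real_le_rsqrt)
    qed
    then show "(CL_norm x)\<^sup>2 \<le> CL_norm (star x * x)"
      using CL_norm_nonneg by (metis power_mono real_sqrt_pow2)
  qed
  show ?thesis by (simp add: cstar_seminorm_def sc ad mu cs)
qed

lemmas CL_norm_simps =
  seminorm_zero[OF CL_norm_seminorm] seminorm_scaleC[OF CL_norm_seminorm]
  seminorm_minus[OF CL_norm_seminorm] seminorm_cstar[OF CL_norm_seminorm]
  seminorm_star[OF CL_norm_seminorm]

definition CL_eq :: "'r::idom CL_free \<Rightarrow> 'r CL_free \<Rightarrow> bool" where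
  "CL_eq x y \<longleftrightarrow> CL_norm (x - y) = 0"

lemma CL_norm_triangle_zero:
  "CL_norm x = 0 \<Longrightarrow> CL_norm y = 0 \<Longrightarrow> CL_norm (x + y) = 0"
  using seminorm_add[OF CL_norm_seminorm, of x y] CL_norm_nonneg[of "x + y"] by simp

lemma equivp_CL_eq: "equivp (CL_eq :: 'r::idom CL_free \<Rightarrow> _)"
proof (rule equivpI)
  show "reflp (CL_eq :: 'r CL_free \<Rightarrow> _)" by (simp add: reflp_def CL_eq_def CL_norm_simps)
  show "symp (CL_eq :: 'r CL_free \<Rightarrow> _)" by (simp add: symp_def CL_eq_def seminorm_diff_commute[OF CL_norm_seminorm])
  show "transp (CL_eq :: 'r CL_free \<Rightarrow> _)"
  proof (rule transpI)
    fix x y z :: "'r CL_free" assume "CL_eq x y" "CL_eq y z"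
    then show "CL_eq x z"
      using CL_norm_triangle_zero[of "x - y" "y - z"] by (simp add: CL_eq_def)
  qed
qed

quotient_type (overloaded) 'r pre_ring_cstar = "'r::idom CL_free" / CL_eq
  by (rule equivp_CL_eq)

instantiation pre_ring_cstar :: (idom) pre_cstar_algebra
begin

lift_definition zero_pre_ring_cstar :: "'a pre_ring_cstar" is 0 .
lift_definition one_pre_ring_cstar :: "'a pre_ring_cstar" is 1 .

lift_definition plus_pre_ring_cstar ::
  "'a pre_ring_cstar \<Rightarrow> 'a pre_ring_cstar \<Rightarrow> 'a pre_ring_cstar" is "(+)"
proof -
  fix a b c d :: "'a CL_free" assume "CL_eq a b" "CL_eq c d"
  then show "CL_eq (a + c) (b + d)"
    using CL_norm_triangle_zero[of "a - b" "c - d"] by (simp add: CL_eq_def algebra_simps)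
qed

lift_definition uminus_pre_ring_cstar :: "'a pre_ring_cstar \<Rightarrow> 'a pre_ring_cstar" is uminus
  by (simp add: CL_eq_def seminorm_diff_commute[OF CL_norm_seminorm])

definition minus_pre_ring_cstar ::
  "'a pre_ring_cstar \<Rightarrow> 'a pre_ring_cstar \<Rightarrow> 'a pre_ring_cstar" where
  "x - y = x + - y" for x y :: "'a pre_ring_cstar"

lift_definition times_pre_ring_cstar ::
  "'a pre_ring_cstar \<Rightarrow> 'a pre_ring_cstar \<Rightarrow> 'a pre_ring_cstar" is "(*)"
proof -
  fix a b c d :: "'a CL_free" assume *: "CL_eq a b" "CL_eq c d"
  have "CL_norm ((a - b) * c) \<le> 0" "CL_norm (b * (c - d)) \<le> 0"
    using seminorm_mult[OF CL_norm_seminorm, of "a - b" c]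
      seminorm_mult[OF CL_norm_seminorm, of b "c - d"] * by (simp_all add: CL_eq_def)
  then have "CL_norm ((a - b) * c + b * (c - d)) = 0"
    by (intro CL_norm_triangle_zero antisym CL_norm_nonneg)
  then show "CL_eq (a * c) (b * d)" by (simp add: CL_eq_def algebra_simps)
qed

lift_definition scaleC_pre_ring_cstar :: "complex \<Rightarrow> 'a pre_ring_cstar \<Rightarrow> 'a pre_ring_cstar"
  is "scaleC"
  by (simp add: CL_eq_def scaleC_diff_right[symmetric] CL_norm_simps)

definition scaleR_pre_ring_cstar :: "real \<Rightarrow> 'a pre_ring_cstar \<Rightarrow> 'a pre_ring_cstar" where
  "r *\<^sub>R x = complex_of_real r *\<^sub>C x" for x :: "'a pre_ring_cstar"

lift_definition star_pre_ring_cstar :: "'a pre_ring_cstar \<Rightarrow> 'a pre_ring_cstar" is star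
  by (simp add: CL_eq_def star_diff[symmetric] CL_norm_simps)

lift_definition norm_pre_ring_cstar :: "'a pre_ring_cstar \<Rightarrow> real" is CL_norm
proof -
  fix a b :: "'a CL_free" assume "CL_eq a b"
  then show "CL_norm a = CL_norm b"
    using seminorm_abs_diff[OF CL_norm_seminorm, of a b] by (simp add: CL_eq_def)
qed

definition dist_pre_ring_cstar :: "'a pre_ring_cstar \<Rightarrow> 'a pre_ring_cstar \<Rightarrow> real" where
  "dist x y = norm (x - y)" for x y :: "'a pre_ring_cstar"

definition sgn_pre_ring_cstar :: "'a pre_ring_cstar \<Rightarrow> 'a pre_ring_cstar" where
  "sgn x = inverse (norm x) *\<^sub>R x" for x :: "'a pre_ring_cstar"

definition uniformity_pre_ring_cstar :: "('a pre_ring_cstar \<times> 'a pre_ring_cstar) filter" where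
  "uniformity_pre_ring_cstar = (INF e\<in>{0 <..}. principal {(x, y). dist x y < e})"

definition open_pre_ring_cstar :: "'a pre_ring_cstar set \<Rightarrow> bool" where
  "open U = (\<forall>x\<in>U. eventually (\<lambda>(x', y). x' = x \<longrightarrow> y \<in> U) uniformity)"
  for U :: "'a pre_ring_cstar set"

lemma CL_eq_refl: "x = y \<Longrightarrow> CL_eq x y"
  by (simp add: CL_eq_def CL_norm_simps)

instance
proof
  fix x y z :: "'a pre_ring_cstar" and c d :: complex and r s :: real
  show "(x + y) + z = x + (y + z)" by transfer (rule CL_eq_refl, simp add: add.assoc)
  show "x + y = y + x" by transfer (rule CL_eq_refl, simp add: add.commute)
  show "0 + x = x" "- x + x = 0" "1 * x = x" "x * 1 = x" by (transfer; rule CL_eq_refl, simp)+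
  show "x - y = x + - y" by (rule minus_pre_ring_cstar_def)
  show "(x * y) * z = x * (y * z)" by transfer (rule CL_eq_refl, simp add: mult.assoc)
  show "(x + y) * z = x * z + y * z" by transfer (rule CL_eq_refl, simp add: distrib_right)
  show "x * (y + z) = x * y + x * z" by transfer (rule CL_eq_refl, simp add: distrib_left)
  show c1: "c *\<^sub>C (x + y) = c *\<^sub>C x + c *\<^sub>C y" for c
    by transfer (rule CL_eq_refl, simp add: scaleC_add_right)
  show c2: "(c + d) *\<^sub>C x = c *\<^sub>C x + d *\<^sub>C x" for c d
    by transfer (rule CL_eq_refl, simp add: scaleC_add_left)
  show c3: "c *\<^sub>C d *\<^sub>C x = (c * d) *\<^sub>C x" for c d
    by transfer (rule CL_eq_refl, simp add: scaleC_scaleC)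
  show c4: "1 *\<^sub>C x = x" by transfer (rule CL_eq_refl, simp add: scaleC_one)
  show c5: "(c *\<^sub>C x) * y = c *\<^sub>C (x * y)" for c
    by transfer (rule CL_eq_refl, simp add: mult_scaleC_left)
  show c6: "x * (c *\<^sub>C y) = c *\<^sub>C (x * y)" for c
    by transfer (rule CL_eq_refl, simp add: mult_scaleC_right)
  show "star (x + y) = star x + star y" by transfer (rule CL_eq_refl, simp add: star_add)
  show "star (c *\<^sub>C x) = cnj c *\<^sub>C star x" by transfer (rule CL_eq_refl, simp add: star_scaleC)
  show "star (x * y) = star y * star x" by transfer (rule CL_eq_refl, simp add: star_mult)
  show "star (star x) = x" by transfer (rule CL_eq_refl, simp add: star_star)
  show "r *\<^sub>R (x + y) = r *\<^sub>R x + r *\<^sub>R y" "(r + s) *\<^sub>R x = r *\<^sub>R x + s *\<^sub>R x"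
    "r *\<^sub>R s *\<^sub>R x = (r * s) *\<^sub>R x" "1 *\<^sub>R x = x" "(r *\<^sub>R x) * y = r *\<^sub>R (x * y)"
    "x * (r *\<^sub>R y) = r *\<^sub>R (x * y)"
    by (simp_all add: scaleR_pre_ring_cstar_def c1 c2 c3 c4 c5 c6)
  show "dist x y = norm (x - y)" by (rule dist_pre_ring_cstar_def)
  show "sgn x = inverse (norm x) *\<^sub>R x" by (rule sgn_pre_ring_cstar_def)
  show "uniformity = (INF e\<in>{0 <..}. principal {(x, y::'a pre_ring_cstar). dist x y < e})"
    by (rule uniformity_pre_ring_cstar_def)
  show "open U = (\<forall>x\<in>U. \<forall>\<^sub>F (x', y) in uniformity. x' = x \<longrightarrow> y \<in> U)" for U :: "'a pre_ring_cstar set"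
    by (rule open_pre_ring_cstar_def)
  show "r *\<^sub>R x = complex_of_real r *\<^sub>C x" by (rule scaleR_pre_ring_cstar_def)
  show n: "norm (c *\<^sub>C x) = cmod c * norm x" for c by transfer (simp add: CL_norm_simps)
  show "norm (r *\<^sub>R x) = \<bar>r\<bar> * norm x" by (simp add: scaleR_pre_ring_cstar_def n)
  show "norm x = 0 \<longleftrightarrow> x = 0" by transfer (simp add: CL_eq_def)
  show "norm (x + y) \<le> norm x + norm y" by transfer (rule seminorm_add[OF CL_norm_seminorm])
  show "norm (x * y) \<le> norm x * norm y" by transfer (rule seminorm_mult[OF CL_norm_seminorm])
  show "norm (star x * x) = (norm x)\<^sup>2" by transfer (rule seminorm_cstar[OF CL_norm_seminorm])
qed

end

text \<open>\<open>'r ring_cstar\<close> is \<open>\<AA>[R]\<close>; that it is the universal C*-algebra on the generators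
  \<open>ring_s\<close>, \<open>ring_u\<close> and the relations \<open>CL_relations\<close> is \<open>ring_cstar_satisfies\<close> together with
  \<open>ring_cstar_universal\<close>.\<close>

type_synonym 'r ring_cstar = "'r pre_ring_cstar completion"

definition ring_s :: "'r::idom nonzero \<Rightarrow> 'r ring_cstar" where
  "ring_s m = of_pre (abs_pre_ring_cstar (free_gen (Inl m)))"

definition ring_u :: "'r::idom \<Rightarrow> 'r ring_cstar" where
  "ring_u n = of_pre (abs_pre_ring_cstar (free_gen (Inr n)))"

lemma star_hom_abs: "star_hom abs_pre_ring_cstar"
  unfolding star_hom_def
  by (simp add: plus_pre_ring_cstar.abs_eq scaleC_pre_ring_cstar.abs_eq times_pre_ring_cstar.abs_eq
      star_pre_ring_cstar.abs_eq one_pre_ring_cstar_def)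

lemma star_hom_comp: "star_hom \<phi> \<Longrightarrow> star_hom \<psi> \<Longrightarrow> star_hom (\<psi> \<circ> \<phi>)"
  by (simp add: star_hom_def)

lemma CL_relations_hom:
  assumes "star_hom \<phi>"
  shows "CL_relations (\<phi> \<circ> s) (\<phi> \<circ> u) = map_prod \<phi> \<phi> ` CL_relations s u"
proof -
  have 1: "map_prod \<phi> \<phi> ` {(F m, G m) |m. True} = {(\<phi> (F m), \<phi> (G m)) |m. True}" for F G :: "'x \<Rightarrow> _"
    by auto
  have 2: "map_prod \<phi> \<phi> ` {(F m n, G m n) |m n. True} = {(\<phi> (F m n), \<phi> (G m n)) |m n. True}"
    for F G :: "'x \<Rightarrow> 'y \<Rightarrow> _"
    by auto
  show ?thesis
    by (simp only: CL_relations_def image_Un 1 2 star_homD[OF assms] star_hom_sum[OF assms]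
        Let_def o_apply)
qed

lemma CL_norm_relations:
  assumes "(a, b) \<in> CL_relations (free_gen \<circ> Inl) (free_gen \<circ> Inr)"
  shows "CL_norm (a - b) = 0"
  by (rule antisym[OF CL_norm_least CL_norm_nonneg]) (use assms in \<open>force simp: CL_seminorms_def\<close>)

lemma ring_cstar_satisfies: "satisfies_CL ring_s (ring_u :: 'r::idom \<Rightarrow> 'r ring_cstar)"
proof -
  let ?h = "of_pre \<circ> abs_pre_ring_cstar :: 'r CL_free \<Rightarrow> 'r ring_cstar"
  have "ring_s = ?h \<circ> (free_gen \<circ> Inl)" "ring_u = ?h \<circ> (free_gen \<circ> Inr)"
    by (auto simp: ring_s_def ring_u_def)
  then have "CL_relations ring_s (ring_u :: 'r \<Rightarrow> 'r ring_cstar) =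
      map_prod ?h ?h ` CL_relations (free_gen \<circ> Inl) (free_gen \<circ> Inr)"
    using CL_relations_hom[OF star_hom_comp[OF star_hom_abs star_hom_of_pre]] by metis
  moreover have "?h a = ?h b" if "(a, b) \<in> CL_relations (free_gen \<circ> Inl) (free_gen \<circ> Inr)" for a b
    using CL_norm_relations[OF that] pre_ring_cstar.abs_eq_iff[of a b] by (auto simp: CL_eq_def)
  ultimately show ?thesis by (auto simp: satisfies_CL_def)
qed

lemma extend_to_completion:
  fixes \<phi> :: "'a::pre_cstar_algebra \<Rightarrow> 'b::cstar_algebra"
  assumes h: "star_hom \<phi>" and le: "\<And>x. norm (\<phi> x) \<le> norm x"
  obtains \<psi> where "star_hom \<psi>" "\<And>x. norm (\<psi> x) \<le> norm x" "\<And>a. \<psi> (of_pre a) = \<phi> a"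
proof -
  have con: "\<exists>l. \<forall>A. Cauchy A \<longrightarrow> abs_completion A = x \<longrightarrow> (\<lambda>n. \<phi> (A n)) \<longlonglongrightarrow> l" for x
  proof -
    obtain B where B: "Cauchy B" "x = abs_completion B" by (rule completion_cases)
    have "Cauchy (\<lambda>n. \<phi> (B n))"
      using B(1) by (rule Cauchy_contraction[of _ _ 1]) (simp add: le flip: star_hom_diff[OF h])
    then obtain l where l: "(\<lambda>n. \<phi> (B n)) \<longlonglongrightarrow> l"
      using Cauchy_convergent convergent_def by blast
    have "(\<lambda>n. \<phi> (A n)) \<longlonglongrightarrow> l" if A: "Cauchy A" "abs_completion A = x" for A
    proof -
      have "completion_rel A B"
        using A B Quotient3_rel[OF Quotient3_completion] by (metis completion_rel_Cauchy)
      then have "(\<lambda>n. norm (A n - B n)) \<longlonglongrightarrow> 0"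
        by (simp add: completion_rel_def tendsto_norm_zero)
      then have "(\<lambda>n. \<phi> (A n) - \<phi> (B n)) \<longlonglongrightarrow> 0"
        by (rule Lim_null_comparison[rotated]) (simp add: le flip: star_hom_diff[OF h])
      from tendsto_add[OF this l] show ?thesis by simp
    qed
    then show ?thesis by blast
  qed
  define \<psi> where "\<psi> x = (SOME l. \<forall>A. Cauchy A \<longrightarrow> abs_completion A = x \<longrightarrow> (\<lambda>n. \<phi> (A n)) \<longlonglongrightarrow> l)" for x
  have lim: "(\<lambda>n. \<phi> (A n)) \<longlonglongrightarrow> \<psi> (abs_completion A)" if "Cauchy A" for A
    using someI_ex[OF con[of "abs_completion A"]] that unfolding \<psi>_def by blast
  have ofp: "\<psi> (of_pre a) = \<phi> a" for a
    using lim[OF Cauchy_constant[of a]] by (simp add: LIMSEQ_const_iff of_pre.abs_eq)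
  have n: "norm (\<psi> x) \<le> norm x" for x
  proof -
    obtain A where A: "Cauchy A" "x = abs_completion A" by (rule completion_cases)
    have "(\<lambda>n. norm (of_pre (A n))) \<longlonglongrightarrow> norm x"
      unfolding A(2) by (intro tendsto_norm of_pre_tendsto A)
    moreover have "(\<lambda>n. norm (\<phi> (A n))) \<longlonglongrightarrow> norm (\<psi> x)"
      unfolding A(2) by (intro tendsto_norm lim A)
    moreover have "\<exists>N. \<forall>n\<ge>N. norm (\<phi> (A n)) \<le> norm (of_pre (A n))" by (simp add: le)
    ultimately show ?thesis using LIMSEQ_le by blast
  qed
  have ad: "\<psi> (x + y) = \<psi> x + \<psi> y" for x y
  proof -
    obtain A where A: "Cauchy A" "x = abs_completion A" by (rule completion_cases)
    obtain B where B: "Cauchy B" "y = abs_completion B" by (rule completion_cases)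
    have "x + y = abs_completion (\<lambda>n. A n + B n)"
      by (simp add: A B plus_completion.abs_eq completion_rel_Cauchy)
    then have "(\<lambda>n. \<phi> (A n + B n)) \<longlonglongrightarrow> \<psi> (x + y)" using lim[OF Cauchy_plus[OF A(1) B(1)]] by simp
    moreover have "(\<lambda>n. \<phi> (A n + B n)) \<longlonglongrightarrow> \<psi> x + \<psi> y"
      using tendsto_add[OF lim[OF A(1)] lim[OF B(1)]] A B by (simp add: star_homD[OF h])
    ultimately show ?thesis by (rule LIMSEQ_unique)
  qed
  have mu: "\<psi> (x * y) = \<psi> x * \<psi> y" for x y
  proof -
    obtain A where A: "Cauchy A" "x = abs_completion A" by (rule completion_cases)
    obtain B where B: "Cauchy B" "y = abs_completion B" by (rule completion_cases)
    have "x * y = abs_completion (\<lambda>n. A n * B n)"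
      by (simp add: A B times_completion.abs_eq completion_rel_Cauchy)
    then have "(\<lambda>n. \<phi> (A n * B n)) \<longlonglongrightarrow> \<psi> (x * y)" using lim[OF Cauchy_times[OF A(1) B(1)]] by simp
    moreover have "(\<lambda>n. \<phi> (A n * B n)) \<longlonglongrightarrow> \<psi> x * \<psi> y"
      using tendsto_mult[OF lim[OF A(1)] lim[OF B(1)]] A B by (simp add: star_homD[OF h])
    ultimately show ?thesis by (rule LIMSEQ_unique)
  qed
  have sc: "\<psi> (c *\<^sub>C x) = c *\<^sub>C \<psi> x" for c x
  proof -
    have *: "c *\<^sub>C x = of_pre (c *\<^sub>C 1) * x"
      by (simp add: star_homD[OF star_hom_of_pre] mult_scaleC_left)
    show ?thesis unfolding * mu ofp by (simp add: star_homD[OF h] mult_scaleC_left)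
  qed
  have st: "\<psi> (star x) = star (\<psi> x)" for x
  proof -
    obtain A where A: "Cauchy A" "x = abs_completion A" by (rule completion_cases)
    have c: "Cauchy (\<lambda>n. star (A n))"
      using A(1) by (rule Cauchy_contraction[of _ _ 1]) (simp add: star_diff[symmetric] norm_star)
    have "star x = abs_completion (\<lambda>n. star (A n))"
      by (simp add: A star_completion.abs_eq completion_rel_Cauchy)
    then have 1: "(\<lambda>n. star (\<phi> (A n))) \<longlonglongrightarrow> \<psi> (star x)"
      using lim[OF c] by (simp add: star_homD[OF h])
    have "(\<lambda>n. \<phi> (A n) - \<psi> x) \<longlonglongrightarrow> 0" using lim[OF A(1)] A(2) by (simp add: LIM_zero)
    then have "(\<lambda>n. norm (\<phi> (A n) - \<psi> x)) \<longlonglongrightarrow> 0" by (rule tendsto_norm_zero)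
    then have "(\<lambda>n. star (\<phi> (A n)) - star (\<psi> x)) \<longlonglongrightarrow> 0"
      by (rule Lim_null_comparison[rotated]) (simp add: star_diff[symmetric] norm_star)
    then have "(\<lambda>n. star (\<phi> (A n))) \<longlonglongrightarrow> star (\<psi> x)" by (rule LIM_zero_cancel)
    with 1 show ?thesis by (rule LIMSEQ_unique)
  qed
  have "\<psi> 1 = 1" using ofp[of 1] by (simp add: star_homD[OF h] star_homD[OF star_hom_of_pre])
  then have "star_hom \<psi>" by (simp add: star_hom_def ad mu sc st)
  then show ?thesis using that n ofp by blast
qed

text \<open>*-homomorphisms between C*-algebras are automatically continuous, so the continuity condition
  does not restrict the class of homomorphisms; it only avoids having to prove that fact.\<close>

lemma ring_cstar_universal:
  fixes s :: "'r::idom nonzero \<Rightarrow> 'b::cstar_algebra" and u :: "'r \<Rightarrow> 'b"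
  assumes CL: "satisfies_CL s u"
  shows "\<exists>!\<psi> :: 'r ring_cstar \<Rightarrow> 'b. star_hom \<psi> \<and> continuous_on UNIV \<psi> \<and>
    (\<forall>m. \<psi> (ring_s m) = s m) \<and> (\<forall>n. \<psi> (ring_u n) = u n)"
proof (rule ex_ex1I)
  define ev where "ev = free_eval (case_sum s u)"
  have ev: "star_hom ev" by (simp add: ev_def star_hom_free_eval)
  have evg: "ev \<circ> (free_gen \<circ> Inl) = s" "ev \<circ> (free_gen \<circ> Inr) = u" by (auto simp: ev_def)
  have rel: "ev a = ev b" if "(a, b) \<in> CL_relations (free_gen \<circ> Inl) (free_gen \<circ> Inr)" for a b
  proof -
    have "(ev a, ev b) \<in> CL_relations s u"
      using that CL_relations_hom[OF ev, of "free_gen \<circ> Inl" "free_gen \<circ> Inr"]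
      unfolding evg by force
    then show ?thesis using CL by (auto simp: satisfies_CL_def)
  qed
  have "(\<lambda>x. norm (ev x)) \<in> CL_seminorms"
    by (auto simp: CL_seminorms_def cstar_seminorm_def star_homD[OF ev] norm_triangle_ineq
        norm_scaleC norm_mult_ineq cstar_identity star_hom_diff[OF ev] dest: rel)
  then have evn: "norm (ev x) \<le> CL_norm x" for x by (rule CL_norm_upper)
  define \<phi> where "\<phi> x = ev (rep_pre_ring_cstar x)" for x
  have \<phi>: "\<phi> (abs_pre_ring_cstar x) = ev x" for x
  proof -
    have "CL_eq (rep_pre_ring_cstar (abs_pre_ring_cstar x)) x"
      using Quotient3_rep_abs[OF Quotient3_pre_ring_cstar] CL_eq_refl by blast
    then have "norm (ev (rep_pre_ring_cstar (abs_pre_ring_cstar x) - x)) \<le> 0"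
      using evn by (metis CL_eq_def)
    then show ?thesis by (simp add: \<phi>_def star_hom_diff[OF ev])
  qed
  have surj: "\<exists>y. x = abs_pre_ring_cstar y" for x :: "'r pre_ring_cstar"
    by (metis Quotient3_abs_rep[OF Quotient3_pre_ring_cstar])
  have h: "star_hom \<phi>"
    unfolding star_hom_def
  proof (intro conjI allI)
    fix x y :: "'r pre_ring_cstar" and c
    obtain x' y' where xy: "x = abs_pre_ring_cstar x'" "y = abs_pre_ring_cstar y'" using surj by metis
    show "\<phi> (x + y) = \<phi> x + \<phi> y" "\<phi> (c *\<^sub>C x) = c *\<^sub>C \<phi> x" "\<phi> (x * y) = \<phi> x * \<phi> y"
      "\<phi> (star x) = star (\<phi> x)"
      unfolding xy star_homD[OF star_hom_abs, symmetric] \<phi> star_homD[OF ev] by (rule refl)+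
    show "\<phi> 1 = 1" unfolding star_homD(5)[OF star_hom_abs, symmetric] \<phi> star_homD[OF ev] by (rule refl)
  qed
  have "norm (\<phi> x) \<le> norm x" for x
  proof -
    obtain y where y: "x = abs_pre_ring_cstar y" using surj by blast
    show ?thesis unfolding y \<phi> norm_pre_ring_cstar.abs_eq by (rule evn)
  qed
  from extend_to_completion[OF h this] obtain \<psi> where
    \<psi>: "star_hom \<psi>" "\<And>x. norm (\<psi> x) \<le> norm x" "\<And>a. \<psi> (of_pre a) = \<phi> a" by blast
  have "continuous_on UNIV \<psi>"
  proof (rule continuous_on_iff[THEN iffD2], intro ballI allI impI)
    fix x and e :: real assume "e > 0"
    moreover have "dist (\<psi> y) (\<psi> x) \<le> dist y x" for y
      using \<psi>(2)[of "y - x"] by (simp add: dist_norm star_hom_diff[OF \<psi>(1)])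
    ultimately show "\<exists>d>0. \<forall>y\<in>UNIV. dist y x < d \<longrightarrow> dist (\<psi> y) (\<psi> x) < e"
      by (meson le_less_trans)
  qed
  moreover have "\<psi> (ring_s m) = s m" "\<psi> (ring_u n) = u n" for m n
    by (simp_all add: ring_s_def ring_u_def \<psi> \<phi> ev_def)
  ultimately show "\<exists>\<psi> :: 'r ring_cstar \<Rightarrow> 'b. star_hom \<psi> \<and> continuous_on UNIV \<psi> \<and>
      (\<forall>m. \<psi> (ring_s m) = s m) \<and> (\<forall>n. \<psi> (ring_u n) = u n)"
    using \<psi>(1) by blast
next
  fix f g :: "'r ring_cstar \<Rightarrow> 'b"
  assume f: "star_hom f \<and> continuous_on UNIV f \<and> (\<forall>m. f (ring_s m) = s m) \<and> (\<forall>n. f (ring_u n) = u n)"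
    and g: "star_hom g \<and> continuous_on UNIV g \<and> (\<forall>m. g (ring_s m) = s m) \<and> (\<forall>n. g (ring_u n) = u n)"
  let ?h = "of_pre \<circ> abs_pre_ring_cstar :: 'r CL_free \<Rightarrow> 'r ring_cstar"
  have h: "star_hom ?h" by (intro star_hom_comp star_hom_abs star_hom_of_pre)
  have eq0: "(f \<circ> ?h) x = (g \<circ> ?h) x" for x
  proof (rule free_star_hom_unique)
    show "star_hom (f \<circ> ?h)" "star_hom (g \<circ> ?h)" using f g h by (auto intro: star_hom_comp)
    show "(f \<circ> ?h) (free_gen k) = (g \<circ> ?h) (free_gen k)" for k
      using f g by (cases k) (simp_all flip: ring_s_def ring_u_def)
  qed
  have eq: "f (of_pre a) = g (of_pre a)" for a
  proof -
    have "a = abs_pre_ring_cstar (rep_pre_ring_cstar a)"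
      by (rule Quotient3_abs_rep[OF Quotient3_pre_ring_cstar, symmetric])
    then show ?thesis using eq0[of "rep_pre_ring_cstar a"] by simp
  qed
  show "f = g"
  proof
    fix x :: "'r ring_cstar"
    obtain A where A: "Cauchy A" "x = abs_completion A" by (rule completion_cases)
    have t: "(\<lambda>n. of_pre (A n)) \<longlonglongrightarrow> x" using of_pre_tendsto[OF A(1)] A(2) by simp
    have "isCont f x" "isCont g x" using f g by (simp_all add: continuous_on_eq_continuous_at)
    then have "(\<lambda>n. f (of_pre (A n))) \<longlonglongrightarrow> f x" "(\<lambda>n. g (of_pre (A n))) \<longlonglongrightarrow> g x"
      using t isCont_tendsto_compose by blast+
    then show "f x = g x" unfolding eq by (rule LIMSEQ_unique)
  qed
qed

end

theory Submission
  imports Defs "HOL-Computational_Algebra.Polynomial_Factorial"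
begin

text \<open>
  Let \<open>F\<close> be the free *-algebra on the generators, \<open>h\<close> its evaluation in \<open>\<AA>[R]\<close> and \<open>K\<close> the field of
  fractions of \<open>R\<close>. A word in the generators and their adjoints has a degree \<open>(scale, shift)\<close>, namely
  the affine map of \<open>K\<close> that it composes to when \<open>s\<^sub>m\<close> is read as \<open>r \<mapsto> m r\<close> and \<open>u\<^sup>n\<close> as \<open>r \<mapsto> n + r\<close>;
  and it acts on \<open>R\<close> as a partial injection, the restriction of this affine map to the points at
  which every division on the way is possible. Adding up the coefficients of the words of scale 1
  that fix 0 defines a positive functional \<open>vac\<close> on \<open>F\<close>. The theorem results from comparing norms
  with \<open>vac\<close> in both directions.

  From \<open>vac\<close> to ideals: for every \<open>x \<in> F\<close> there is an isometry \<open>v = u\<^sup>l s\<^sub>m\<close> with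
  \<open>v\<^sup>* h(x) v = vac(x) 1\<close> (\<open>ex_compressing_isometry\<close>). If \<open>m\<close> is divisible enough, a word
  maps \<open>u\<^sup>l s\<^sub>m\<close> to some \<open>u\<^sup>k s\<^sub>n\<close> or to 0, and since \<open>R\<close> is not a field, \<open>l\<close> and \<open>m\<close> can be chosen such
  that all words of nontrivial degree are compressed to 0. Consequently, if \<open>I\<close> is a proper closed
  ideal, then \<open>\<bar>vac(x)\<bar>\<close> is at most the distance of \<open>h(x)\<close> to \<open>I\<close>: otherwise \<open>I\<close> would contain an
  element close to a nonzero scalar, and then 1 (\<open>vac_le_qnorm\<close>).

  From norms to \<open>vac\<close>: elements of trivial degree are diagonal for a finite partition of 1 into range
  projections \<open>u\<^sup>l s\<^sub>m s\<^sub>m\<^sup>* u\<^sup>-\<^sup>l\<close>, and \<open>vac\<close> sees their eigenvalues (\<open>norm_degree_zero_le\<close>). The passage from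
  trivial degree to all of \<open>F\<close> is where the amenability of the affine group would enter. As this
  group is an extension of the abelian group \<open>K\<^sup>\<times>\<close> by the abelian group \<open>K\<close>, polynomial growth suffices: if \<open>x\<close> is
  self-adjoint, the degrees in \<open>x\<^sup>n\<close> with respect to an abelian group number at most polynomially
  many in \<open>n\<close>, and a polynomial factor in an estimate of \<open>\<parallel>x\<parallel>\<^sup>n = \<parallel>x\<^sup>n\<parallel>\<close> disappears
  when \<open>n\<close>-th roots are taken (\<open>norm_le_if_parts_of_powers_le\<close>). This argument is used
  for the shifts on the words of scale 1 (\<open>norm_scale_one_le\<close>) and then for the scales
  (\<open>norm_le_qnorm\<close>). Between the two, the part of scale 1 has to be shown not to increase the relevant
  bounds; this is done for the operator norm in the representation that belongs to the
  positive functional \<open>vac\<close> (\<open>bounded_by_scale_part\<close>), which is dominated by the distance to \<open>I\<close> by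
  iterating the Cauchy-Schwarz inequality (\<open>sqnorm_dominated\<close>).

  The result is \<open>\<parallel>h(x)\<parallel> \<le> dist(h(x), I)\<close> for all \<open>x \<in> F\<close>, and \<open>h(F)\<close> is dense; so \<open>I = 0\<close>.
\<close>

section \<open>Polynomial factors in power estimates\<close>

lemma polynomial_times_power_tendsto_0:
  fixes r :: real
  assumes "0 \<le> r" "r < 1"
  shows "(\<lambda>n. real (n + 1) ^ k * r ^ n) \<longlonglongrightarrow> 0"
proof -
  \<comment> \<open>a share \<open>q\<^sup>n\<close> of \<open>r\<^sup>n\<close> for each of the \<open>k\<close> linear factors and one more that tends to 0\<close>
  define q where "q = root (Suc k) r"
  have q: "0 \<le> q" "q < 1" "q ^ Suc k = r"
    using assms real_root_pow_pos2[of "Suc k" r] by (auto simp: q_def real_root_pos_pos_le)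
  have "(\<lambda>n. real n * q ^ n + q ^ n) \<longlonglongrightarrow> 0 + 0"
    using powser_times_n_limit_0[of q] q by (intro tendsto_add LIMSEQ_power_zero) auto
  then have "(\<lambda>n. (real (n + 1) * q ^ n) ^ k * q ^ n) \<longlonglongrightarrow> 0 ^ k * 0"
    using q by (intro tendsto_mult tendsto_power LIMSEQ_power_zero) (auto simp: algebra_simps)
  moreover have "(real (n + 1) * q ^ n) ^ k * q ^ n = real (n + 1) ^ k * r ^ n" for n
  proof -
    have "r ^ n = (q ^ n) ^ Suc k" unfolding q(3)[symmetric] by (metis mult.commute power_mult)
    then show ?thesis by (simp add: power_mult_distrib mult.commute)
  qed
  ultimately show ?thesis by simp
qed

text \<open>Only exponents \<open>2\<^sup>j\<close> occur, since these are the powers for which the C*-identity gives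
  \<open>\<parallel>x\<^sup>n\<parallel> = \<parallel>x\<parallel>\<^sup>n\<close>.\<close>

lemma le_if_powers_le_polynomial:
  fixes s t C :: real
  assumes s: "0 \<le> s"
    and le: "\<And>j. t ^ 2 ^ j \<le> C * real (2 ^ j + 1) ^ k * s ^ 2 ^ j"
  shows "t \<le> s"
proof (rule ccontr)
  assume "\<not> t \<le> s"
  then have t: "0 < t" "s < t" using s by auto
  define r where "r = s / t"
  have r: "0 \<le> r" "r < 1" using s t by (auto simp: r_def)
  have "strict_mono (\<lambda>j. 2 ^ j :: nat)" by (simp add: strict_mono_def)
  then have "((\<lambda>n. real (n + 1) ^ k * r ^ n) \<circ> (\<lambda>j. 2 ^ j)) \<longlonglongrightarrow> 0"
    by (rule LIMSEQ_subseq_LIMSEQ[OF polynomial_times_power_tendsto_0[OF r]])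
  then have "(\<lambda>j. C * (real (2 ^ j + 1) ^ k * r ^ 2 ^ j)) \<longlonglongrightarrow> C * 0"
    by (intro tendsto_mult tendsto_const) (simp add: o_def)
  moreover have "1 \<le> C * (real (2 ^ j + 1) ^ k * r ^ 2 ^ j)" for j
    using le[of j] t by (simp add: r_def power_divide field_simps)
  ultimately have "1 \<le> C * 0"
    by (meson LIMSEQ_le_const)
  then show False by simp
qed

section \<open>Projections in C*-algebras\<close>

lemma scaleC_minus_left: "(- c) *\<^sub>C x = - (c *\<^sub>C (x :: 'a::star_algebra))"
  by (metis mult_minus1 scaleC_minus_one scaleC_scaleC)

lemma scaleC_sum_left: "(\<Sum>i\<in>A. f i *\<^sub>C a) = (\<Sum>i\<in>A. f i) *\<^sub>C (a :: 'a::star_algebra)"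
  by (induction A rule: infinite_finite_induct) (simp_all add: scaleC_add_left)

lemma scaleC_two: "2 *\<^sub>C x = x + (x :: 'a::star_algebra)"
  using scaleC_add_left[of 1 1 x] by (simp add: scaleC_one)

lemma norm_one_le: "norm (1 :: 'a::pre_cstar_algebra) \<le> 1"
proof -
  have "norm (1::'a) * norm (1::'a) = norm (1::'a)"
    using cstar_identity[of "1::'a"] by (simp add: power2_eq_square)
  then show ?thesis by (cases "norm (1::'a) = 0") auto
qed

lemma norm_isometry_le:
  assumes "star v * v = (1 :: 'a::pre_cstar_algebra)"
  shows "norm v \<le> 1"
  using cstar_identity[of v] norm_one_le[where 'a='a] assms by (simp add: abs_square_le_1)

definition projection :: "'a::star_algebra \<Rightarrow> bool" where
  "projection p \<longleftrightarrow> star p = p \<and> p * p = p"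

lemma projectionD:
  assumes "projection p"
  shows "star p = p" "p * p = p"
  using assms by (auto simp: projection_def)

lemma projection_complement: "projection p \<Longrightarrow> projection (1 - p)"
  by (simp add: projection_def star_diff algebra_simps)

lemma norm_projection_le:
  fixes p :: "'a::pre_cstar_algebra"
  assumes "projection p"
  shows "norm p \<le> 1"
proof -
  have "norm p * norm p = norm p"
    using cstar_identity[of p] assms by (simp add: projection_def power2_eq_square)
  then show ?thesis by (cases "norm p = 0") auto
qed

lemma norm_mult_le:
  fixes x y :: "'a::real_normed_algebra"
  assumes "norm x \<le> a" "norm y \<le> b"
  shows "norm (x * y) \<le> a * b"
  by (meson assms mult_mono norm_ge_zero norm_mult_ineq order_trans)

text \<open>The square of \<open>e + c a\<close> plus the square of \<open>e + \<i> c a\<close> is \<open>2 (e + (1 + \<i>) c a)\<close>, because the terms in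
  \<open>a\<^sup>2\<close> cancel. Hence the hypothesis is inherited by \<open>(1 + \<i>) a\<close>, and after \<open>n\<close> steps \<open>(1 + \<i>)\<^sup>n a\<close>, whose norm
  grows unless \<open>a = 0\<close>, is still bounded by 2.\<close>

lemma rotated_contractions_imp_zero:
  fixes a e :: "'a::pre_cstar_algebra"
  assumes e: "e * e = e" "e * a = a" "a * e = a"
    and le: "\<And>k. norm (e + \<i> ^ k *\<^sub>C a) \<le> 1"
  shows "a = 0"
proof -
  have *: "norm (e + (\<i> ^ k * (1 + \<i>) ^ n) *\<^sub>C a) \<le> 1" for k n
  proof (induction n arbitrary: k)
    case 0
    show ?case using le by simp
  next
    case (Suc n)
    define c where "c = \<i> ^ k * (1 + \<i>) ^ n"
    have c: "\<i> ^ Suc k * (1 + \<i>) ^ n = \<i> * c" by (simp add: c_def)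
    have sq: "(e + d *\<^sub>C a) * (e + d *\<^sub>C a) = e + (2 * d) *\<^sub>C a + (d * d) *\<^sub>C (a * a)" for d
    proof -
      have "(2 * d) *\<^sub>C a = d *\<^sub>C a + d *\<^sub>C a" using scaleC_add_left[of d d a] by simp
      then show ?thesis
        using e
        by (simp add: algebra_simps mult_scaleC_left mult_scaleC_right scaleC_scaleC scaleC_add_right)
    qed
    have "(e + c *\<^sub>C a) * (e + c *\<^sub>C a) + (e + (\<i> * c) *\<^sub>C a) * (e + (\<i> * c) *\<^sub>C a) =
        (e + e) + ((2 * c) *\<^sub>C a + (2 * (\<i> * c)) *\<^sub>C a) + ((c * c) *\<^sub>C (a * a) + (\<i> * c * (\<i> * c)) *\<^sub>C (a * a))"
      unfolding sq by (simp only: add_ac)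
    also have "\<dots> = 2 *\<^sub>C (e + (c * (1 + \<i>)) *\<^sub>C a)"
      using scaleC_add_left[of 1 1 e]
      by (simp add: scaleC_add_right scaleC_scaleC scaleC_one algebra_simps flip: scaleC_add_left)
    finally have "2 * norm (e + (c * (1 + \<i>)) *\<^sub>C a) =
        norm ((e + c *\<^sub>C a) * (e + c *\<^sub>C a) + (e + (\<i> * c) *\<^sub>C a) * (e + (\<i> * c) *\<^sub>C a))"
      by (simp add: norm_scaleC)
    also have "\<dots> \<le> 1 * 1 + 1 * 1"
      using Suc[of k] Suc[of "Suc k"] unfolding c c_def[symmetric]
      by (intro norm_triangle_mono norm_mult_le)
    finally show ?case by (simp add: c_def mult_ac)
  qed
  have "sqrt 2 ^ n * norm a \<le> 2" for n
  proof -
    have cm: "cmod (1 + \<i>) = sqrt 2" by (simp add: cmod_def)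
    have "2 *\<^sub>C ((1 + \<i>) ^ n *\<^sub>C a) =
        (e + (\<i> ^ 0 * (1 + \<i>) ^ n) *\<^sub>C a) - (e + (\<i> ^ 2 * (1 + \<i>) ^ n) *\<^sub>C a)"
      by (simp add: scaleC_two scaleC_minus_left)
    also have "norm \<dots> \<le> 1 + 1" by (intro norm_triangle_le_diff add_mono *)
    finally have "2 * (sqrt 2 ^ n * norm a) \<le> 1 + 1"
      by (simp add: norm_scaleC norm_power cm)
    then show ?thesis by simp
  qed
  then have *: "norm a \<le> 2 * (1 / sqrt 2) ^ n" for n by (simp add: power_divide field_simps)
  have "(\<lambda>n. 2 * (1 / sqrt 2) ^ n) \<longlonglongrightarrow> 2 * 0"
    by (intro tendsto_mult tendsto_const LIMSEQ_realpow_zero) auto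
  then have "norm a \<le> 2 * 0" by (rule LIMSEQ_le_const) (use * in blast)
  then show ?thesis by simp
qed

text \<open>Read in terms of spectra in the corner of \<open>e\<close>: the two bounds say \<open>a \<le> 0\<close> and \<open>a \<ge> 0\<close>. The
  C*-identity turns the bound on \<open>e + a\<^sup>2\<close>, the mean of the squares of \<open>e + a\<close> and \<open>e - a\<close>, into bounds
  on \<open>e + \<i> a\<close> and \<open>e - \<i> a\<close>, so the preceding lemma applies.\<close>

lemma selfadjoint_contractions_imp_zero:
  fixes a e :: "'a::pre_cstar_algebra"
  assumes e: "projection e" "e * a = a" "a * e = a" and a: "star a = a"
    and le: "norm (e + a) \<le> 1" "norm (e - a) \<le> 1"
  shows "a = 0"
proof (rule rotated_contractions_imp_zero[OF projectionD(2)[OF e(1)] e(2,3)])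
  note e' = projectionD[OF e(1)]
  have "(e + a) * (e + a) + (e - a) * (e - a) = 2 *\<^sub>C (e + a * a)"
    using scaleC_add_left[of 1 1 "e + a * a"]
    by (simp add: scaleC_one algebra_simps e e')
  then have "2 * norm (e + a * a) = norm ((e + a) * (e + a) + (e - a) * (e - a))"
    by (simp add: norm_scaleC)
  also have "\<dots> \<le> 1 * 1 + 1 * 1"
    using le by (intro norm_triangle_mono norm_mult_le)
  finally have sq: "norm (e + a * a) \<le> 1" by simp
  have rot: "norm (e + c *\<^sub>C a) \<le> 1" if c: "c = \<i> \<or> c = - \<i>" for c
  proof -
    have c: "cnj c = - c" "c * c = -1" using c by auto
    have "star (e + c *\<^sub>C a) * (e + c *\<^sub>C a) = (e - c *\<^sub>C a) * (e + c *\<^sub>C a)"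
      by (simp add: star_add star_scaleC a e' c scaleC_minus_left)
    also have "\<dots> = e + a * a"
      by (simp add: algebra_simps e e' mult_scaleC_left mult_scaleC_right scaleC_scaleC c
          scaleC_minus_one scaleC_diff_right)
    finally have "star (e + c *\<^sub>C a) * (e + c *\<^sub>C a) = e + a * a" .
    then have "(norm (e + c *\<^sub>C a))\<^sup>2 \<le> 1" using sq by (metis cstar_identity)
    then show ?thesis by (simp add: abs_square_le_1)
  qed
  fix k :: nat
  consider "\<i> ^ k = 1" | "\<i> ^ k = -1" | "\<i> ^ k = \<i>" | "\<i> ^ k = - \<i>"
  proof -
    have "\<i> ^ k = 1 \<or> \<i> ^ k = -1 \<or> \<i> ^ k = \<i> \<or> \<i> ^ k = - \<i>" by (induction k) auto
    then show ?thesis using that by blast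
  qed
  then show "norm (e + \<i> ^ k *\<^sub>C a) \<le> 1"
    using le rot by cases (auto simp: scaleC_one scaleC_minus_one)
qed

text \<open>Put \<open>e = p i\<close>. Compressing \<open>\<Sum>k. p k = 1\<close> by \<open>e\<close> shows that the positive elements \<open>e (p k) e\<close>,
  \<open>k \<noteq> i\<close>, add up to 0. The substitute for positivity of \<open>a\<close> is \<open>\<parallel>t e - a\<parallel> \<le> t\<close>, a condition that is
  evidently stable under sums; it shows that \<open>e (p j) e\<close> is both positive and negative, hence 0, and
  the C*-identity gives \<open>p j e = 0\<close>.\<close>

lemma projections_sum_one_orthogonal:
  fixes p :: "'i \<Rightarrow> 'a::pre_cstar_algebra"
  assumes fin: "finite I" and p: "\<And>i. i \<in> I \<Longrightarrow> projection (p i)" and sum: "(\<Sum>i\<in>I. p i) = 1"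
    and ij: "i \<in> I" "j \<in> I" "i \<noteq> j"
  shows "p j * p i = 0"
proof -
  define e where "e = p i"
  have e: "star e = e" "e * e = e" using p[OF ij(1)] by (auto simp: e_def projection_def)
  then have e': "e * (e * x) = e * x" for x by (metis mult.assoc)
  define a where "a k = e * p k * e" for k
  have ae: "e * a k = a k" "a k * e = a k" for k by (simp_all add: a_def mult.assoc e e')
  have sa: "star (a k) = a k" if "k \<in> I" for k
    using p[OF that] by (simp add: a_def star_mult e projection_def mult.assoc)
  have "(\<Sum>k\<in>I. a k) = e"
    using sum by (simp add: a_def e flip: sum_distrib_left sum_distrib_right)
  moreover have "a i = e" by (simp add: a_def e e_def[symmetric])
  ultimately have "(\<Sum>k\<in>I - {i}. a k) = 0" using fin ij by (simp add: sum_diff1)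
  then have aj: "a j = - (\<Sum>k\<in>I - {i, j}. a k)"
    using fin ij sum.remove[of "I - {i}" j a]
    by (simp add: eq_neg_iff_add_eq_0 Diff_insert2[symmetric])
  have c: "norm (e - a k) \<le> 1" if "k \<in> I" for k
  proof -
    have "e - a k = e * (1 - p k) * e" by (simp add: a_def algebra_simps e)
    also have "norm \<dots> \<le> 1 * 1 * 1"
      using that p ij by (intro norm_mult_le norm_projection_le projection_complement) (auto simp: e_def)
    finally show ?thesis by simp
  qed
  define n where "n = card (I - {i, j})"
  have plus: "norm (real n *\<^sub>R e + a j) \<le> real n"
  proof -
    have "real n *\<^sub>R e + a j = (\<Sum>k\<in>I - {i, j}. e - a k)"
      by (simp add: sum_subtractf aj n_def sum_constant_scaleR)
    also have "norm \<dots> \<le> (\<Sum>k\<in>I - {i, j}. 1)" by (intro sum_norm_le c) auto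
    finally show ?thesis by (simp add: n_def)
  qed
  have ne: "norm e \<le> 1" using p ij by (auto simp: e_def intro: norm_projection_le)
  \<comment> \<open>\<open>n\<close> is large enough for the bound on \<open>n e + a j\<close>, and \<open>1\<close> for the one on \<open>e - a j\<close>; \<open>t\<close> serves both\<close>
  define t where "t = real n + 1"
  have t: "t > 0" by (simp add: t_def)
  have "norm (t *\<^sub>R e + a j) \<le> t"
  proof -
    have "t *\<^sub>R e + a j = (real n *\<^sub>R e + a j) + e" by (simp add: t_def algebra_simps)
    also have "norm \<dots> \<le> t" unfolding t_def using plus ne by (rule norm_triangle_mono)
    finally show ?thesis .
  qed
  moreover have "norm (t *\<^sub>R e - a j) \<le> t"
  proof -
    have "t *\<^sub>R e - a j = real n *\<^sub>R e + (e - a j)" by (simp add: t_def algebra_simps)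
    also have "norm \<dots> \<le> t"
      unfolding t_def using ne c[OF ij(2)] by (intro norm_triangle_mono) (simp_all add: mult_left_le)
    finally show ?thesis .
  qed
  moreover have "e + inverse t *\<^sub>R a j = inverse t *\<^sub>R (t *\<^sub>R e + a j)"
    "e - inverse t *\<^sub>R a j = inverse t *\<^sub>R (t *\<^sub>R e - a j)"
    using t by (simp_all add: scaleR_add_right scaleR_diff_right)
  ultimately have le: "norm (e + inverse t *\<^sub>R a j) \<le> 1" "norm (e - inverse t *\<^sub>R a j) \<le> 1"
    using t by (simp_all only: norm_scaleR) (simp_all add: inverse_eq_divide divide_le_eq)
  have "inverse t *\<^sub>R a j = 0"
  proof (rule selfadjoint_contractions_imp_zero[OF _ _ _ _ le])
    show "projection e" by (simp add: projection_def e)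
    show "star (inverse t *\<^sub>R a j) = inverse t *\<^sub>R a j"
      using sa ij by (simp add: scaleR_scaleC star_scaleC)
  qed (simp_all add: ae)
  then have "a j = 0" using t by simp
  moreover have "a j = e * (p j * p j) * e" using p[OF ij(2)] by (simp add: a_def projection_def)
  then have "a j = star (p j * e) * (p j * e)"
    using p[OF ij(2)] by (simp add: star_mult e projection_def mult.assoc)
  ultimately have "norm (p j * e) = 0" using cstar_identity[of "p j * e"] by simp
  then show ?thesis by (simp add: e_def)
qed

lemma norm_selfadjoint_power:
  fixes x :: "'a::pre_cstar_algebra"
  assumes "star x = x"
  shows "norm (x ^ 2 ^ k) = norm x ^ 2 ^ k"
proof (induction k)
  case (Suc k)
  have "star (x ^ n) = x ^ n" for n
    by (induction n) (simp_all add: star_mult assms power_commutes)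
  then have "norm (x ^ 2 ^ k * x ^ 2 ^ k) = (norm (x ^ 2 ^ k))\<^sup>2"
    using cstar_identity[of "x ^ 2 ^ k"] by simp
  then show ?case by (simp add: Suc mult_2 power_add power2_eq_square flip: power_mult)
qed simp

text \<open>The crude triangle inequality is off by the factor \<open>card I\<close>, which disappears in high powers.\<close>

lemma norm_orthogonal_projections_le:
  fixes p :: "'i \<Rightarrow> 'a::pre_cstar_algebra"
  assumes fin: "finite I" and p: "\<And>i. i \<in> I \<Longrightarrow> projection (p i)"
    and orth: "\<And>i j. i \<in> I \<Longrightarrow> j \<in> I \<Longrightarrow> i \<noteq> j \<Longrightarrow> p i * p j = 0"
    and C: "\<And>i. i \<in> I \<Longrightarrow> cmod (c i) \<le> C" "0 \<le> C"
  shows "norm (\<Sum>i\<in>I. c i *\<^sub>C p i) \<le> C"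
proof -
  have mult: "(\<Sum>i\<in>I. a i *\<^sub>C p i) * (\<Sum>i\<in>I. b i *\<^sub>C p i) = (\<Sum>i\<in>I. (a i * b i) *\<^sub>C p i)" for a b
  proof -
    have "(\<Sum>i\<in>I. a i *\<^sub>C p i) * (\<Sum>i\<in>I. b i *\<^sub>C p i) = (\<Sum>i\<in>I. \<Sum>j\<in>I. (a i * b j) *\<^sub>C (p i * p j))"
      by (simp add: sum_product mult_scaleC_left mult_scaleC_right scaleC_scaleC mult.commute)
    also have "\<dots> = (\<Sum>i\<in>I. \<Sum>j\<in>I. if j = i then (a i * b i) *\<^sub>C p i else 0)"
      using p orth by (intro sum.cong) (auto simp: projection_def)
    finally show ?thesis using fin by simp
  qed
  have star: "star (\<Sum>i\<in>A. a i *\<^sub>C p i) = (\<Sum>i\<in>A. cnj (a i) *\<^sub>C p i)" if "A \<subseteq> I" for a A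
    using finite_subset[OF that fin] that
    by (induction A rule: finite_induct) (simp_all add: star_add star_scaleC p projectionD)
  define z where "z = (\<Sum>i\<in>I. c i *\<^sub>C p i)"
  define x where "x = star z * z"
  have x: "x = (\<Sum>i\<in>I. (cnj (c i) * c i) *\<^sub>C p i)" by (simp add: x_def z_def star mult)
  have pow: "x ^ Suc n = (\<Sum>i\<in>I. ((cnj (c i) * c i) ^ Suc n) *\<^sub>C p i)" for n
    by (induction n) (simp_all add: x mult mult.assoc)
  have "norm x \<le> C\<^sup>2"
  proof (rule le_if_powers_le_polynomial[where C = "real (card I)" and k = 0])
    fix j
    obtain n where n: "2 ^ j = Suc n" by (metis Suc_pred zero_less_numeral zero_less_power)
    have "norm x ^ 2 ^ j = norm (x ^ 2 ^ j)"
      by (rule norm_selfadjoint_power[symmetric]) (simp add: x_def star_mult star_star)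
    also have "\<dots> = norm (\<Sum>i\<in>I. ((cnj (c i) * c i) ^ Suc n) *\<^sub>C p i)" by (simp only: n pow)
    also have "\<dots> \<le> (\<Sum>i\<in>I. (C\<^sup>2) ^ Suc n)"
    proof (rule sum_norm_le)
      fix i assume i: "i \<in> I"
      have "norm (((cnj (c i) * c i) ^ Suc n) *\<^sub>C p i) = ((cmod (c i))\<^sup>2) ^ Suc n * norm (p i)"
        by (simp add: norm_scaleC norm_mult norm_power power2_eq_square)
      also have "\<dots> \<le> (C\<^sup>2) ^ Suc n * 1"
        using i C p by (intro mult_mono power_mono norm_projection_le) auto
      finally show "norm (((cnj (c i) * c i) ^ Suc n) *\<^sub>C p i) \<le> (C\<^sup>2) ^ Suc n" by simp
    qed
    finally show "norm x ^ 2 ^ j \<le> real (card I) * real (2 ^ j + 1) ^ 0 * (C\<^sup>2) ^ 2 ^ j" by (simp add: n)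
  qed simp
  then have "(norm z)\<^sup>2 \<le> C\<^sup>2" by (simp add: x_def cstar_identity)
  then show ?thesis using C(2) by (simp add: z_def power2_le_iff_abs_le)
qed

section \<open>Words and homogeneous parts in the free *-algebra\<close>

lift_definition coef :: "'g free_star_algebra \<Rightarrow> 'g star_word \<Rightarrow> complex" is Poly_Mapping.lookup .

definition words :: "'g free_star_algebra \<Rightarrow> 'g star_word set" where
  "words x = {w. coef x w \<noteq> 0}"

lemma free_eqI: "(\<And>w. coef x w = coef y w) \<Longrightarrow> x = y"
  by transfer (rule poly_mapping_eqI)

lemma finite_words [simp]: "finite (words x)"
  unfolding words_def by transfer simp

lemma coef_simps [simp]:
  "coef 0 w = 0" "coef (x + y) w = coef x w + coef y w" "coef (c *\<^sub>C x) w = c * coef x w"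
  "coef (free_word v) w = of_bool (v = w)" "coef (star x) w = cnj (coef x (word_adj w))"
proof -
  show "coef 0 w = 0" "coef (x + y) w = coef x w + coef y w"
    by (transfer; simp add: lookup_add)+
  have "Poly_Mapping.lookup (Poly_Mapping.single 0 c * f) w = c * Poly_Mapping.lookup f w"
    for f :: "'a star_word \<Rightarrow>\<^sub>0 complex"
    by (induction f rule: poly_mapping_single_induct)
      (simp_all add: mult_single lookup_single when_def distrib_left lookup_add)
  then show "coef (c *\<^sub>C x) w = c * coef x w" by transfer
  show "coef (free_word v) w = of_bool (v = w)"
    by transfer (simp add: lookup_single when_def)
  show "coef (star x) w = cnj (coef x (word_adj w))"
    by transfer (rule lookup_pm_star)
qed

lemma coef_sum [simp]: "coef (\<Sum>i\<in>A. f i) w = (\<Sum>i\<in>A. coef (f i) w)"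
  by (induction A rule: infinite_finite_induct) auto

lemma words_expansion: "x = (\<Sum>w\<in>words x. coef x w *\<^sub>C free_word w)"
proof (rule free_eqI)
  fix v
  have "(\<Sum>w\<in>words x. coef x w * of_bool (w = v)) = (\<Sum>w\<in>words x. if w = v then coef x w else 0)"
    by (intro sum.cong) auto
  then show "coef x v = coef (\<Sum>w\<in>words x. coef x w *\<^sub>C free_word w) v"
    by (cases "v \<in> words x") (simp_all, simp add: words_def)
qed

lemma words_add: "words (x + y) \<subseteq> words x \<union> words y"
  by (auto simp: words_def)

lemma words_star: "words (star x) = word_adj ` words x"
proof -
  have "w \<in> word_adj ` words x" if "w \<in> words (star x)" for w
    using that by (intro image_eqI[of _ _ "word_adj w"]) (auto simp: words_def)
  then show ?thesis by (auto simp: words_def)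
qed

lemma words_free_word: "words (free_word w) = {w}"
  by (auto simp: words_def)

lemma words_mult: "words (x * y) \<subseteq> {v + w |v w. v \<in> words x \<and> w \<in> words y}"
  for x y :: "'a free_star_algebra"
proof -
  have "words z = Poly_Mapping.keys (Rep_free_star_algebra z)" for z :: "'a free_star_algebra"
    by (auto simp: words_def coef.rep_eq in_keys_iff)
  then show ?thesis
    using keys_mult[of "Rep_free_star_algebra x" "Rep_free_star_algebra y"]
    by (simp add: times_free_star_algebra.rep_eq)
qed

lemma words_power:
  "words (x ^ n) \<subseteq> {sum_list ws |ws. length ws = n \<and> set ws \<subseteq> words x}"
  for x :: "'a free_star_algebra"
proof (induction n)
  case 0
  have "words (1 :: 'a free_star_algebra) = {0}"
    using words_free_word[of 0] by (simp only: free_word_zero)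
  then show ?case by simp
next
  case (Suc n)
  have "v + w \<in> {sum_list ws |ws. length ws = Suc n \<and> set ws \<subseteq> words x}"
    if vw: "v \<in> words x" "w \<in> words (x ^ n)" for v w
  proof -
    obtain ws where "w = sum_list ws" "length ws = n" "set ws \<subseteq> words x" using vw(2) Suc by blast
    then show ?thesis using vw(1) by (intro CollectI exI[of _ "v # ws"]) auto
  qed
  then show ?case using words_mult[of x "x ^ n"] by auto
qed

lift_definition pm_part :: "('b \<Rightarrow> bool) \<Rightarrow> ('b \<Rightarrow>\<^sub>0 complex) \<Rightarrow> 'b \<Rightarrow>\<^sub>0 complex"
  is "\<lambda>P f w. f w when P w"
  by (rule finite_subset[rotated]) auto

text \<open>When \<open>P\<close> fixes a degree, this is the homogeneous component of that degree; components are well defined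
  since the algebra is free.\<close>

lift_definition part :: "('g star_word \<Rightarrow> bool) \<Rightarrow> 'g free_star_algebra \<Rightarrow> 'g free_star_algebra"
  is pm_part .

lemma coef_part [simp]: "coef (part P x) w = (if P w then coef x w else 0)"
  by transfer (simp add: pm_part.rep_eq when_def)

lemma words_part [simp]: "words (part P x) = {w \<in> words x. P w}"
  by (auto simp: words_def)

lemma part_add: "part P (x + y) = part P x + part P y"
  by (rule free_eqI) simp

lemma part_scaleC: "part P (c *\<^sub>C x) = c *\<^sub>C part P x"
  by (rule free_eqI) simp

lemma part_sum: "part P (\<Sum>i\<in>A. f i) = (\<Sum>i\<in>A. part P (f i))"
  by (rule free_eqI) simp

lemma part_free_word: "part P (free_word w) = (if P w then free_word w else 0)"
  by (rule free_eqI) auto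

lemma part_cong: "(\<And>w. w \<in> words x \<Longrightarrow> P w \<longleftrightarrow> Q w) \<Longrightarrow> part P x = part Q x"
  by (rule free_eqI) (auto simp: words_def)

lemma sum_parts: "x = (\<Sum>k\<in>deg ` words x. part (\<lambda>w. deg w = k) x)"
proof (rule free_eqI)
  fix w
  have "(\<Sum>k\<in>deg ` words x. if deg w = k then coef x w else 0) =
      (if deg w \<in> deg ` words x then coef x w else 0)" by simp
  also have "\<dots> = coef x w" by (auto simp: words_def)
  finally show "coef x w = coef (\<Sum>k\<in>deg ` words x. part (\<lambda>w. deg w = k) x) w" by simp
qed

text \<open>Multiplication by a homogeneous element permutes homogeneous components. The hypothesis speaks about
  words so as to cover degrees in nonabelian groups and degrees that are only partly fixed.\<close>

lemma part_mult_left: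
  assumes "\<And>v w. v \<in> words x \<Longrightarrow> P (v + w) \<longleftrightarrow> Q w"
  shows "part P (x * y) = x * part Q y"
proof -
  have 1: "part P (free_word v * y) = free_word v * part Q y" if "v \<in> words x" for v
  proof (induction y rule: free_induct)
    case (1 c w)
    show ?case
      using assms[OF that, of w]
      by (simp add: mult_scaleC_right part_scaleC part_free_word flip: free_word_plus)
  qed (simp add: distrib_left part_add)
  have "part P ((\<Sum>v\<in>words x. coef x v *\<^sub>C free_word v) * y) =
      (\<Sum>v\<in>words x. coef x v *\<^sub>C free_word v) * part Q y"
    by (simp add: sum_distrib_right part_sum mult_scaleC_left part_scaleC 1)
  then show ?thesis by (simp flip: words_expansion)
qed

lemma part_mult_right:
  assumes "\<And>v w. w \<in> words y \<Longrightarrow> P (v + w) \<longleftrightarrow> Q v"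
  shows "part P (x * y) = part Q x * y"
proof -
  have 1: "part P (x * free_word w) = part Q x * free_word w" if "w \<in> words y" for w
  proof (induction x rule: free_induct)
    case (1 c v)
    show ?case
      using assms[OF that, of v]
      by (simp add: mult_scaleC_left part_scaleC part_free_word flip: free_word_plus)
  qed (simp add: distrib_right part_add)
  have "part P (x * (\<Sum>w\<in>words y. coef y w *\<^sub>C free_word w)) =
      part Q x * (\<Sum>w\<in>words y. coef y w *\<^sub>C free_word w)"
    by (simp add: sum_distrib_left part_sum mult_scaleC_right part_scaleC 1)
  then show ?thesis by (simp flip: words_expansion)
qed

definition linear_extension :: "('g star_word \<Rightarrow> complex) \<Rightarrow> 'g free_star_algebra \<Rightarrow> complex" where
  "linear_extension f x = (\<Sum>w\<in>words x. coef x w * f w)"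

lemma linear_extension_superset:
  assumes "finite A" "words x \<subseteq> A"
  shows "linear_extension f x = (\<Sum>w\<in>A. coef x w * f w)"
  unfolding linear_extension_def using assms by (intro sum.mono_neutral_left) (auto simp: words_def)

lemma linear_extension_add: "linear_extension f (x + y) = linear_extension f x + linear_extension f y"
  using words_add[of x y]
  by (simp add: linear_extension_superset[of "words x \<union> words y"] sum.distrib algebra_simps)

lemma linear_extension_scaleC: "linear_extension f (c *\<^sub>C x) = c * linear_extension f x"
proof -
  have "words (c *\<^sub>C x) \<subseteq> words x" by (auto simp: words_def)
  from linear_extension_superset[OF _ this] show ?thesis by (simp add: linear_extension_def sum_distrib_left mult.assoc)
qed

lemma linear_extension_free_word [simp]: "linear_extension f (free_word w) = f w"
  by (simp add: linear_extension_def words_free_word)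

lemma linear_extension_part: "linear_extension f (part P x) = linear_extension (\<lambda>w. if P w then f w else 0) x"
proof -
  have "words (part P x) \<subseteq> words x" by auto
  from linear_extension_superset[OF _ this] show ?thesis by (auto simp: linear_extension_def intro!: sum.cong)
qed

lemma linear_extension_cong: "(\<And>w. w \<in> words x \<Longrightarrow> f w = g w) \<Longrightarrow> linear_extension f x = linear_extension g x"
  by (simp add: linear_extension_def)

section \<open>Polynomial growth of commuting degrees\<close>

text \<open>A product of \<open>n\<close> words from \<open>S\<close> has a degree that depends only on how often each word occurs.\<close>

lemma card_degrees_le:
  assumes fin: "finite S" and D: "\<And>ws. set ws \<subseteq> S \<Longrightarrow> deg (sum_list ws) = D (mset ws)"
  shows "finite (deg ` {sum_list ws |ws. length ws = n \<and> set ws \<subseteq> S})"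
    and "card (deg ` {sum_list ws |ws. length ws = n \<and> set ws \<subseteq> S}) \<le> (n + 1) ^ card S"
proof -
  let ?F = "S \<rightarrow>\<^sub>E {..n}"
  let ?m = "\<lambda>f. \<Sum>a\<in>S. replicate_mset (f a) a"
  have "deg ` {sum_list ws |ws. length ws = n \<and> set ws \<subseteq> S} \<subseteq> (\<lambda>f. D (?m f)) ` ?F"
  proof clarify
    fix ws assume ws: "set ws \<subseteq> S" "n = length ws"
    define f where "f = restrict (count (mset ws)) S"
    have "?m f = mset ws"
    proof (rule multiset_eqI)
      fix b
      have "count (?m f) b = (\<Sum>a\<in>S. if a = b then f a else 0)"
        by (simp add: count_sum) (intro sum.cong, auto)
      also have "\<dots> = count (mset ws) b"
        using fin ws by (auto simp: f_def count_mset_0_iff)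
      finally show "count (?m f) b = count (mset ws) b" .
    qed
    moreover have "f \<in> ?F"
      using count_le_length[of ws] ws by (auto simp: f_def count_mset)
    ultimately show "deg (sum_list ws) \<in> (\<lambda>f. D (?m f)) ` (S \<rightarrow>\<^sub>E {..length ws})"
      using D[OF ws(1)] ws(2) by (intro image_eqI[of _ _ f]) auto
  qed
  moreover have F: "finite ?F" using fin by (intro finite_PiE) auto
  ultimately show "finite (deg ` {sum_list ws |ws. length ws = n \<and> set ws \<subseteq> S})"
    by (meson finite_imageI finite_subset)
  have "card (deg ` {sum_list ws |ws. length ws = n \<and> set ws \<subseteq> S}) \<le> card ?F"
    by (rule surj_card_le) fact+
  then show "card (deg ` {sum_list ws |ws. length ws = n \<and> set ws \<subseteq> S}) \<le> (n + 1) ^ card S"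
    using fin by (simp add: card_PiE)
qed

text \<open>The substitute for amenability. The power \<open>x\<^sup>n\<close> is the sum of its homogeneous components, of
  which there are at most \<open>(n + 1)\<^sup>k\<close> with \<open>k = card (words x)\<close>, so \<open>\<parallel>h x\<parallel>\<^sup>n = \<parallel>h (x\<^sup>n)\<parallel> \<le> (n + 1)\<^sup>k C\<^sup>n\<close>
  for all \<open>n\<close> that are powers of 2.\<close>

lemma norm_le_if_parts_of_powers_le:
  fixes h :: "'g free_star_algebra \<Rightarrow> 'a::pre_cstar_algebra"
  assumes h: "star_hom h" and x: "star (h x) = h x"
    and D: "\<And>ws. set ws \<subseteq> words x \<Longrightarrow> deg (sum_list ws) = D (mset ws)"
    and C: "0 \<le> C" and le: "\<And>n k. norm (h (part (\<lambda>w. deg w = k) (x ^ n))) \<le> C ^ n"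
  shows "norm (h x) \<le> C"
proof (rule le_if_powers_le_polynomial[OF C, where C = 1 and k = "card (words x)"])
  fix j
  define n :: nat where "n = 2 ^ j"
  let ?T = "deg ` {sum_list ws |ws. length ws = n \<and> set ws \<subseteq> words x}"
  have pow: "h (x ^ m) = h x ^ m" for m
    by (induction m) (simp_all add: star_homD[OF h])
  have sub: "deg ` words (x ^ n) \<subseteq> ?T" using words_power[of x n] by blast
  have "card (deg ` words (x ^ n)) \<le> card ?T"
    by (rule card_mono[OF card_degrees_le(1)[where D = D] sub]) (simp_all add: D)
  also have "\<dots> \<le> (n + 1) ^ card (words x)"
    by (rule card_degrees_le(2)[where D = D]) (simp_all add: D)
  finally have "real (card (deg ` words (x ^ n))) \<le> real ((n + 1) ^ card (words x))"
    by (rule of_nat_mono)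
  then have card_le: "real (card (deg ` words (x ^ n))) \<le> real (n + 1) ^ card (words x)"
    by (simp only: of_nat_power)
  have "norm (h x) ^ n = norm (h (x ^ n))"
    unfolding pow n_def by (rule norm_selfadjoint_power[OF x, symmetric])
  also have "h (x ^ n) = (\<Sum>k\<in>deg ` words (x ^ n). h (part (\<lambda>w. deg w = k) (x ^ n)))"
    using arg_cong[OF sum_parts[of "x ^ n" deg], of h] by (simp only: star_hom_sum[OF h])
  also have "norm \<dots> \<le> (\<Sum>k\<in>deg ` words (x ^ n). C ^ n)"
    by (intro sum_norm_le le)
  also have "\<dots> = real (card (deg ` words (x ^ n))) * C ^ n" by simp
  also have "\<dots> \<le> real (n + 1) ^ card (words x) * C ^ n"
    using C card_le by (intro mult_right_mono) auto
  finally show "norm (h x) ^ 2 ^ j \<le> 1 * real (2 ^ j + 1) ^ card (words x) * C ^ 2 ^ j"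
    by (simp add: n_def)
qed

section \<open>Degrees in the affine group and partial action on the ring\<close>

type_synonym 'r CL_word = "('r nonzero + 'r) star_word"

text \<open>The word \<open>w\<close> composes to the affine map \<open>r \<mapsto> scale w * r + shift w\<close> of the field of fractions, the
  rightmost letter acting first.\<close>

fun gen_scale :: "'r::idom nonzero + 'r \<Rightarrow> 'r fract" where
  "gen_scale (Inl m) = to_fract (elem m)"
| "gen_scale (Inr n) = 1"

fun gen_shift :: "'r::idom nonzero + 'r \<Rightarrow> 'r fract" where
  "gen_shift (Inl m) = 0"
| "gen_shift (Inr n) = to_fract n"

fun letter_scale :: "('r::idom nonzero + 'r) letter \<Rightarrow> 'r fract" where
  "letter_scale (Gen g) = gen_scale g"
| "letter_scale (Adj g) = inverse (gen_scale g)"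

fun letter_shift :: "('r::idom nonzero + 'r) letter \<Rightarrow> 'r fract" where
  "letter_shift (Gen g) = gen_shift g"
| "letter_shift (Adj g) = - gen_shift g / gen_scale g"

fun scale :: "'r::idom CL_word \<Rightarrow> 'r fract" where
  "scale (Word l) = prod_list (map letter_scale l)"

fun shift :: "'r::idom CL_word \<Rightarrow> 'r fract" where
  "shift (Word []) = 0"
| "shift (Word (a # l)) = letter_scale a * shift (Word l) + letter_shift a"

text \<open>The action of words on the ring is a relation rather than a partial function, so that an adjoint letter
  acts by the converse relation.\<close>

fun gen_sends :: "'r::idom nonzero + 'r \<Rightarrow> 'r \<Rightarrow> 'r \<Rightarrow> bool" where
  "gen_sends (Inl m) r r' \<longleftrightarrow> r' = elem m * r"
| "gen_sends (Inr n) r r' \<longleftrightarrow> r' = n + r"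

fun letter_sends :: "('r::idom nonzero + 'r) letter \<Rightarrow> 'r \<Rightarrow> 'r \<Rightarrow> bool" where
  "letter_sends (Gen g) r r' \<longleftrightarrow> gen_sends g r r'"
| "letter_sends (Adj g) r r' \<longleftrightarrow> gen_sends g r' r"

fun sends :: "'r::idom CL_word \<Rightarrow> 'r \<Rightarrow> 'r \<Rightarrow> bool" where
  "sends (Word []) r r' \<longleftrightarrow> r = r'"
| "sends (Word (a # l)) r r' \<longleftrightarrow> (\<exists>q. sends (Word l) r q \<and> letter_sends a q r')"

lemma elem_nonzero [simp]: "elem m \<noteq> 0"
  using elem by blast

lemma elem_Nonzero [simp]: "m \<noteq> 0 \<Longrightarrow> elem (Nonzero m) = m"
  by (simp add: Nonzero_inverse)

lemma letter_scale_nonzero: "letter_scale a \<noteq> 0"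
proof -
  have "gen_scale g \<noteq> 0" for g :: "'a nonzero + 'a" by (cases g) auto
  then show ?thesis by (cases a) auto
qed

lemma scale_nonzero [simp]: "scale w \<noteq> 0"
  by (cases w) (auto simp: prod_list_zero_iff letter_scale_nonzero)

lemma scale_zero [simp]: "scale 0 = 1" and shift_zero [simp]: "shift 0 = 0"
  by (simp_all add: zero_star_word_def)

lemma scale_plus [simp]: "scale (v + w) = scale v * scale w"
  by (cases v; cases w) simp

lemma shift_plus: "shift (v + w) = scale v * shift w + shift v"
proof (cases v; cases w)
  fix k l assume "v = Word k" "w = Word l"
  moreover have "shift (Word (k @ l)) = scale (Word k) * shift (Word l) + shift (Word k)"
    by (induction k) (simp_all add: algebra_simps)
  ultimately show ?thesis by simp
qed

lemma letter_scale_adj: "letter_scale (letter_adj a) = inverse (letter_scale a)"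
  by (cases a) auto

lemma letter_shift_adj: "letter_shift (letter_adj a) = - letter_shift a / letter_scale a"
  using letter_scale_nonzero[of a] by (cases a) auto

lemma scale_adj [simp]: "scale (word_adj w) = inverse (scale w)"
proof (cases w)
  case (Word l)
  have "prod_list (map letter_scale (rev (map letter_adj l))) = inverse (prod_list (map letter_scale l))"
    by (induction l) (simp_all add: letter_scale_adj)
  then show ?thesis using Word by simp
qed

lemma shift_adj: "shift (word_adj w) = - shift w / scale w"
proof (cases w)
  case (Word l)
  have "shift (word_adj (Word l)) = - shift (Word l) / scale (Word l)"
  proof (induction l)
    case (Cons a l)
    have "word_adj (Word (a # l)) = word_adj (Word l) + Word [letter_adj a]" by simp
    then show ?case
      using letter_scale_nonzero[of a] scale_nonzero[of "Word l"] Cons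
      by (simp add: shift_plus letter_shift_adj field_simps del: word_adj.simps scale.simps)
         (simp add: algebra_simps)
  qed simp
  then show ?thesis using Word by simp
qed

lemma sends_plus: "sends (v + w) r r' \<longleftrightarrow> (\<exists>q. sends w r q \<and> sends v q r')"
proof (cases v; cases w)
  fix k l assume "v = Word k" "w = Word l"
  moreover have "sends (Word (k @ l)) r r' \<longleftrightarrow> (\<exists>q. sends (Word l) r q \<and> sends (Word k) q r')" for r'
    by (induction k arbitrary: r') auto
  ultimately show ?thesis by simp
qed

lemma sends_zero_word [simp]: "sends 0 r r' \<longleftrightarrow> r = r'"
  by (simp add: zero_star_word_def)

lemma sends_adj: "sends (word_adj w) r r' \<longleftrightarrow> sends w r' r"
proof (cases w)
  case (Word l)
  have "sends (word_adj (Word l)) r r' \<longleftrightarrow> sends (Word l) r' r" for r'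
  proof (induction l arbitrary: r r')
    case (Cons a l)
    have "word_adj (Word (a # l)) = word_adj (Word l) + Word [letter_adj a]" by simp
    moreover have "letter_sends (letter_adj a) q q' \<longleftrightarrow> letter_sends a q' q" for q q' by (cases a) auto
    ultimately show ?case using Cons by (auto simp: sends_plus simp del: word_adj.simps)
  qed auto
  then show ?thesis using Word by simp
qed

lemma sends_affine: "sends w r r' \<Longrightarrow> to_fract r' = scale w * to_fract r + shift w"
proof (cases w)
  case (Word l)
  have gen: "to_fract q' = gen_scale g * to_fract q + gen_shift g" "gen_scale g \<noteq> 0"
    if "gen_sends g q q'" for g and q q' :: 'a
    using that by (cases g; simp)+
  have letter: "to_fract q' = letter_scale a * to_fract q + letter_shift a"
    if "letter_sends a q q'" for a and q q' :: 'a
    using that gen by (cases a) (auto simp: field_simps)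
  have "sends (Word l) r r' \<Longrightarrow> to_fract r' = scale (Word l) * to_fract r + shift (Word l)"
    by (induction l arbitrary: r') (auto dest!: letter simp: algebra_simps)
  then show "sends w r r' \<Longrightarrow> ?thesis" using Word by simp
qed

lemma sends_zero: "sends w 0 r \<Longrightarrow> to_fract r = shift w"
  using sends_affine[of w 0 r] by simp

section \<open>A positive functional\<close>

text \<open>This is the vector state of the unit vector \<open>\<delta>(0, 1)\<close> in the representation on \<open>\<ell>\<^sup>2(R \<times> K\<^sup>\<times>)\<close> in which \<open>u\<^sup>n\<close>
  maps \<open>\<delta>(r, k)\<close> to \<open>\<delta>(n + r, k)\<close> and \<open>s\<^sub>m\<close> maps it to \<open>\<delta>(m r, m k)\<close>. The second coordinate records the
  scale. A word of scale 1 that fixes 0 also has shift 0, so \<open>vac\<close> is supported on the words of trivial degree.\<close>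

definition vac :: "'r::idom CL_free \<Rightarrow> complex" where
  "vac = linear_extension (\<lambda>w. of_bool (scale w = 1 \<and> sends w 0 0))"

lemma vac_add: "vac (x + y) = vac x + vac y"
  and vac_scaleC: "vac (c *\<^sub>C x) = c * vac x"
  and vac_free_word: "vac (free_word w) = of_bool (scale w = 1 \<and> sends w 0 0)"
  by (simp_all add: vac_def linear_extension_add linear_extension_scaleC)

lemma vac_sum: "vac (\<Sum>i\<in>A. f i) = (\<Sum>i\<in>A. vac (f i))"
  using vac_scaleC[of 0 0] by (induction A rule: infinite_finite_induct) (auto simp: vac_add)

lemma vac_expansion: "vac x = (\<Sum>w\<in>words x. coef x w * vac (free_word w))"
  unfolding vac_free_word by (simp add: vac_def linear_extension_def)

text \<open>The coordinates of the vector that \<open>x\<close> produces from the vacuum vector. A word \<open>w\<close> defined at 0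
  moves the vacuum vector to the point with first coordinate \<open>shift w\<close> and second coordinate \<open>scale w\<close>,
  so coordinates are indexed by degrees, and they vanish outside a finite set given by the
  words of \<open>x\<close>.\<close>

definition vec :: "'r::idom CL_free \<Rightarrow> 'r fract \<times> 'r fract \<Rightarrow> complex" where
  "vec x j = linear_extension (\<lambda>w. of_bool ((\<exists>r. sends w 0 r) \<and> (scale w, shift w) = j)) x"

abbreviation degrees :: "'r::idom CL_free \<Rightarrow> ('r fract \<times> 'r fract) set" where
  "degrees x \<equiv> (\<lambda>w. (scale w, shift w)) ` words x"

lemma vec_eq_0: "j \<notin> degrees x \<Longrightarrow> vec x j = 0"
  by (auto simp: vec_def linear_extension_def intro!: sum.neutral)

text \<open>On words: \<open>v\<^sup>* w\<close> has scale 1 and fixes 0 iff \<open>v\<close> and \<open>w\<close> are both defined at 0 and have equal degree,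
  since they then agree at 0 as well.\<close>

lemma vac_star_mult:
  assumes "finite J" "degrees x \<subseteq> J"
  shows "vac (star x * y) = (\<Sum>j\<in>J. cnj (vec x j) * vec y j)"
proof -
  let ?g = "\<lambda>w j. of_bool ((\<exists>r. sends w 0 r) \<and> (scale w, shift w) = j) :: complex"
  have word: "vac (free_word (word_adj v + w)) = (\<Sum>j\<in>J. ?g v j * ?g w j)" if v: "v \<in> words x" for v w
  proof -
    have vJ: "(scale v, shift v) \<in> J" using v assms by auto
    have "(\<Sum>j\<in>J. ?g v j * ?g w j) = (\<Sum>j\<in>J. if j = (scale v, shift v) then ?g v j * ?g w j else 0)"
      by (intro sum.cong) auto
    also have "\<dots> = ?g v (scale v, shift v) * ?g w (scale v, shift v)" using assms vJ by simp
    also have "\<dots> = vac (free_word (word_adj v + w))"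
    proof -
      have "(\<exists>r. sends v 0 r) \<and> (\<exists>r. sends w 0 r) \<and> scale w = scale v \<and> shift w = shift v \<longleftrightarrow>
          inverse (scale v) * scale w = 1 \<and> (\<exists>r. sends w 0 r \<and> sends v 0 r)"
      proof (intro iffI conjI; elim conjE exE)
        fix r r' assume r: "sends v 0 r" "sends w 0 r'" "scale w = scale v" "shift w = shift v"
        then have "to_fract r = to_fract r'" by (simp add: sends_zero)
        then show "\<exists>r. sends w 0 r \<and> sends v 0 r" using r by auto
      next
        fix r assume r: "sends w 0 r" "sends v 0 r"
        then show "shift w = shift v" using sends_zero[OF r(1)] sends_zero[OF r(2)] by simp
      qed (auto simp: field_simps)
      then show ?thesis by (auto simp: vac_free_word sends_plus sends_adj)
    qed
    finally show ?thesis by simp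
  qed
  have starx: "star x = (\<Sum>v\<in>words x. cnj (coef x v) *\<^sub>C free_word (word_adj v))"
  proof -
    have "star (\<Sum>v\<in>A. coef x v *\<^sub>C free_word v) = (\<Sum>v\<in>A. cnj (coef x v) *\<^sub>C free_word (word_adj v))" for A
      by (induction A rule: infinite_finite_induct) (simp_all add: star_add star_scaleC star_free_word)
    then show ?thesis by (metis words_expansion)
  qed
  have "vac (star x * y) = vac ((\<Sum>v\<in>words x. cnj (coef x v) *\<^sub>C free_word (word_adj v)) *
      (\<Sum>w\<in>words y. coef y w *\<^sub>C free_word w))"
    by (simp flip: starx words_expansion)
  also have "\<dots> = (\<Sum>v\<in>words x. \<Sum>w\<in>words y. cnj (coef x v) * (coef y w * vac (free_word (word_adj v + w))))"
    by (simp add: sum_product vac_sum vac_scaleC mult_scaleC_left mult_scaleC_right free_word_plus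
        mult.left_commute)
  also have "\<dots> = (\<Sum>v\<in>words x. \<Sum>w\<in>words y. \<Sum>j\<in>J. (cnj (coef x v) * ?g v j) * (coef y w * ?g w j))"
    by (intro sum.cong refl) (simp add: word sum_distrib_left mult_ac)
  also have "\<dots> = (\<Sum>j\<in>J. \<Sum>v\<in>words x. \<Sum>w\<in>words y. (cnj (coef x v) * ?g v j) * (coef y w * ?g w j))"
    by (simp only: sum.swap[of _ J])
  also have "\<dots> = (\<Sum>j\<in>J. (\<Sum>v\<in>words x. cnj (coef x v) * ?g v j) * (\<Sum>w\<in>words y. coef y w * ?g w j))"
    by (simp only: sum_product)
  also have "\<dots> = (\<Sum>j\<in>J. cnj (vec x j) * vec y j)"
    by (intro sum.cong refl) (simp add: vec_def linear_extension_def)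
  finally show ?thesis .
qed

definition sqnorm :: "'r::idom CL_free \<Rightarrow> real" where
  "sqnorm x = (\<Sum>j\<in>degrees x. (cmod (vec x j))\<^sup>2)"

lemma sqnorm_superset:
  assumes "finite J" "degrees x \<subseteq> J"
  shows "sqnorm x = (\<Sum>j\<in>J. (cmod (vec x j))\<^sup>2)"
  unfolding sqnorm_def using assms by (intro sum.mono_neutral_left) (auto simp: vec_eq_0)

lemma sqnorm_nonneg: "0 \<le> sqnorm x"
  by (simp add: sqnorm_def sum_nonneg)

lemma vac_star_self: "vac (star x * x) = of_real (sqnorm x)"
  by (simp add: vac_star_mult[of "degrees x"] sqnorm_def complex_norm_square mult.commute del: of_real_power)

lemma vac_Cauchy_Schwarz: "cmod (vac (star x * y)) \<le> sqrt (sqnorm x) * sqrt (sqnorm y)"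
proof -
  let ?J = "degrees x \<union> degrees y"
  have "cmod (vac (star x * y)) = cmod (\<Sum>j\<in>?J. cnj (vec x j) * vec y j)"
    by (subst vac_star_mult[of ?J]) auto
  also have "\<dots> \<le> (\<Sum>j\<in>?J. \<bar>cmod (vec x j)\<bar> * \<bar>cmod (vec y j)\<bar>)"
    by (rule order_trans[OF norm_sum]) (simp add: norm_mult)
  also have "\<dots> \<le> L2_set (\<lambda>j. cmod (vec x j)) ?J * L2_set (\<lambda>j. cmod (vec y j)) ?J"
    by (rule L2_set_mult_ineq)
  also have "\<dots> = sqrt (sqnorm x) * sqrt (sqnorm y)"
    by (simp add: L2_set_def sqnorm_superset[of ?J])
  finally show ?thesis .
qed

lemma sqnorm_parts:
  assumes K: "finite K" "scale ` words x \<subseteq> K"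
  shows "sqnorm x = (\<Sum>k\<in>K. sqnorm (part (\<lambda>w. scale w = k) x))"
proof -
  have vec: "vec (part (\<lambda>w. scale w = k) x) j = (if fst j = k then vec x j else 0)" for k j
    by (auto simp: vec_def linear_extension_part linear_extension_def intro!: sum.cong sum.neutral)
  have "(\<Sum>k\<in>K. sqnorm (part (\<lambda>w. scale w = k) x)) =
      (\<Sum>k\<in>K. \<Sum>j\<in>degrees x. (cmod (if fst j = k then vec x j else 0))\<^sup>2)"
    by (intro sum.cong refl, subst sqnorm_superset[of "degrees x"]) (auto simp: vec)
  also have "\<dots> = (\<Sum>j\<in>degrees x. \<Sum>k\<in>K. if k = fst j then (cmod (vec x j))\<^sup>2 else 0)"
    by (subst sum.swap) (intro sum.cong refl, auto)
  also have "\<dots> = sqnorm x"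
    unfolding sqnorm_def using K by (intro sum.cong refl) auto
  finally show ?thesis by simp
qed

lemma sqnorm_part_le: "sqnorm (part (\<lambda>w. scale w = k) x) \<le> sqnorm x"
proof -
  have "sqnorm (part (\<lambda>w. scale w = k) x) \<le>
      (\<Sum>k\<in>insert k (scale ` words x). sqnorm (part (\<lambda>w. scale w = k) x))"
    by (rule member_le_sum[where f = "\<lambda>k. sqnorm (part (\<lambda>w. scale w = k) x)"]) (auto simp: sqnorm_nonneg)
  also have "\<dots> = sqnorm x" by (rule sqnorm_parts[symmetric]) auto
  finally show ?thesis .
qed

section \<open>Bounds in the representation of the functional\<close>

text \<open>In the representation belonging to \<open>vac\<close>, \<open>y\<close> acts with operator norm at most \<open>C\<close>.\<close>

definition bounded_by :: "'r::idom CL_free \<Rightarrow> real \<Rightarrow> bool" where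
  "bounded_by y C \<longleftrightarrow> 0 \<le> C \<and> (\<forall>b. sqnorm (y * b) \<le> C\<^sup>2 * sqnorm b)"

lemma bounded_byD: "bounded_by y C \<Longrightarrow> sqnorm (y * b) \<le> C\<^sup>2 * sqnorm b"
  by (simp add: bounded_by_def)

lemma bounded_by_mult:
  assumes x: "bounded_by x C" and y: "bounded_by y D"
  shows "bounded_by (x * y) (C * D)"
proof -
  have "sqnorm (x * y * b) \<le> (C * D)\<^sup>2 * sqnorm b" for b
  proof -
    have "sqnorm (x * (y * b)) \<le> C\<^sup>2 * (D\<^sup>2 * sqnorm b)"
      using bounded_byD[OF x, of "y * b"] mult_left_mono[OF bounded_byD[OF y, of b], of "C\<^sup>2"] by simp
    then show ?thesis by (simp add: mult.assoc power_mult_distrib)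
  qed
  then show ?thesis using x y by (simp add: bounded_by_def)
qed

lemma bounded_by_power: "bounded_by x C \<Longrightarrow> bounded_by (x ^ n) (C ^ n)"
proof (induction n)
  case 0
  then show ?case by (simp add: bounded_by_def)
next
  case (Suc n)
  then show ?case by (simp add: bounded_by_mult)
qed

text \<open>The representation space is graded by the scale, and passing to the part of scale 1 keeps the diagonal
  blocks of the operator.\<close>

lemma bounded_by_scale_part:
  assumes y: "bounded_by y C"
  shows "bounded_by (part (\<lambda>w. scale w = 1) y) C"
proof -
  let ?p = "\<lambda>k. part (\<lambda>w. scale w = k)"
  have "sqnorm (?p 1 y * b) \<le> C\<^sup>2 * sqnorm b" for b
  proof -
    have b: "?p k (?p 1 y * b) = ?p 1 y * ?p k b" for k
      by (rule part_mult_left) auto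
    have 1: "?p k (y * ?p k b) = ?p 1 y * ?p k b" for k
      by (rule part_mult_right) auto
    define K where "K = scale ` (words b \<union> words (?p 1 y * b))"
    have K: "finite K" "scale ` words b \<subseteq> K" "scale ` words (?p 1 y * b) \<subseteq> K"
      by (auto simp: K_def)
    have "sqnorm (?p 1 y * b) = (\<Sum>k\<in>K. sqnorm (?p k (y * ?p k b)))"
      using sqnorm_parts[OF K(1,3)] by (simp add: b 1)
    also have "\<dots> \<le> (\<Sum>k\<in>K. C\<^sup>2 * sqnorm (?p k b))"
      by (intro sum_mono order_trans[OF sqnorm_part_le] bounded_byD[OF y])
    also have "\<dots> = C\<^sup>2 * sqnorm b"
      using sqnorm_parts[OF K(1,2)] by (simp add: sum_distrib_left)
    finally show ?thesis .
  qed
  then show ?thesis using y by (simp add: bounded_by_def)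
qed

text \<open>An algebra seminorm that dominates a positive functional controls the operator norm in its
  representation. With \<open>x = y\<^sup>* y\<close> and \<open>t = \<parallel>y b\<parallel>\<^sup>2 / \<parallel>b\<parallel>\<^sup>2\<close>, iterating the Cauchy-Schwarz inequality gives
  \<open>t\<^sup>n \<parallel>b\<parallel>\<^sup>2 \<le> \<bar>vac (b\<^sup>* x\<^sup>n b)\<bar>\<close> for \<open>n = 2\<^sup>j\<close>, which is at most a constant times \<open>d(x)\<^sup>n\<close>.\<close>

lemma sqnorm_dominated:
  assumes N: "\<And>x. 0 \<le> d x" "\<And>x y. d (x * y) \<le> d x * d y"
    and vac: "\<And>x. cmod (vac x) \<le> d x"
  shows "sqnorm (y * b) \<le> d (star y * y) * sqnorm b"
proof (cases "sqnorm b = 0")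
  case True
  have "sqnorm (y * b) = cmod (vac (star b * (star y * (y * b))))"
    using vac_star_self[of "y * b"] by (simp add: sqnorm_nonneg star_mult mult.assoc)
  also have "\<dots> \<le> sqrt (sqnorm b) * sqrt (sqnorm (star y * (y * b)))" by (rule vac_Cauchy_Schwarz)
  finally show ?thesis using True by simp
next
  case False
  then have b: "sqnorm b > 0" using sqnorm_nonneg[of b] by simp
  define x where "x = star y * y"
  have sx: "star (x ^ n) = x ^ n" for n
    by (induction n) (simp_all add: x_def star_mult star_star power_commutes)
  define t where "t = sqnorm (y * b) / sqnorm b"
  have yb: "vac (star b * (x * b)) = of_real (sqnorm (y * b))"
    using vac_star_self[of "y * b"] by (simp add: x_def star_mult mult.assoc)
  have iter: "t ^ 2 ^ j * sqnorm b \<le> cmod (vac (star b * (x ^ 2 ^ j * b)))" for j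
  proof (induction j)
    case 0
    show ?case using b by (simp add: yb t_def sqnorm_nonneg)
  next
    case (Suc j)
    let ?v = "cmod (vac (star b * (x ^ 2 ^ j * b)))"
    have sq: "vac (star b * (x ^ 2 ^ Suc j * b)) = of_real (sqnorm (x ^ 2 ^ j * b))"
      using vac_star_self[of "x ^ 2 ^ j * b"]
      by (simp add: star_mult sx mult.assoc mult_2 power_add)
    have "?v \<le> sqrt (sqnorm b) * sqrt (sqnorm (x ^ 2 ^ j * b))" by (rule vac_Cauchy_Schwarz)
    then have "?v\<^sup>2 \<le> sqnorm b * sqnorm (x ^ 2 ^ j * b)"
      using power_mono[of ?v _ 2] by (fastforce simp: power_mult_distrib sqnorm_nonneg)
    moreover have "(t ^ 2 ^ j * sqnorm b)\<^sup>2 \<le> ?v\<^sup>2"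
      using Suc b sqnorm_nonneg[of "y * b"] by (intro power_mono) (auto simp: t_def)
    ultimately have "(t ^ 2 ^ j)\<^sup>2 * sqnorm b * sqnorm b \<le> sqnorm (x ^ 2 ^ j * b) * sqnorm b"
      by (simp add: power_mult_distrib power2_eq_square mult_ac)
    then have "(t ^ 2 ^ j)\<^sup>2 * sqnorm b \<le> sqnorm (x ^ 2 ^ j * b)" using b by simp
    moreover have "cmod (vac (star b * (x ^ 2 ^ Suc j * b))) = sqnorm (x ^ 2 ^ j * b)"
      unfolding sq by (simp add: sqnorm_nonneg)
    moreover have "(t ^ 2 ^ j)\<^sup>2 = t ^ 2 ^ Suc j" by (simp add: mult.commute flip: power_mult)
    ultimately show ?case by simp
  qed
  have "t \<le> d x"
  proof (rule le_if_powers_le_polynomial[where k = 0 and C = "d (star b) * d b / sqnorm b"])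
    fix j
    have pow: "d (x ^ n) \<le> d x ^ n" if "n \<ge> 1" for n
      using that
    proof (induction n rule: dec_induct)
      case (step n)
      then show ?case using N(2)[of x "x ^ n"] N(1) mult_left_mono[of "d (x ^ n)" "d x ^ n" "d x"]
        by (simp add: order_trans)
    qed simp
    have "t ^ 2 ^ j * sqnorm b \<le> d (star b * (x ^ 2 ^ j * b))"
      using iter[of j] vac order_trans by blast
    also have "\<dots> \<le> d (star b) * (d (x ^ 2 ^ j) * d b)"
      using N order_trans mult_left_mono by meson
    also have "\<dots> \<le> d (star b) * (d x ^ 2 ^ j * d b)"
      by (intro mult_left_mono mult_right_mono pow N(1)) simp
    finally have "t ^ 2 ^ j \<le> d (star b) * (d x ^ 2 ^ j * d b) / sqnorm b"
      using b by (simp add: pos_le_divide_eq)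
    then show "t ^ 2 ^ j \<le> d (star b) * d b / sqnorm b * real (2 ^ j + 1) ^ 0 * d x ^ 2 ^ j"
      by (simp add: mult_ac)
  qed (rule N(1))
  then show ?thesis using b by (simp add: t_def x_def pos_divide_le_eq)
qed

section \<open>Representations of the relations\<close>

lemma finite_Collect_if_unique:
  assumes "\<And>x y. P x \<Longrightarrow> P y \<Longrightarrow> x = y"
  shows "finite {x. P x}"
proof (cases "\<exists>x. P x")
  case True
  then obtain x where "P x" by blast
  then have "{x. P x} = {x}" using assms by blast
  then show ?thesis by simp
qed simp

text \<open>The argument is carried out in an arbitrary nonzero C*-algebra with elements satisfying the relations;
  that these elements generate it enters as the density assumption of \<open>ideal_zero\<close>.\<close>

locale CL_representation =
  fixes s :: "'r::idom nonzero \<Rightarrow> 'a::cstar_algebra" and u :: "'r \<Rightarrow> 'a"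
  assumes CL: "satisfies_CL s u"
    and one_nonzero: "(1::'a) \<noteq> 0"
    and not_field: "\<exists>z :: 'r. z \<noteq> 0 \<and> \<not> z dvd 1"
    and finite_quotient: "\<And>m :: 'r. m \<noteq> 0 \<Longrightarrow> finite (UNIV // ideal_cong m)"
begin

definition S :: "'r \<Rightarrow> 'a" where "S m = s (Nonzero m)"

definition h :: "'r CL_free \<Rightarrow> 'a" where "h = free_eval (case_sum s u)"

lemma star_hom_h: "star_hom h"
  by (simp add: h_def star_hom_free_eval)

lemmas h_simps = star_homD[OF star_hom_h]

lemma h_gen [simp]: "h (free_gen (Inl m)) = s m" "h (free_gen (Inr n)) = u n"
  by (simp_all add: h_def)

lemma h_letter:
  "h (free_word (Word [Gen g])) = h (free_gen g)"
  "h (free_word (Word [Adj g])) = star (h (free_gen g))"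
  by (simp_all add: free_gen_def star_free_gen flip: h_simps(4))
    (simp add: star_free_word)

lemma s_eq_S: "s m = S (elem m)"
  by (simp add: S_def elem_inverse)

lemma S_isometry: "star (S m) * S m = 1"
  by (simp add: S_def satisfies_CLD[OF CL])

lemma S_isometry_left: "star (S m) * (S m * x) = x"
  using S_isometry[of m] by (simp flip: mult.assoc)

lemma S_mult: "m \<noteq> 0 \<Longrightarrow> n \<noteq> 0 \<Longrightarrow> S m * S n = S (m * n)"
proof -
  assume mn: "m \<noteq> 0" "n \<noteq> 0"
  then have "Nonzero m * Nonzero n = Nonzero (m * n)"
    by (intro elem_inject[THEN iffD1]) (simp add: times_nonzero.rep_eq)
  then show ?thesis by (simp add: S_def satisfies_CLD(4)[OF CL])
qed

lemma u_add: "u m * u n = u (m + n)"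
  by (rule satisfies_CLD(5)[OF CL])

lemma u_zero [simp]: "u 0 = 1"
  using u_add[of 0 0] satisfies_CLD(2)[OF CL, of 0] by (metis add_0 mult.assoc mult_1_left)

lemma star_u: "star (u n) = u (- n)"
proof -
  have "star (u n) * (u n * u (- n)) = u (- n)"
    using satisfies_CLD(2)[OF CL, of n] by (simp flip: mult.assoc)
  then show ?thesis by (simp add: u_add)
qed

lemma S_u: "m \<noteq> 0 \<Longrightarrow> S m * u n = u (m * n) * S m"
  using satisfies_CLD(6)[OF CL, of "Nonzero m" n] by (simp add: S_def)

section \<open>Range projections of the isometries\<close>

text \<open>The range projections of the isometries \<open>u\<^sup>l s\<^sub>m\<close>, which are the summands of the last relation.\<close>

definition range_proj :: "'r \<Rightarrow> 'r \<Rightarrow> 'a" where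
  "range_proj m l = u l * S m * star (S m) * u (- l)"

definition coset_rep :: "'r set \<Rightarrow> 'r" where
  "coset_rep X = (SOME l. l \<in> X)"

lemma projection_range_proj: "projection (range_proj m l)"
proof -
  have *: "u (- l) * (u l * x) = x" for x by (simp add: u_add flip: mult.assoc)
  show ?thesis
    by (simp add: projection_def range_proj_def star_mult star_star star_u mult.assoc * S_isometry_left)
qed

lemma sum_range_proj:
  assumes "m \<noteq> 0"
  shows "(\<Sum>X\<in>UNIV // ideal_cong m. range_proj m (coset_rep X)) = 1"
  using satisfies_CLD(7)[OF CL, of "Nonzero m"] assms
  by (simp add: S_def range_proj_def coset_rep_def Let_def)

lemma range_proj_coset_rep_orthogonal:
  assumes "m \<noteq> 0" "X \<in> UNIV // ideal_cong m" "Y \<in> UNIV // ideal_cong m" "X \<noteq> Y"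
  shows "range_proj m (coset_rep Y) * range_proj m (coset_rep X) = 0"
  by (rule projections_sum_one_orthogonal[OF finite_quotient[OF assms(1)] projection_range_proj
        sum_range_proj[OF assms(1)] assms(2-4)])

lemma range_proj_coset_rep:
  assumes "m \<noteq> 0"
  shows "range_proj m (coset_rep (ideal_cong m `` {l})) = range_proj m l"
proof -
  have "l \<in> ideal_cong m `` {l}" by (simp add: ideal_cong_def)
  then have "coset_rep (ideal_cong m `` {l}) \<in> ideal_cong m `` {l}" unfolding coset_rep_def by (rule someI)
  then have "(l, coset_rep (ideal_cong m `` {l})) \<in> ideal_cong (elem (Nonzero m))"
    using assms by (simp add: ideal_cong_def)
  then show ?thesis
    using CL_summand_independent[OF CL] by (simp add: range_proj_def S_def)
qed

text \<open>The isometries \<open>s\<^sub>m\<close> and \<open>u\<^sup>-\<^sup>l s\<^sub>m\<close> belong to different summands of the last relation, so their ranges are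
  orthogonal.\<close>

lemma S_u_S_not_dvd:
  assumes m: "m \<noteq> 0" and l: "\<not> m dvd l"
  shows "star (S m) * (u l * S m) = 0"
proof -
  let ?c = "\<lambda>l. ideal_cong m `` {l}"
  have "?c 0 \<noteq> ?c (- l)"
  proof
    assume "?c 0 = ?c (- l)"
    moreover have "- l \<in> ?c (- l)" by (simp add: ideal_cong_def)
    ultimately have "- l \<in> ?c 0" by simp
    then show False using l by (simp add: ideal_cong_def)
  qed
  then have "range_proj m (- l) * range_proj m 0 = 0"
    using range_proj_coset_rep_orthogonal[OF m, of "?c 0" "?c (- l)"]
    by (simp add: range_proj_coset_rep[OF m] quotientI)
  then have "star (S m) * u l * (range_proj m (- l) * range_proj m 0) * S m = 0" by simp
  moreover have "u l * (u (- l) * x) = x" for x by (simp add: u_add flip: mult.assoc)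
  ultimately show ?thesis
    by (simp add: range_proj_def mult.assoc S_isometry_left S_isometry)
qed

lemma S_u_S_dvd:
  assumes "m \<noteq> 0"
  shows "star (S m) * (u (m * q) * S m) = u q"
  using S_u[OF assms, of q] by (simp add: S_isometry_left flip: S_u[OF assms])

section \<open>The action of words on the isometries\<close>

text \<open>At the resolution \<open>M\<close>, the word \<open>w\<close> acts in the algebra as it acts on the ring: for all \<open>n\<close>, it maps the
  isometry with parameters \<open>l\<close> and \<open>M n\<close> to the one with parameters \<open>r'\<close> and \<open>M' n\<close> if it sends \<open>l\<close> to \<open>r'\<close>,
  and to 0 if it is undefined at \<open>l\<close>. Moreover, whether \<open>w\<close> is defined at \<open>l\<close> depends only on \<open>l\<close> modulo \<open>M\<close>.\<close>

definition acts_at :: "'r CL_word \<Rightarrow> 'r \<Rightarrow> 'r \<Rightarrow> bool" where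
  "acts_at w M M' \<longleftrightarrow> M \<noteq> 0 \<and> M' \<noteq> 0 \<and> to_fract M' = scale w * to_fract M \<and>
     (\<forall>r r' t. sends w r r' \<longrightarrow> sends w (r + M * t) (r' + M' * t)) \<and>
     (\<forall>n l r'. n \<noteq> 0 \<longrightarrow> sends w l r' \<longrightarrow> h (free_word w) * (u l * S (M * n)) = u r' * S (M' * n)) \<and>
     (\<forall>n l. n \<noteq> 0 \<longrightarrow> (\<nexists>r'. sends w l r') \<longrightarrow> h (free_word w) * (u l * S (M * n)) = 0)"

lemma acts_atD:
  assumes "acts_at w M M'"
  shows "M \<noteq> 0" "M' \<noteq> 0" "to_fract M' = scale w * to_fract M"
    "\<And>r r' t. sends w r r' \<Longrightarrow> sends w (r + M * t) (r' + M' * t)"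
    "\<And>n l r'. n \<noteq> 0 \<Longrightarrow> sends w l r' \<Longrightarrow> h (free_word w) * (u l * S (M * n)) = u r' * S (M' * n)"
    "\<And>n l. n \<noteq> 0 \<Longrightarrow> (\<nexists>r'. sends w l r') \<Longrightarrow> h (free_word w) * (u l * S (M * n)) = 0"
  using assms unfolding acts_at_def by blast+

lemma acts_at_mult:
  assumes "acts_at w M M'" "t \<noteq> 0"
  shows "acts_at w (M * t) (M' * t)"
  unfolding acts_at_def
  using acts_atD[OF assms(1)] assms(2) by (auto simp: mult.assoc)

text \<open>Prepending a letter: if it needs the additional divisibility \<open>k\<close>, the resolution grows from \<open>M\<close> to
  \<open>M k\<close>.\<close>

lemma acts_at_Cons:
  assumes w: "acts_at (Word l) M M'" and k: "k \<noteq> 0" "M'' \<noteq> 0" "to_fract M'' = letter_scale a * to_fract (M' * k)"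
    and shift: "\<And>q q' t. letter_sends a q q' \<Longrightarrow> letter_sends a (q + M' * k * t) (q' + M'' * t)"
    and act: "\<And>n q q'. n \<noteq> 0 \<Longrightarrow> letter_sends a q q' \<Longrightarrow>
        h (free_word (Word [a])) * (u q * S (M' * k * n)) = u q' * S (M'' * n)"
    and act0: "\<And>n q. n \<noteq> 0 \<Longrightarrow> (\<nexists>q'. letter_sends a q q') \<Longrightarrow>
        h (free_word (Word [a])) * (u q * S (M' * k * n)) = 0"
  shows "acts_at (Word (a # l)) (M * k) M''"
proof -
  note D = acts_atD[OF w]
  have h: "h (free_word (Word (a # l))) * x = h (free_word (Word [a])) * (h (free_word (Word l)) * x)" for x
  proof -
    have "free_word (Word (a # l)) = free_word (Word [a]) * free_word (Word l)"
      by (simp flip: free_word_plus)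
    then show ?thesis by (simp add: h_simps mult.assoc)
  qed
  show ?thesis
    unfolding acts_at_def
  proof (intro conjI allI impI)
    show "M * k \<noteq> 0" "M'' \<noteq> 0" using D k by auto
    show "to_fract M'' = scale (Word (a # l)) * to_fract (M * k)" using D(3) k(3) by simp
  next
    fix r r' t assume "sends (Word (a # l)) r r'"
    then obtain q where q: "sends (Word l) r q" "letter_sends a q r'" by auto
    show "sends (Word (a # l)) (r + M * k * t) (r' + M'' * t)"
      using D(4)[OF q(1), of "k * t"] shift[OF q(2), of t] by (auto simp: mult.assoc)
  next
    fix n r r' :: 'r assume n: "n \<noteq> 0" and "sends (Word (a # l)) r r'"
    then obtain q where q: "sends (Word l) r q" "letter_sends a q r'" by auto
    show "h (free_word (Word (a # l))) * (u r * S (M * k * n)) = u r' * S (M'' * n)"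
      using D(5)[OF _ q(1), of "k * n"] act[OF n q(2)] n k by (simp add: h mult.assoc)
  next
    fix n r :: 'r assume n: "n \<noteq> 0" and none: "\<nexists>r'. sends (Word (a # l)) r r'"
    show "h (free_word (Word (a # l))) * (u r * S (M * k * n)) = 0"
    proof (cases "\<exists>q. sends (Word l) r q")
      case True
      then obtain q where q: "sends (Word l) r q" by blast
      then have "\<nexists>q'. letter_sends a q q'" using none by auto
      from act0[OF n this] show ?thesis
        using D(5)[OF _ q, of "k * n"] n k by (simp add: h mult.assoc)
    next
      case False
      then show ?thesis using D(6)[of "k * n" r] n k by (simp add: h mult.assoc)
    qed
  qed
qed

text \<open>The resolution collects the divisors \<open>m\<close> of all letters \<open>s\<^sub>m\<^sup>*\<close>. Such a letter annihilates
  \<open>u\<^sup>q s\<^sub>m\<close> when \<open>m\<close> does not divide \<open>q\<close>, by orthogonality of the ranges.\<close>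

lemma ex_acts_at: "\<exists>M M'. acts_at w M M'"
proof (cases w)
  case (Word l)
  have "\<exists>M M'. acts_at (Word l) M M'"
  proof (induction l)
    case Nil
    have "acts_at (Word []) 1 1"
      by (simp add: acts_at_def h_simps free_word_zero flip: zero_star_word_def)
    then show ?case by blast
  next
    case (Cons a l)
    then obtain M M' where w: "acts_at (Word l) M M'" by blast
    note D = acts_atD[OF w]
    show ?case
    proof (cases a)
      case (Gen g)
      show ?thesis
      proof (cases g)
        case (Inl m)
        have "acts_at (Word (a # l)) (M * 1) (elem m * M')"
        proof (rule acts_at_Cons[OF w])
          fix n q q' :: 'r assume n: "n \<noteq> 0" and q: "letter_sends a q q'"
          have "S (elem m) * (u q * S (M' * n)) = u (elem m * q) * (S (elem m) * S (M' * n))"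
            by (simp add: S_u flip: mult.assoc)
          then show "h (free_word (Word [a])) * (u q * S (M' * 1 * n)) = u q' * S (elem m * M' * n)"
            using n q D(2) by (simp add: h_letter Inl Gen s_eq_S S_mult mult.assoc)
        qed (use D(2) in \<open>auto simp: Gen Inl algebra_simps\<close>)
        then show ?thesis by blast
      next
        case (Inr k)
        have "acts_at (Word (a # l)) (M * 1) M'"
          by (rule acts_at_Cons[OF w])
            (use D(2) in \<open>auto simp: h_letter Gen Inr algebra_simps u_add simp flip: mult.assoc\<close>)
        then show ?thesis by blast
      qed
    next
      case (Adj g)
      show ?thesis
      proof (cases g)
        case (Inl m)
        have *: "star (S (elem m)) * (u q * S (M' * elem m * n)) =
            star (S (elem m)) * (u q * S (elem m)) * S (M' * n)" if "n \<noteq> 0" for q n :: 'r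
          using that D(2) S_mult[of "elem m" "M' * n"] by (simp add: mult.assoc mult.left_commute)
        have "acts_at (Word (a # l)) (M * elem m) M'"
        proof (rule acts_at_Cons[OF w])
          fix n q q' :: 'r assume n: "n \<noteq> 0" and q: "letter_sends a q q'"
          then show "h (free_word (Word [a])) * (u q * S (M' * elem m * n)) = u q' * S (M' * n)"
            by (simp add: h_letter Inl Adj s_eq_S * S_u_S_dvd)
        next
          fix n q :: 'r assume n: "n \<noteq> 0" and q: "\<nexists>q'. letter_sends a q q'"
          then have "\<not> elem m dvd q" by (auto simp: Adj Inl dvd_def)
          then show "h (free_word (Word [a])) * (u q * S (M' * elem m * n)) = 0"
            using n by (simp add: h_letter Inl Adj s_eq_S * S_u_S_not_dvd)
        qed (use D(2) in \<open>auto simp: Adj Inl algebra_simps\<close>)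
        then show ?thesis by blast
      next
        case (Inr k)
        have ex: "letter_sends a q (q - k)" for q by (simp add: Adj Inr)
        have "acts_at (Word (a # l)) (M * 1) M'"
        proof (rule acts_at_Cons[OF w])
          fix n q :: 'r assume "\<nexists>q'. letter_sends a q q'"
          then show "h (free_word (Word [a])) * (u q * S (M' * 1 * n)) = 0" using ex by blast
        qed (use D(2) in \<open>auto simp: h_letter Adj Inr algebra_simps star_u u_add simp flip: mult.assoc\<close>)
        then show ?thesis by blast
      qed
    qed
  qed
  then show ?thesis using Word by simp
qed

lemma ex_common_acts_at:
  assumes "finite A"
  shows "\<exists>M\<noteq>0. \<forall>w\<in>A. \<exists>M'. acts_at w M M'"
  using assms
proof (induction A rule: finite_induct)
  case (insert w A)
  then obtain M where M: "M \<noteq> 0" "\<forall>w\<in>A. \<exists>M'. acts_at w M M'" by blast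
  obtain L L' where L: "acts_at w L L'" using ex_acts_at by blast
  have "\<exists>M'. acts_at v (M * L) M'" if "v \<in> A" for v
    using M(2) that acts_at_mult[OF _ acts_atD(1)[OF L]] by blast
  moreover have "acts_at w (M * L) (L' * M)"
    using acts_at_mult[OF L M(1)] by (simp add: mult.commute)
  ultimately show ?case using M(1) acts_atD(1)[OF L] by (intro exI[of _ "M * L"]) auto
qed (auto intro: exI[of _ 1])

section \<open>Norms of elements of trivial degree\<close>

lemma h_expansion: "h x = (\<Sum>w\<in>words x. coef x w *\<^sub>C h (free_word w))"
  using arg_cong[OF words_expansion[of x], of h] by (simp add: star_hom_sum[OF star_hom_h] h_simps)

lemma vac_conj_u:
  "vac (star (free_gen (Inr b)) * (x * free_gen (Inr b))) =
    linear_extension (\<lambda>w. of_bool (scale w = 1 \<and> sends w b b)) x"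
proof (induction x rule: free_induct)
  case (1 c w)
  let ?v = "Word [Adj (Inr b)] + (w + Word [Gen (Inr b)])"
  have "vac (star (free_gen (Inr b)) * ((c *\<^sub>C free_word w) * free_gen (Inr b))) =
      c * vac (free_word ?v)"
    by (simp add: star_free_gen free_word_plus mult_scaleC_left mult_scaleC_right vac_scaleC)
      (simp add: free_gen_def)
  moreover have "sends ?v 0 0 \<longleftrightarrow> sends w b b" "scale ?v = scale w"
    unfolding sends_plus scale_plus by auto
  ultimately show ?case by (simp add: vac_free_word linear_extension_scaleC)
qed (simp add: distrib_left distrib_right vac_add linear_extension_add)

text \<open>At a common resolution \<open>M\<close> of its words, \<open>z\<close> multiplies each range projection \<open>range_proj M l\<close> by the
  scalar \<open>vac (u\<^sup>-\<^sup>l z u\<^sup>l)\<close>, and finitely many of these orthogonal projections add up to 1. The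
  formula uses the adjoint of the generator \<open>u\<^sup>l\<close>, since in the free algebra it differs from the generator
  \<open>u\<^sup>-\<^sup>l\<close>.\<close>

lemma norm_degree_zero_le:
  assumes z: "\<And>w. w \<in> words z \<Longrightarrow> scale w = 1 \<and> shift w = 0"
    and C: "\<And>b. cmod (vac (star (free_gen (Inr b)) * (z * free_gen (Inr b)))) \<le> C"
  shows "norm (h z) \<le> C"
proof -
  define c where "c b = vac (star (free_gen (Inr b)) * (z * free_gen (Inr b)))" for b
  obtain M where M: "M \<noteq> 0" "\<forall>w\<in>words z. \<exists>M'. acts_at w M M'"
    using ex_common_acts_at[OF finite_words] by blast
  have word: "h (free_word w) * range_proj M l = of_bool (scale w = 1 \<and> sends w l l) *\<^sub>C range_proj M l"
    if w: "w \<in> words z" for w l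
  proof -
    obtain M' where M': "acts_at w M M'" using M w by blast
    have "M' = M" using acts_atD(3)[OF M'] z[OF w] by simp
    note D = acts_atD(5,6)[OF M'[unfolded this], of 1]
    have "sends w l r \<Longrightarrow> r = l" for r using sends_affine[of w l r] z[OF w] by simp
    then have "h (free_word w) * (u l * S M) = of_bool (scale w = 1 \<and> sends w l l) *\<^sub>C (u l * S M)"
      using D[of l] z[OF w] by (cases "\<exists>r. sends w l r") (auto simp: scaleC_one)
    then show ?thesis
      by (simp add: range_proj_def mult_scaleC_left flip: mult.assoc)
  qed
  have hz: "h z * range_proj M l = c l *\<^sub>C range_proj M l" for l
  proof -
    have "h z * range_proj M l = (\<Sum>w\<in>words z. coef z w *\<^sub>C (h (free_word w) * range_proj M l))"
      by (subst h_expansion) (simp add: sum_distrib_right mult_scaleC_left)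
    also have "\<dots> = (\<Sum>w\<in>words z. (coef z w * of_bool (scale w = 1 \<and> sends w l l)) *\<^sub>C range_proj M l)"
      by (intro sum.cong refl) (simp add: word scaleC_scaleC)
    also have "\<dots> = (\<Sum>w\<in>words z. coef z w * of_bool (scale w = 1 \<and> sends w l l)) *\<^sub>C range_proj M l"
      by (rule scaleC_sum_left)
    finally show ?thesis by (simp add: c_def vac_conj_u linear_extension_def)
  qed
  have "h z = h z * (\<Sum>X\<in>UNIV // ideal_cong M. range_proj M (coset_rep X))"
    by (simp add: sum_range_proj[OF M(1)])
  also have "\<dots> = (\<Sum>X\<in>UNIV // ideal_cong M. c (coset_rep X) *\<^sub>C range_proj M (coset_rep X))"
    by (simp add: sum_distrib_left hz)
  also have "norm \<dots> \<le> C"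
  proof (rule norm_orthogonal_projections_le[OF finite_quotient[OF M(1)] projection_range_proj])
    show "0 \<le> C" using C[of 0] norm_ge_zero order_trans by blast
  qed (use C in \<open>auto simp: c_def range_proj_coset_rep_orthogonal[OF M(1)]\<close>)
  finally show ?thesis .
qed

section \<open>Compression to scalars\<close>

lemma infinite_ring: "infinite (UNIV :: 'r set)"
proof
  assume fin: "finite (UNIV :: 'r set)"
  obtain z :: 'r where z: "z \<noteq> 0" "\<not> z dvd 1" using not_field by blast
  have "inj ((*) z)" using z by (auto intro!: injI)
  then have "surj ((*) z)" using fin finite_UNIV_inj_surj by blast
  then show False using z(2) by (metis dvd_def surjD)
qed

text \<open>If \<open>z\<close> is not a unit, \<open>z\<close> times the product of \<open>D\<close> divides no member of \<open>D\<close>.\<close>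

lemma ex_nondivisor:
  assumes "finite D" "0 \<notin> (D :: 'r set)"
  shows "\<exists>n\<noteq>0. \<forall>t\<in>D. \<not> n dvd t"
proof -
  obtain z :: 'r where z: "z \<noteq> 0" "\<not> z dvd 1" using not_field by blast
  have "\<not> z * \<Prod>D dvd t" if t: "t \<in> D" for t
  proof
    assume "z * \<Prod>D dvd t"
    moreover have "\<Prod>D = t * \<Prod>(D - {t})" using assms(1) t by (rule prod.remove)
    ultimately have "t * (z * \<Prod>(D - {t})) dvd t * 1" by (simp add: mult.left_commute)
    moreover have "t \<noteq> 0" using assms t by blast
    ultimately have "z * \<Prod>(D - {t}) dvd 1" by (simp only: dvd_mult_cancel_left) simp
    then show False using z(2) dvd_mult_left by blast
  qed
  then show ?thesis using assms z by (intro exI[of _ "z * \<Prod>D"]) auto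
qed

text \<open>Take \<open>v = u\<^sup>l s\<^sub>m\<close> with \<open>m = M n\<close> for a common resolution \<open>M\<close> of the words of \<open>x\<close>, and \<open>l\<close> a multiple of
  \<open>M\<close>, so that a word is defined at \<open>l\<close> iff it is defined at 0. A word sending \<open>l\<close> to \<open>r\<close> is compressed by \<open>v\<close> to
  \<open>s\<^sub>m\<^sup>* u\<^sup>r\<^sup>-\<^sup>l s\<^sub>k\<close> with \<open>n\<close> dividing both \<open>m\<close> and \<open>k\<close>, which vanishes if \<open>n\<close> does not divide \<open>r - l\<close>. A word of
  nontrivial degree has at most one fixed point, so \<open>l\<close> can be chosen to be moved by all of them, and then
  \<open>n\<close> not to divide any of the finitely many nonzero differences \<open>r - l\<close>.\<close>

lemma ex_compressing_isometry:
  "\<exists>v. star v * v = 1 \<and> star v * (h x * v) = vac x *\<^sub>C 1"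
proof -
  obtain M where M: "M \<noteq> 0" "\<forall>w\<in>words x. \<exists>M'. acts_at w M M'"
    using ex_common_acts_at[OF finite_words] by blast
  define trivial where "trivial w \<longleftrightarrow> scale w = 1 \<and> shift w = 0" for w :: "'r CL_word"
  have "finite {l. sends w l l}" if w: "\<not> trivial w" for w
  proof -
    have "l = l'" if "sends w l l" "sends w l' l'" for l l'
    proof (cases "scale w = 1")
      case True
      then show ?thesis using w sends_affine[OF that(1)] by (simp add: trivial_def)
    next
      case False
      have "(1 - scale w) * to_fract l = (1 - scale w) * to_fract l'"
        using sends_affine[OF that(1)] sends_affine[OF that(2)] by algebra
      then show ?thesis using False by simp
    qed
    then show ?thesis by (rule finite_Collect_if_unique)
  qed
  then have "finite (\<Union>w\<in>{w \<in> words x. \<not> trivial w}. {l. sends w l l})" by auto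
  moreover have "infinite (range ((*) M))"
    using infinite_ring M(1) by (subst finite_image_iff) (auto intro: injI)
  ultimately have "\<not> range ((*) M) \<subseteq> (\<Union>w\<in>{w \<in> words x. \<not> trivial w}. {l. sends w l l})"
    by (meson finite_subset)
  then obtain t where t: "\<And>w. w \<in> words x \<Longrightarrow> \<not> trivial w \<Longrightarrow> \<not> sends w (M * t) (M * t)"
    by auto
  define l where "l = M * t"
  \<comment> \<open>the nonzero displacements of \<open>l\<close> under the words of \<open>x\<close>\<close>
  define D where "D = (\<Union>w\<in>words x. {r - l |r. sends w l r}) - {0}"
  have "finite {r - l |r. sends w l r}" for w
  proof -
    have "r = r'" if "sends w l r" "sends w l r'" for r r'
      using sends_affine[OF that(1)] sends_affine[OF that(2)] by (metis to_fract_eq_iff)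
    then have "finite {r. sends w l r}" by (rule finite_Collect_if_unique)
    then show ?thesis by simp
  qed
  then have "finite D" "0 \<notin> D" by (auto simp: D_def)
  from ex_nondivisor[OF this] obtain n where n: "n \<noteq> 0" "\<And>r. r \<in> D \<Longrightarrow> \<not> n dvd r" by auto
  define v where "v = u l * S (M * n)"
  have uu: "u (- l) * (u k * y) = u (k - l) * y" for k y
    by (simp add: u_add flip: mult.assoc)
  have v: "star v * v = 1"
    by (simp add: v_def star_mult star_u mult.assoc uu S_isometry)
  have word: "star v * (h (free_word w) * v) = vac (free_word w) *\<^sub>C 1" if w: "w \<in> words x" for w
  proof -
    obtain M' where M': "acts_at w M M'" using M w by blast
    note D = acts_atD[OF M']
    consider "\<nexists>r. sends w l r" | "sends w l l" | r where "sends w l r" "r \<noteq> l" by blast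
    then show ?thesis
    proof cases
      case 1
      then have "\<not> sends w 0 0" using D(4)[of 0 0 t] by (auto simp: l_def)
      then show ?thesis using D(6)[OF n(1) 1] by (simp add: v_def vac_free_word)
    next
      case 2
      then have sc: "scale w = 1" using t[OF w] by (auto simp: l_def trivial_def)
      then have "M' = M" using D(3) by simp
      then have "sends w 0 0" using D(4)[OF 2, of "- t"] by (simp add: l_def)
      moreover have "h (free_word w) * v = v"
        using D(5)[OF n(1) 2] \<open>M' = M\<close> by (simp add: v_def)
      ultimately show ?thesis by (simp add: v vac_free_word sc scaleC_one)
    next
      case 3
      have "\<not> (scale w = 1 \<and> sends w 0 0)"
        using 3 sends_affine[OF 3(1)] sends_zero[of w 0] by auto
      then have "vac (free_word w) = 0" by (simp add: vac_free_word)
      moreover have "\<not> n dvd r - l" using 3 w by (intro n(2)) (auto simp: D_def)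
      then have "star (S n) * (u (r - l) * S n) = 0" using n(1) by (simp add: S_u_S_not_dvd)
      then have "star (S M) * (star (S n) * (u (r - l) * S n)) * S M' = 0" by simp
      then have "star (S n * S M) * (u (r - l) * (S n * S M')) = 0"
        by (simp add: star_mult mult.assoc)
      then have "star v * (u r * S (M' * n)) = 0"
        using n(1) M(1) D(2)
        by (simp add: v_def S_mult star_mult star_u mult.assoc uu mult.commute)
      ultimately show ?thesis using D(5)[OF n(1) 3(1)] by (simp add: v_def)
    qed
  qed
  have "star v * (h x * v) = (\<Sum>w\<in>words x. coef x w *\<^sub>C (star v * (h (free_word w) * v)))"
    by (subst h_expansion) (simp add: sum_distrib_left sum_distrib_right mult_scaleC_left mult_scaleC_right)
  also have "\<dots> = (\<Sum>w\<in>words x. (coef x w * vac (free_word w)) *\<^sub>C 1)"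
    by (intro sum.cong refl) (simp add: word scaleC_scaleC)
  also have "\<dots> = vac x *\<^sub>C 1" by (simp only: scaleC_sum_left flip: vac_expansion)
  finally show ?thesis using v by blast
qed

section \<open>Norms of elements of scale 1\<close>

lemma norm_one [simp]: "norm (1 :: 'a) = 1"
proof -
  have "norm (1::'a) * norm (1::'a) = norm (1::'a)"
    using cstar_identity[of "1::'a"] by (simp add: power2_eq_square)
  then show ?thesis using one_nonzero by simp
qed

lemma norm_isometry_conj_le:
  assumes "star v * v = (1 :: 'a)"
  shows "norm (star v * (x * v)) \<le> norm x"
proof -
  have "norm (star v * (x * v)) \<le> 1 * (norm x * 1)"
    using norm_isometry_le[OF assms] by (intro norm_mult_le) (auto simp: norm_star)
  then show ?thesis by simp
qed

lemma norm_h_star: "norm (h (star x)) = norm (h x)"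
  by (simp add: h_simps norm_star)

lemma norm_h_star_mult: "norm (h (star x * x)) = (norm (h x))\<^sup>2"
  by (simp add: h_simps cstar_identity)

lemma vac_le_norm: "cmod (vac x) \<le> norm (h x)"
proof -
  obtain v where "star v * v = 1" "star v * (h x * v) = vac x *\<^sub>C 1"
    using ex_compressing_isometry by blast
  then show ?thesis using norm_isometry_conj_le[of v "h x"] by (simp add: norm_scaleC)
qed

lemma bounded_by_norm: "bounded_by x (norm (h x))"
  using sqnorm_dominated[of "\<lambda>x. norm (h x)" x] vac_le_norm
  by (simp add: bounded_by_def h_simps cstar_identity norm_mult_ineq)

lemma sqnorm_gen_u: "sqnorm (free_gen (Inr b)) = 1"
proof -
  have "complex_of_real (sqnorm (free_gen (Inr b))) = vac (star (free_gen (Inr b)) * (1 * free_gen (Inr b)))"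
    by (simp add: vac_star_self)
  also have "\<dots> = linear_extension (\<lambda>w. of_bool (scale w = 1 \<and> sends w b b)) (free_word 0)"
    by (simp only: vac_conj_u free_word_zero)
  also have "\<dots> = 1" by (simp only: linear_extension_free_word) simp
  finally show ?thesis by (simp only: of_real_eq_1_iff)
qed

text \<open>Let \<open>z\<close> be the component of \<open>y\<close> of shift \<open>c\<close>. Then \<open>z\<^sup>* z\<close> is the component of trivial degree of \<open>z\<^sup>* y\<close>.
  Its norm is controlled by values of \<open>vac\<close>, which do not distinguish it from \<open>z\<^sup>* y\<close>; the
  Cauchy-Schwarz inequality then gives \<open>\<parallel>z\<parallel>\<^sup>2 \<le> \<parallel>z\<parallel> C\<close>.\<close>

lemma norm_shift_part_le:
  assumes x: "\<And>w. w \<in> words y \<Longrightarrow> scale w = 1" and bd: "bounded_by y C"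
  shows "norm (h (part (\<lambda>w. shift w = c) y)) \<le> C"
proof -
  have C: "0 \<le> C" using bd by (simp add: bounded_by_def)
  define yc where "yc = part (\<lambda>w. shift w = c) y"
  have yc: "scale v = 1" "shift v = - c" if "v \<in> words (star yc)" for v
    using that x by (auto simp: words_star yc_def shift_adj)
  have "part (\<lambda>w. scale w = 1 \<and> shift w = 0) (star yc * y) = star yc * part (\<lambda>w. scale w = 1 \<and> shift w = c) y"
    by (rule part_mult_left) (auto simp: yc shift_plus)
  also have "part (\<lambda>w. scale w = 1 \<and> shift w = c) y = yc"
    unfolding yc_def using x by (intro part_cong) auto
  finally have part: "part (\<lambda>w. scale w = 1 \<and> shift w = 0) (star yc * y) = star yc * yc" .
  have "norm (h (star yc * yc)) \<le> norm (h yc) * C"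
  proof (rule norm_degree_zero_le)
    fix w assume "w \<in> words (star yc * yc)"
    then show "scale w = 1 \<and> shift w = 0" by (simp flip: part)
  next
    fix b
    let ?u = "free_gen (Inr b) :: 'r CL_free"
    have "vac (star ?u * (star yc * yc * ?u)) = vac (star ?u * ((star yc * y) * ?u))"
      unfolding vac_conj_u part[symmetric] linear_extension_part
      by (intro linear_extension_cong) (auto dest: sends_affine)
    also have "\<dots> = vac (star (yc * ?u) * (y * ?u))" by (simp add: star_mult mult.assoc)
    finally have "cmod (vac (star ?u * (star yc * yc * ?u))) \<le> sqrt (sqnorm (yc * ?u)) * sqrt (sqnorm (y * ?u))"
      by (simp add: vac_Cauchy_Schwarz)
    also have "\<dots> \<le> sqrt ((norm (h yc))\<^sup>2) * sqrt (C\<^sup>2)"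
      using bounded_byD[OF bounded_by_norm[of yc], of ?u] bounded_byD[OF bd, of ?u]
      by (intro mult_mono real_sqrt_le_mono) (auto simp: sqnorm_gen_u sqnorm_nonneg)
    finally show "cmod (vac (star ?u * (star yc * yc * ?u))) \<le> norm (h yc) * C" using C by simp
  qed
  then have "norm (h yc) * norm (h yc) \<le> norm (h yc) * C"
    by (simp add: norm_h_star_mult power2_eq_square)
  then show ?thesis using C by (cases "norm (h yc) = 0") (auto simp: yc_def)
qed

text \<open>On words of scale 1 the shift is additive, so the growth argument applies to the group \<open>K\<close>.\<close>

lemma norm_scale_one_le:
  assumes x: "\<And>w. w \<in> words x \<Longrightarrow> scale w = 1" and bd: "bounded_by x C"
  shows "norm (h x) \<le> C"
proof -
  have C: "0 \<le> C" using bd by (simp add: bounded_by_def)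
  have sc: "scale (sum_list ws) = 1" if "set ws \<subseteq> A" "\<And>w. w \<in> A \<Longrightarrow> scale w = 1"
    for ws A using that by (induction ws) auto
  have sa: "norm (h y) \<le> D"
    if y: "\<And>w. w \<in> words y \<Longrightarrow> scale w = 1" "star y = y" "bounded_by y D" for y D
  proof (rule norm_le_if_parts_of_powers_le[OF star_hom_h, where deg = shift
        and D = "\<lambda>M. sum_mset (image_mset shift M)"])
    show "star (h y) = h y" by (simp add: y(2) flip: h_simps(4))
    show "0 \<le> D" using y(3) by (simp add: bounded_by_def)
    show "shift (sum_list ws) = sum_mset (image_mset shift (mset ws))" if "set ws \<subseteq> words y" for ws
      using that by (induction ws) (auto simp: shift_plus y(1) add.commute)
    fix n k
    show "norm (h (part (\<lambda>w. shift w = k) (y ^ n))) \<le> D ^ n"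
    proof (rule norm_shift_part_le[OF _ bounded_by_power[OF y(3)]])
      fix w assume "w \<in> words (y ^ n)"
      then show "scale w = 1" using words_power[of y n] sc[OF _ y(1)] by blast
    qed
  qed
  have "norm (h (star x * x)) \<le> norm (h x) * C"
  proof (rule sa)
    show "scale w = 1" if "w \<in> words (star x * x)" for w
      using that words_mult[of "star x" x] x by (auto simp: words_star)
    show "star (star x * x) = star x * x" by (simp add: star_mult star_star)
    show "bounded_by (star x * x) (norm (h x) * C)"
      using bounded_by_mult[OF bounded_by_norm[of "star x"] bd] by (simp add: norm_h_star)
  qed
  then have "norm (h x) * norm (h x) \<le> norm (h x) * C"
    by (simp add: norm_h_star_mult power2_eq_square)
  then show ?thesis using C by (cases "norm (h x) = 0") auto
qed

lemma norm_scale_part_le: "bounded_by y C \<Longrightarrow> norm (h (part (\<lambda>w. scale w = 1) y)) \<le> C"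
  by (intro norm_scale_one_le bounded_by_scale_part) auto

end

section \<open>Closed ideals\<close>

lemma mult_le_infdist:
  assumes "A \<noteq> {}" "0 \<le> D" "\<And>a. a \<in> A \<Longrightarrow> c \<le> D * dist x a"
  shows "c \<le> D * infdist x A"
proof (cases "D = 0")
  case True
  then show ?thesis using assms by auto
next
  case False
  then have "c / D \<le> dist x a" if "a \<in> A" for a
    using assms that by (simp add: divide_le_eq mult.commute)
  then have "c / D \<le> infdist x A"
    unfolding infdist_notempty[OF assms(1)] using assms(1) by (intro cINF_greatest) auto
  then show ?thesis using False assms(2) by (simp add: divide_le_eq mult.commute)
qed

text \<open>After division by \<open>c\<close>, the ideal contains an element \<open>y\<close> with \<open>\<parallel>1 - y\<parallel> < 1\<close>. It also contains
  \<open>1 - (1 - y)\<^sup>k\<close>, and these elements converge to 1.\<close>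

lemma one_in_ideal_if_near:
  fixes I :: "'a::cstar_algebra set"
  assumes I: "closed_two_sided_ideal I" and z: "z \<in> I" "norm (c *\<^sub>C 1 - z) < cmod c"
  shows "1 \<in> I"
proof -
  have c: "c \<noteq> 0" using z(2) by auto
  note D = I[unfolded closed_two_sided_ideal_def]
  define y where "y = inverse c *\<^sub>C z"
  have y: "y \<in> I" using D z by (simp add: y_def)
  have "1 - y = inverse c *\<^sub>C (c *\<^sub>C 1 - z)"
    using c by (simp add: y_def scaleC_diff_right scaleC_scaleC scaleC_one)
  then have n: "norm (1 - y) < 1"
    using z(2) c by (simp add: norm_scaleC norm_inverse divide_less_eq flip: divide_inverse_commute)
  have "1 - (1 - y) ^ k \<in> I" for k
  proof (induction k)
    case 0
    then show ?case using D by simp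
  next
    case (Suc k)
    have "1 - (1 - y) ^ Suc k = (1 - (1 - y) ^ k) + y * (1 - y) ^ k" by (simp add: algebra_simps)
    then show ?case using Suc D y by metis
  qed
  moreover have "(\<lambda>k. 1 - (1 - y) ^ k) \<longlonglongrightarrow> 1 - 0"
  proof (intro tendsto_diff tendsto_const)
    have "norm ((1 - y) ^ k) \<le> norm (1 - y) ^ k" for k
    proof (induction k)
      case (Suc k)
      then show ?case by (simp add: norm_mult_le)
    qed (simp add: norm_one_le)
    then show "(\<lambda>k. (1 - y) ^ k) \<longlonglongrightarrow> 0"
      using n by (intro Lim_null_comparison[OF _ LIMSEQ_power_zero[of "norm (1 - y)"]]) auto
  qed
  moreover have "closed I" using D by blast
  ultimately show ?thesis by (metis closed_sequentially diff_zero)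
qed

locale CL_proper_ideal = CL_representation s u for s :: "'r::idom nonzero \<Rightarrow> 'a::cstar_algebra" and u +
  fixes I :: "'a set"
  assumes ideal: "closed_two_sided_ideal I" and proper: "1 \<notin> I"
begin

text \<open>The quotient norm, considered as a mere algebra seminorm. The place of the C*-identity and of the
  invariance under the adjoint is taken by the geometric mean with \<open>\<parallel>h y\<parallel>\<close> in \<open>bounded_by_qnorm\<close>.\<close>

definition qnorm :: "'r CL_free \<Rightarrow> real" where
  "qnorm x = infdist (h x) I"

lemmas idealD = ideal[unfolded closed_two_sided_ideal_def]

lemma ideal_nonempty: "I \<noteq> {}"
  using idealD by blast

lemma qnorm_nonneg: "0 \<le> qnorm x"
  by (simp add: qnorm_def infdist_nonneg)

lemma qnorm_le_norm: "qnorm x \<le> norm (h x)"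
  using idealD infdist_le[of 0 I "h x"] by (simp add: qnorm_def)

lemma vac_le_qnorm: "cmod (vac x) \<le> qnorm x"
proof -
  have "cmod (vac x) \<le> 1 * dist (h x) i" if i: "i \<in> I" for i
  proof (rule ccontr)
    assume less: "\<not> cmod (vac x) \<le> 1 * dist (h x) i"
    obtain v where v: "star v * v = 1" "star v * (h x * v) = vac x *\<^sub>C 1"
      using ex_compressing_isometry by blast
    have "vac x *\<^sub>C 1 - star v * (i * v) = star v * ((h x - i) * v)"
      by (simp add: v(2) algebra_simps)
    then have "norm (vac x *\<^sub>C 1 - star v * (i * v)) \<le> norm (h x - i)"
      using norm_isometry_conj_le[OF v(1), of "h x - i"] by simp
    then have "norm (vac x *\<^sub>C 1 - star v * (i * v)) < cmod (vac x)"
      using less by (simp add: dist_norm)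
    moreover have "star v * (i * v) \<in> I" using idealD i by blast
    ultimately show False using one_in_ideal_if_near[OF ideal] proper by blast
  qed
  then show ?thesis
    using mult_le_infdist[OF ideal_nonempty, of 1 "cmod (vac x)" "h x"] by (simp add: qnorm_def)
qed

lemma qnorm_mult: "qnorm (x * y) \<le> qnorm x * qnorm y"
proof -
  have 1: "qnorm (x * y) \<le> dist (h x) i * dist (h y) j" if "i \<in> I" "j \<in> I" for i j
  proof -
    have "i * h y + (h x * j + (- 1) *\<^sub>C (i * j)) \<in> I" using idealD that by metis
    then have "qnorm (x * y) \<le> norm (h x * h y - (i * h y + (h x * j - i * j)))"
      using infdist_le by (fastforce simp: qnorm_def h_simps dist_norm scaleC_minus_one)
    also have "h x * h y - (i * h y + (h x * j - i * j)) = (h x - i) * (h y - j)"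
      by (simp add: algebra_simps)
    also have "norm \<dots> \<le> dist (h x) i * dist (h y) j" by (simp add: dist_norm norm_mult_ineq)
    finally show ?thesis .
  qed
  have "qnorm (x * y) \<le> dist (h x) i * qnorm y" if "i \<in> I" for i
    unfolding qnorm_def[of y] by (rule mult_le_infdist[OF ideal_nonempty]) (auto simp: 1 that qnorm_nonneg)
  then have "qnorm (x * y) \<le> qnorm y * infdist (h x) I"
    by (intro mult_le_infdist[OF ideal_nonempty]) (auto simp: qnorm_nonneg mult.commute)
  then show ?thesis by (simp add: qnorm_def mult.commute)
qed

lemma bounded_by_qnorm: "bounded_by y (sqrt (norm (h y) * qnorm y))"
proof -
  have "sqnorm (y * b) \<le> (norm (h y) * qnorm y) * sqnorm b" for b
  proof -
    have "sqnorm (y * b) \<le> qnorm (star y * y) * sqnorm b"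
      by (rule sqnorm_dominated[OF qnorm_nonneg qnorm_mult vac_le_qnorm])
    also have "qnorm (star y * y) \<le> qnorm (star y) * qnorm y" by (rule qnorm_mult)
    also have "qnorm (star y) \<le> norm (h y)" using qnorm_le_norm[of "star y"] by (simp add: norm_h_star)
    finally show ?thesis by (simp add: sqnorm_nonneg qnorm_nonneg mult_right_mono)
  qed
  then show ?thesis by (simp add: bounded_by_def qnorm_nonneg)
qed

text \<open>Let \<open>z\<close> be the component of \<open>y = x\<^sup>n\<close> of scale \<open>k\<close>. Then \<open>z\<^sup>* z\<close> is the part of scale 1 of \<open>z\<^sup>* y\<close>, so
  \<open>norm_scale_part_le\<close> bounds its norm by the geometric mean of \<open>\<parallel>z\<^sup>* y\<parallel>\<close> and the quotient norm of \<open>z\<^sup>* y\<close>.\<close>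

lemma norm_scale_part_power_le:
  "norm (h (part (\<lambda>w. scale w = k) (x ^ n))) \<le> sqrt (norm (h x) * qnorm x) ^ n"
proof -
  define y where "y = x ^ n"
  define yk where "yk = part (\<lambda>w. scale w = k) y"
  have ny: "norm (h y) \<le> norm (h x) ^ n" unfolding y_def
  proof (induction n)
    case (Suc n)
    then show ?case by (simp add: h_simps norm_mult_le)
  qed (simp add: h_simps)
  have qy: "qnorm y \<le> qnorm x ^ n" unfolding y_def
  proof (induction n)
    case 0
    show ?case using qnorm_le_norm[of 1] by (simp add: h_simps)
  next
    case (Suc n)
    then show ?case
      using qnorm_mult[of x "x ^ n"] mult_left_mono[OF Suc qnorm_nonneg[of x]] by simp
  qed
  have star: "star yk * yk = part (\<lambda>w. scale w = 1) (star yk * y)"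
  proof (cases "yk = 0")
    case False
    have "part (\<lambda>w. scale w = 1) (star yk * y) = star yk * part (\<lambda>w. scale w = k) y"
      by (rule part_mult_left) (auto simp: words_star yk_def field_simps)
    then show ?thesis by (simp add: yk_def)
  next
    case True
    have "part (\<lambda>w. scale w = 1) (0 :: 'r CL_free) = 0" by (rule free_eqI) simp
    then show ?thesis using True by simp
  qed
  have "(norm (h yk))\<^sup>2 \<le> sqrt (norm (h (star yk * y)) * qnorm (star yk * y))"
    unfolding norm_h_star_mult[symmetric] star by (rule norm_scale_part_le[OF bounded_by_qnorm])
  also have "\<dots> \<le> sqrt ((norm (h yk) * norm (h x) ^ n) * (norm (h yk) * qnorm x ^ n))"
  proof (intro real_sqrt_le_mono mult_mono)
    show "norm (h (star yk * y)) \<le> norm (h yk) * norm (h x) ^ n"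
      unfolding h_simps using ny by (intro norm_mult_le) (simp_all add: norm_star)
    have "qnorm (star yk * y) \<le> qnorm (star yk) * qnorm y" by (rule qnorm_mult)
    also have "\<dots> \<le> norm (h yk) * qnorm x ^ n"
      using qy qnorm_le_norm[of "star yk"] by (intro mult_mono) (auto simp: norm_h_star qnorm_nonneg)
    finally show "qnorm (star yk * y) \<le> norm (h yk) * qnorm x ^ n" .
  qed (auto simp: qnorm_nonneg)
  also have "\<dots> = sqrt ((norm (h yk))\<^sup>2 * (norm (h x) * qnorm x) ^ n)"
    by (simp add: power_mult_distrib power2_eq_square mult_ac)
  also have "\<dots> = norm (h yk) * sqrt (norm (h x) * qnorm x) ^ n"
    by (simp add: real_sqrt_mult real_sqrt_power power_mult_distrib)
  finally have "norm (h yk) * norm (h yk) \<le> norm (h yk) * sqrt (norm (h x) * qnorm x) ^ n"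
    by (simp add: power2_eq_square)
  then show ?thesis
    by (cases "norm (h yk) = 0") (auto simp: yk_def y_def qnorm_nonneg)
qed

text \<open>The growth argument for the group \<open>K\<^sup>\<times>\<close> bounds \<open>\<parallel>h y\<parallel>\<close>, for self-adjoint \<open>y\<close>, by the geometric mean of
  \<open>\<parallel>h y\<parallel>\<close> and the quotient norm, which is the same as bounding it by the quotient norm.\<close>

lemma norm_le_qnorm: "norm (h x) \<le> qnorm x"
proof -
  have sa: "norm (h y) \<le> qnorm y" if y: "star y = y" for y
  proof -
    have "norm (h y) \<le> sqrt (norm (h y) * qnorm y)"
    proof (rule norm_le_if_parts_of_powers_le[OF star_hom_h, where deg = scale
          and D = "\<lambda>M. prod_mset (image_mset scale M)"])
      show "star (h y) = h y" by (simp add: y flip: h_simps(4))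
      show "scale (sum_list ws) = prod_mset (image_mset scale (mset ws))" for ws :: "'r CL_word list"
        by (induction ws) auto
    qed (auto simp: qnorm_nonneg norm_scale_part_power_le)
    then have "(norm (h y))\<^sup>2 \<le> norm (h y) * qnorm y"
      using power_mono[of "norm (h y)" "sqrt (norm (h y) * qnorm y)" 2] by (simp add: qnorm_nonneg)
    then show ?thesis
      by (cases "norm (h y) = 0") (auto simp: power2_eq_square qnorm_nonneg)
  qed
  have "(norm (h x))\<^sup>2 = norm (h (star x * x))" by (simp add: norm_h_star_mult)
  also have "\<dots> \<le> qnorm (star x * x)" by (rule sa) (simp add: star_mult star_star)
  also have "\<dots> \<le> qnorm (star x) * qnorm x" by (rule qnorm_mult)
  also have "\<dots> \<le> norm (h x) * qnorm x"
    using qnorm_le_norm[of "star x"] by (intro mult_right_mono) (auto simp: norm_h_star qnorm_nonneg)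
  finally show ?thesis
    by (cases "norm (h x) = 0") (auto simp: power2_eq_square qnorm_nonneg)
qed

lemma ideal_zero:
  assumes dense: "\<And>z e. 0 < e \<Longrightarrow> \<exists>x. norm (z - h x) < e"
  shows "I = {0}"
proof -
  have "z = 0" if z: "z \<in> I" for z
  proof (rule ccontr)
    assume "z \<noteq> 0"
    then obtain x where x: "norm (z - h x) < norm z / 2" using dense[of "norm z / 2" z] by auto
    have "norm (h x) \<le> qnorm x" by (rule norm_le_qnorm)
    also have "\<dots> \<le> norm (z - h x)"
      using infdist_le[OF z, of "h x"] by (simp add: qnorm_def dist_norm norm_minus_commute)
    finally have "norm z < norm z"
      using x norm_triangle_ineq[of "z - h x" "h x"] by simp
    then show False by simp
  qed
  then show ?thesis using idealD by blast
qed

end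

lemma ring_cstar_dense:
  fixes z :: "'r::idom ring_cstar"
  assumes "0 < e"
  shows "\<exists>x. norm (z - free_eval (case_sum ring_s ring_u) x) < e"
proof -
  let ?h = "of_pre \<circ> abs_pre_ring_cstar :: 'r CL_free \<Rightarrow> 'r ring_cstar"
  have eval: "free_eval (case_sum ring_s ring_u) x = ?h x" for x :: "'r CL_free"
  proof (rule free_star_hom_unique[OF star_hom_free_eval])
    show "star_hom ?h" by (intro star_hom_comp star_hom_abs star_hom_of_pre)
    show "free_eval (case_sum ring_s ring_u) (free_gen g) = ?h (free_gen g)" for g :: "'r nonzero + 'r"
      by (cases g) (simp_all add: ring_s_def ring_u_def)
  qed
  obtain a where a: "norm (z - of_pre a) < e" using of_pre_approx[OF assms] by blast
  obtain x where "a = abs_pre_ring_cstar x"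
    by (metis Quotient3_abs_rep[OF Quotient3_pre_ring_cstar])
  then show ?thesis using a by (auto simp: eval)
qed

theorem theorem4p8:
  assumes "\<not> (\<forall>x :: 'r::idom. x \<noteq> 0 \<longrightarrow> (\<exists>y. x * y = 1))"
    and "\<And>m :: 'r. m \<noteq> 0 \<Longrightarrow> finite (UNIV // ideal_cong m)"
  shows "simple_cstar_algebra TYPE('r ring_cstar)"
  unfolding simple_cstar_algebra_def
proof (intro allI impI)
  fix I :: "'r ring_cstar set"
  assume I: "closed_two_sided_ideal I"
  show "I = {0} \<or> I = UNIV"
  proof (cases "1 \<in> I")
    case True
    then have "x \<in> I" for x using I unfolding closed_two_sided_ideal_def by (metis mult_1_right)
    then show ?thesis by blast
  next
    case False
    have one: "(1 :: 'r ring_cstar) \<noteq> 0"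
      using I False unfolding closed_two_sided_ideal_def by metis
    interpret CL_proper_ideal ring_s "ring_u :: 'r \<Rightarrow> 'r ring_cstar" I
    proof
      show "\<exists>z :: 'r. z \<noteq> 0 \<and> \<not> z dvd 1" using assms(1) by (metis dvd_def)
    qed (use ring_cstar_satisfies one assms(2) I False in auto)
    have "I = {0}"
      by (rule ideal_zero) (use ring_cstar_dense in \<open>simp add: h_def\<close>)
    then show ?thesis by blast
  qed
qed

end
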